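(* Let $d,m,n\in\mathbb{N}$, let $a_1,\ldots,a_n\in\mathbb{C}^{d\times m}$ be deterministic matrices, let $b\in\mathbb{C}^{d\times d}_{\rm s.a.}$ be a deterministic self-adjoint matrix, and let $x=\sum_{i=1}^n a_i\otimes s_i$, where $s_1,\ldots,s_n$ is a free semicircular family. Let $\mathcal{A}$ be a $*$-subalgebra of $\mathbb{C}^{m\times m}$ and $\mathcal{B}$ be a $*$-subalgebra of $\mathbb{C}^{d\times d}$ such that the following conditions hold: $$b\in\mathcal{B},\qquad \sum_{i=1}^n a_iya_i^*\in\mathcal{B}\ \text{ for all } y\in\mathcal{A},\qquad \sum_{j=1}^n a_j^*za_j\in\mathcal{A}\ \text{ for all } z\in\mathcal{B}.$$ Then $$\lambda_{\rm max}(xx^*+b\otimes\mathbf{1})=\inf_{\substack{z\in\mathcal{B},\ z>0\\ \sum_j a_j^*za_j<\mathbf{1}}}\lambda_{\rm max}\Bigg(b+z^{-1}+\sum_{i=1}^n a_i\Bigg(\mathbf{1}-\sum_{j=1}^n a_j^*za_j\Bigg)^{-1}a_i^*\Bigg)$$ and $$\lambda_{\rm min}(xx^*+b\otimes\mathbf{1})=\sup_{z\in\mathcal{B},\ z<0}\,\lambda_{\rm min}\Bigg(b+z^{-1}+\sum_{i=1}^n a_i\Bigg(\mathbf{1}-\sum_{j=1}^n a_j^*za_j\Bigg)^{-1}a_i^*\Bigg),$$ where $z\in\mathbb{C}^{d\times d}_{\rm s.a.}$. Moreover, the infimum (respectively supremum) can be further restricted to those $z\in\mathcal{B}$ satisfying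 the indicated constraints for which the matrix inside $\lambda_{\rm max}(\cdots)$ (respectively $\lambda_{\rm min}(\cdots)$) on the right-hand side is a multiple of the identity, without changing its value.
   Context: $\mathbb{C}^{d\times d}_{\rm s.a.}$ is the set of self-adjoint $d\times d$ complex matrices; $\mathbf{1}$ is the identity (matrix or operator); $A>B$ for self-adjoint $A,B$ means $A-B$ is positive definite, and $z<0$ means $-z>0$. For self-adjoint $y$ with spectrum $\mathrm{sp}(y)$, $\lambda_{\rm max}(y)=\sup\mathrm{sp}(y)$ and $\lambda_{\rm min}(y)=\inf\mathrm{sp}(y)$. A free semicircular family $s_1,\ldots,s_n$ is a family of freely independent self-adjoint elements of a $C^*$-probability space (with faithful trace), each having the standard semicircular distribution (density $\frac{1}{2\pi}\sqrt{4-t^2}$ on $[-2,2]$); concretely, one may take $s_i=l_i+l_i^*$, where $l_i$ is the operator of left tensoring by the $i$-th coordinate vector $e_i$ of $\mathbb{C}^n$ (creation operator) on the free Fock space $\bigoplus_{k\ge 0}(\mathbb{C}^n)^{\otimes k}$. The operator $x$ is regarded as a $d\times m$ matrix whose entries are linear combinations of $s_1,\ldots,s_n$, so that $xx^*+b\otimes\mathbf{1}$ is a self-adjoint $d\times d$ matrix with operator entries.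
   Formalization: The *-subalgebra B is additionally assumed to contain the identity matrix; otherwise B contains no invertible z, so the infimum and supremum run over the empty set and the formulas fail (e.g. A = B = {0}, b = 0, all a_i = 0). *)

theory Defs
  imports "HOL-Analysis.Analysis"
begin

text \<open>
  Unital C*-algebras. The library has no class of complex algebras, so the complex scalar
  multiplication \<open>cscale\<close> is a parameter, required to extend the real one.
\<close>

class cstar_algebra = real_normed_algebra_1 + banach +
  fixes cscale :: "complex \<Rightarrow> 'a \<Rightarrow> 'a"
    and star :: "'a \<Rightarrow> 'a"
  assumes cscale_of_real: "cscale (complex_of_real r) x = scaleR r x"
    and cscale_add_left: "cscale (c + c') x = cscale c x + cscale c' x"
    and cscale_add_right: "cscale c (x + y) = cscale c x + cscale c y"
    and cscale_cscale: "cscale c (cscale c' x) = cscale (c * c') x"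
    and cscale_mult_left: "cscale c x * y = cscale c (x * y)"
    and cscale_mult_right: "x * cscale c y = cscale c (x * y)"
    and norm_cscale: "norm (cscale c x) = cmod c * norm x"
    and star_star: "star (star x) = x"
    and star_add: "star (x + y) = star x + star y"
    and star_cscale: "star (cscale c x) = cscale (cnj c) (star x)"
    and star_mult: "star (x * y) = star y * star x"
    and cstar_identity: "norm (star x * x) = (norm x)\<^sup>2"

instantiation complex :: cstar_algebra
begin

definition cscale_complex :: "complex \<Rightarrow> complex \<Rightarrow> complex"
  where "cscale_complex c x = c * x"

definition star_complex :: "complex \<Rightarrow> complex"
  where "star_complex x = cnj x"

instance
  by standard
    (simp_all add: cscale_complex_def star_complex_def algebra_simps scaleR_conv_of_real
      norm_mult power2_eq_square)

end


definition cadj :: "'a::cstar_algebra^'m^'d \<Rightarrow> 'a^'d^'m"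
  where "cadj X = (\<chi> i j. star (X $ j $ i))"

definition hermitian :: "'a::cstar_algebra^'d^'d \<Rightarrow> bool"
  where "hermitian X \<longleftrightarrow> cadj X = X"

text \<open>
  The spectrum in the algebra of \<open>d \<times> d\<close> matrices over \<open>'a\<close>. For \<open>'a = complex\<close> this is the
  set of eigenvalues; the library's \<^const>\<open>invertible\<close> asks for a two-sided inverse and does not
  need commutative entries.
\<close>

definition spectrum :: "'a::cstar_algebra^'d^'d \<Rightarrow> complex set"
  where "spectrum X = {c. \<not> invertible (X - mat (cscale c 1))}"

text \<open>Only meaningful for hermitian arguments, whose spectrum is a nonempty compact set of reals.\<close>

definition lambda_max :: "'a::cstar_algebra^'d^'d \<Rightarrow> real"
  where "lambda_max X = Sup {t. complex_of_real t \<in> spectrum X}"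

definition lambda_min :: "'a::cstar_algebra^'d^'d \<Rightarrow> real"
  where "lambda_min X = Inf {t. complex_of_real t \<in> spectrum X}"

definition tensor :: "complex^'m^'d \<Rightarrow> 'a::cstar_algebra \<Rightarrow> 'a^'m^'d"
  where "tensor a s = (\<chi> i j. cscale (a $ i $ j) s)"

definition posdef :: "complex^'d^'d \<Rightarrow> bool"
  where "posdef y \<longleftrightarrow>
    hermitian y \<and> (\<forall>v. v \<noteq> 0 \<longrightarrow> 0 < Re (\<Sum>i\<in>UNIV. cnj (v $ i) * (y *v v) $ i))"

text \<open>Not required to contain the identity matrix.\<close>

definition star_subalgebra :: "(complex^'d^'d) set \<Rightarrow> bool"
  where "star_subalgebra S \<longleftrightarrow>
    0 \<in> S \<and>
    (\<forall>y\<in>S. \<forall>z\<in>S. y + z \<in> S) \<and>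
    (\<forall>c. \<forall>y\<in>S. (\<chi> i j. c * y $ i $ j) \<in> S) \<and>
    (\<forall>y\<in>S. \<forall>z\<in>S. y ** z \<in> S) \<and>
    (\<forall>y\<in>S. cadj y \<in> S)"


text \<open>\<open>('a, \<tau>)\<close> is a C*-probability space with a faithful trace.\<close>

definition faithful_tracial_state :: "('a::cstar_algebra \<Rightarrow> complex) \<Rightarrow> bool"
  where "faithful_tracial_state \<tau> \<longleftrightarrow>
    (\<forall>x y. \<tau> (x + y) = \<tau> x + \<tau> y) \<and>
    (\<forall>c x. \<tau> (cscale c x) = c * \<tau> x) \<and>
    \<tau> 1 = 1 \<and>
    (\<forall>x. \<tau> (star x * x) \<in> \<real>\<^sub>\<ge>\<^sub>0) \<and>
    (\<forall>x y. \<tau> (x * y) = \<tau> (y * x)) \<and>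
    (\<forall>x. \<tau> (star x * x) = 0 \<longrightarrow> x = 0)"

inductive_set star_algebra_generated :: "'a::cstar_algebra set \<Rightarrow> 'a set"
  for S :: "'a set" where
  gen: "x \<in> S \<Longrightarrow> x \<in> star_algebra_generated S"
| one: "1 \<in> star_algebra_generated S"
| add: "x \<in> star_algebra_generated S \<Longrightarrow> y \<in> star_algebra_generated S
    \<Longrightarrow> x + y \<in> star_algebra_generated S"
| scale: "x \<in> star_algebra_generated S \<Longrightarrow> cscale c x \<in> star_algebra_generated S"
| mult: "x \<in> star_algebra_generated S \<Longrightarrow> y \<in> star_algebra_generated S
    \<Longrightarrow> x * y \<in> star_algebra_generated S"
| star: "x \<in> star_algebra_generated S \<Longrightarrow> star x \<in> star_algebra_generated S"

text \<open>
  Free independence: a product of centred elements of the unital *-algebras generated by the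
  individual \<open>s i\<close> has trace zero as soon as neighbouring factors come from different indices.
\<close>

definition freely_independent :: "('a::cstar_algebra \<Rightarrow> complex) \<Rightarrow> ('n \<Rightarrow> 'a) \<Rightarrow> bool"
  where "freely_independent \<tau> s \<longleftrightarrow>
    (\<forall>ws :: ('n \<times> 'a) list.
      ws \<noteq> [] \<and> distinct_adj (map fst ws) \<and>
      (\<forall>(i, x)\<in>set ws. x \<in> star_algebra_generated {s i} \<and> \<tau> x = 0)
      \<longrightarrow> \<tau> (prod_list (map snd ws)) = 0)"

text \<open>
  The distribution of a self-adjoint element is the compactly supported measure with the same
  moments; a compactly supported measure is determined by its moments.
\<close>

definition standard_semicircular :: "('a::cstar_algebra \<Rightarrow> complex) \<Rightarrow> 'a \<Rightarrow> bool"
  where "standard_semicircular \<tau> s \<longleftrightarrow>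
    star s = s \<and>
    (\<forall>k::nat. \<tau> (s ^ k) =
      complex_of_real (integral {-2..2} (\<lambda>t. t ^ k * (1 / (2 * pi) * sqrt (4 - t\<^sup>2)))))"

definition free_semicircular_family :: "('a::cstar_algebra \<Rightarrow> complex) \<Rightarrow> ('n \<Rightarrow> 'a) \<Rightarrow> bool"
  where "free_semicircular_family \<tau> s \<longleftrightarrow>
    (\<forall>i. standard_semicircular \<tau> (s i)) \<and> freely_independent \<tau> s"


definition lehner_matrix ::
    "('n::finite \<Rightarrow> complex^'m^'d) \<Rightarrow> complex^'d^'d \<Rightarrow> complex^'d^'d \<Rightarrow> complex^'d^'d"
  where "lehner_matrix a b z =
    b + matrix_inv z +
    (\<Sum>i\<in>UNIV. a i ** matrix_inv (mat 1 - (\<Sum>j\<in>UNIV. cadj (a j) ** z ** a j)) ** cadj (a i))"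

end

theory Submission
  imports Defs
begin

text \<open>
  The elements \<open>e\<^sub>w\<close>, for words \<open>w\<close>, given by
  \<open>s\<^sub>i e\<^sub>w = e\<^bsub>iw\<^esub> + [w = iw'] e\<^bsub>w'\<^esub>\<close> are products of Chebyshev polynomials in
  the \<open>s\<^sub>i\<close> with distinct neighbours, hence orthonormal for the trace. So on vectors
  \<open>v = (v\<^sub>w)\<close> over the tree of words \<open>\<epsilon> (x x\<^sup>* + b - t)\<close>, \<open>\<epsilon> = \<plusminus>1\<close>, is an explicit quadratic
  form. The sign \<open>\<epsilon> = -1\<close> serves the largest and \<open>\<epsilon> = 1\<close> the smallest spectral value; put
  \<open>P = - \<epsilon> z\<inverse>\<close> and \<open>\<kappa> = \<Sum>\<^sub>j a\<^sub>j\<^sup>* P\<inverse> a\<^sub>j\<close>.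

  If \<open>P \<le> \<epsilon> (b - t) + \<epsilon> \<Sum>\<^sub>i a\<^sub>i (1 + \<epsilon> \<kappa>)\<inverse> a\<^sub>i\<^sup>*\<close>, which says that \<open>t\<close> bounds the matrix of \<open>z\<close>,
  the form is nonnegative, node by node, by completing squares. Conversely, if the form is
  coercive, iterate \<open>P \<mapsto> \<epsilon> (b - t) + \<epsilon> \<Sum>\<^sub>i a\<^sub>i (1 + \<epsilon> \<kappa>)\<inverse> a\<^sub>i\<^sup>*\<close>, starting from \<open>\<kappa> = 0\<close>. Each iterate
  is an energy of vectors on the tree, as a function of their root value, so the iterates
  decrease, stay coercive, and converge to a fixed point; there the matrix of \<open>z\<close> equals \<open>t\<close>.
  All iterates lie in \<open>\<B>\<close>.

  The spectrum is tied to quadratic forms without representation theory: for a faithful trace,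
  an element \<open>p\<close> with \<open>\<tau> (y\<^sup>* p y) \<ge> c \<tau> (y\<^sup>* y)\<close>, \<open>c > 0\<close>, is invertible, and Gaussian elimination
  extends this to matrices.
\<close>

section \<open>Square roots and inverses in a C*-algebra\<close>

text \<open>The words only reach the norm closure of the algebra generated by the
  \<open>s i\<close>, which may be smaller than the whole algebra. Coercivity is therefore known
  only for vectors with entries in that closure, and an inverse has to be built from inside it. This
  is why square roots, Neumann series and Gaussian elimination all track membership in a closed
  subalgebra, while the spectrum refers to the whole algebra. The converse direction works for
  \<open>t\<close> strictly beyond the spectrum: the gap is the coercivity constant that keeps
  \<open>P\<close> and 1 + \<epsilon> \<kappa> uniformly away from singular matrices, so that
  inverses pass to the limit. Infimum and supremum are thus approached by multiples of the identity
  and need not be attained; if all \<open>a i\<close> vanish, for instance, attaining them would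
  force the inverse of \<open>z\<close> to vanish in some direction.\<close>

lemma cscale_one [simp]: "cscale 1 x = x"
  using cscale_of_real[of 1 x] by simp

lemma cscale_zero_left [simp]: "cscale 0 x = 0"
  using cscale_of_real[of 0 x] by simp

lemma cscale_zero_right [simp]: "cscale c 0 = 0"
  using cscale_add_right[of c 0 0] by simp

lemma cscale_minus_left: "cscale (- c) x = - cscale c x"
  using cscale_add_left[of c "- c" x] by (simp add: eq_neg_iff_add_eq_0 add.commute)

lemma cscale_minus_right: "cscale c (- x) = - cscale c x"
  using cscale_add_right[of c x "- x"] by (simp add: eq_neg_iff_add_eq_0 add.commute)

lemma cscale_diff_right: "cscale c (x - y) = cscale c x - cscale c y"
  using cscale_add_right[of c x "- y"] by (simp add: cscale_minus_right)

lemma cscale_sum_right: "cscale c (\<Sum>i\<in>I. f i) = (\<Sum>i\<in>I. cscale c (f i))"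
  by (induction I rule: infinite_finite_induct) (simp_all add: cscale_add_right)

lemma cscale_sum_left: "cscale (\<Sum>i\<in>I. f i) x = (\<Sum>i\<in>I. cscale (f i) x)"
  by (induction I rule: infinite_finite_induct) (simp_all add: cscale_add_left)

lemma star_zero [simp]: "star 0 = 0"
  using star_add[of 0 0] by simp

lemma star_minus: "star (- x) = - star x"
  using star_add[of x "- x"] by (simp add: eq_neg_iff_add_eq_0 add.commute)

lemma star_diff: "star (x - y) = star x - star y"
  using star_add[of x "- y"] by (simp add: star_minus)

lemma star_scaleR: "star (scaleR r x) = scaleR r (star x)"
  using star_cscale[of "complex_of_real r" x] by (simp add: cscale_of_real)

lemma star_one [simp]: "star 1 = 1"
  by (metis star_mult star_star mult_1_left mult_1_right)

lemma star_sum: "star (\<Sum>i\<in>I. f i) = (\<Sum>i\<in>I. star (f i))"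
  by (induction I rule: infinite_finite_induct) (simp_all add: star_add)

lemma norm_star [simp]: "norm (star x) = norm (x :: 'a::cstar_algebra)"
proof -
  have le: "norm y \<le> norm (star y)" for y :: 'a
  proof (cases "norm y = 0")
    case False
    have "norm y * norm y \<le> norm (star y) * norm y"
      using norm_mult_ineq[of "star y" y] by (simp add: cstar_identity flip: power2_eq_square)
    moreover have "norm y > 0" using False by simp
    ultimately show ?thesis by simp
  qed simp
  show ?thesis using le[of x] le[of "star x"] by (simp add: star_star)
qed

lemma bounded_linear_star: "bounded_linear (star :: 'a::cstar_algebra \<Rightarrow> 'a)"
  by (rule bounded_linear_intro[where K = 1]) (simp_all add: star_add star_scaleR)

lemma bounded_linear_cscale: "bounded_linear (cscale c :: 'a::cstar_algebra \<Rightarrow> 'a)"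
proof (rule bounded_linear_intro[where K = "cmod c"])
  show "cscale c (scaleR r x) = scaleR r (cscale c x)" for r and x :: 'a
    unfolding cscale_of_real[symmetric] cscale_cscale by (simp add: mult.commute)
qed (simp_all add: cscale_add_right norm_cscale mult.commute)

definition closed_star_subalgebra :: "'a::cstar_algebra set \<Rightarrow> bool"
  where "closed_star_subalgebra C \<longleftrightarrow> closed C \<and> 1 \<in> C \<and>
    (\<forall>x\<in>C. \<forall>y\<in>C. x + y \<in> C) \<and> (\<forall>x\<in>C. \<forall>y\<in>C. x * y \<in> C) \<and>
    (\<forall>c. \<forall>x\<in>C. cscale c x \<in> C) \<and> (\<forall>x\<in>C. star x \<in> C)"

context
  fixes C :: "'a::cstar_algebra set"
  assumes C: "closed_star_subalgebra C"
begin

lemma csub_closed: "closed C"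
  and csub_one: "1 \<in> C"
  and csub_add: "\<And>x y. x \<in> C \<Longrightarrow> y \<in> C \<Longrightarrow> x + y \<in> C"
  and csub_mult: "\<And>x y. x \<in> C \<Longrightarrow> y \<in> C \<Longrightarrow> x * y \<in> C"
  and csub_cscale: "\<And>c x. x \<in> C \<Longrightarrow> cscale c x \<in> C"
  and csub_star: "\<And>x. x \<in> C \<Longrightarrow> star x \<in> C"
  using C unfolding closed_star_subalgebra_def by blast+

lemma csub_scaleR: "x \<in> C \<Longrightarrow> r *\<^sub>R x \<in> C"
  using csub_cscale[of x "complex_of_real r"] by (simp add: cscale_of_real)

lemma csub_zero: "0 \<in> C"
  using csub_scaleR[OF csub_one, of 0] by simp

lemma csub_minus: "x \<in> C \<Longrightarrow> - x \<in> C"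
  using csub_scaleR[of x "-1"] by simp

lemma csub_diff: "x \<in> C \<Longrightarrow> y \<in> C \<Longrightarrow> x - y \<in> C"
  using csub_add[of x "- y"] csub_minus[of y] by simp

lemma csub_sum: "(\<And>i. i \<in> I \<Longrightarrow> f i \<in> C) \<Longrightarrow> (\<Sum>i\<in>I. f i) \<in> C"
  by (induction I rule: infinite_finite_induct) (auto intro: csub_add csub_zero)

lemma csub_power: "x \<in> C \<Longrightarrow> x ^ n \<in> C"
  by (induction n) (auto intro: csub_mult csub_one)

text \<open>Running a construction inside this subalgebra instead of \<open>C\<close> yields a
  result that commutes with \<open>h\<close>; \<open>sqrt_one_minus\<close> itself need not mention
  commutation.\<close>

lemma csub_commutant:
  assumes "star h = h"
  shows "closed_star_subalgebra {y\<in>C. y * h = h * y}"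
  unfolding closed_star_subalgebra_def
proof (intro conjI ballI allI)
  have "closed {y. y * h = h * y}"
    by (intro closed_Collect_eq continuous_intros)
  moreover have "{y\<in>C. y * h = h * y} = C \<inter> {y. y * h = h * y}" by blast
  ultimately show "closed {y\<in>C. y * h = h * y}"
    using csub_closed by (simp add: closed_Int)
  show "1 \<in> {y\<in>C. y * h = h * y}" using csub_one by simp
  fix x y assume x: "x \<in> {y\<in>C. y * h = h * y}" and y: "y \<in> {y\<in>C. y * h = h * y}"
  show "x + y \<in> {y\<in>C. y * h = h * y}"
    using x y csub_add by (auto simp: algebra_simps)
  show "x * y \<in> {y\<in>C. y * h = h * y}"
    using x y csub_mult by (auto simp: mult.assoc) (metis mult.assoc)
next
  fix c x assume x: "x \<in> {y\<in>C. y * h = h * y}"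
  show "cscale c x \<in> {y\<in>C. y * h = h * y}"
    using x csub_cscale by (auto simp: cscale_mult_left cscale_mult_right)
next
  fix x assume x: "x \<in> {y\<in>C. y * h = h * y}"
  have "star x * h = h * star x"
    using x star_mult[of x h] star_mult[of h x] assms by simp
  then show "star x \<in> {y\<in>C. y * h = h * y}" using x csub_star by simp
qed

text \<open>The iteration \<open>Y \<mapsto> (h + Y\<^sup>2) / 2\<close> is dominated, increment by increment, by the same
  iteration for the number \<open>1\<close>, which increases and is bounded by \<open>1\<close>. So it converges even if
  \<open>\<parallel>h\<parallel> = 1\<close>, where it is not a contraction.\<close>

lemma sqrt_one_minus:
  assumes h: "star h = h" "norm h \<le> 1" "h \<in> C"
  obtains Y where "Y \<in> C" "star Y = Y" "norm Y \<le> 1" "(1 - Y)\<^sup>2 = 1 - h"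
proof -
  define Yf where "Yf = rec_nat (0::'a) (\<lambda>_ Y. (1/2) *\<^sub>R (h + Y\<^sup>2))"
  define yf where "yf = rec_nat (0::real) (\<lambda>_ y. (1/2) * (1 + y\<^sup>2))"
  have Y0: "Yf 0 = 0" and YS: "\<And>n. Yf (Suc n) = (1/2) *\<^sub>R (h + (Yf n)\<^sup>2)"
    by (simp_all add: Yf_def)
  have y0: "yf 0 = 0" and yS: "\<And>n. yf (Suc n) = (1/2) * (1 + (yf n)\<^sup>2)"
    by (simp_all add: yf_def)
  have ybd: "0 \<le> yf n \<and> yf n \<le> 1" for n
  proof (induction n)
    case (Suc n)
    then have "(yf n)\<^sup>2 \<le> 1" by (simp add: power_le_one)
    then show ?case by (simp add: yS)
  qed (simp add: y0)
  have YC: "Yf n \<in> C" for n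
    by (induction n) (auto simp: Y0 YS csub_zero power2_eq_square intro!: csub_scaleR csub_add csub_mult h)
  have Yst: "star (Yf n) = Yf n" for n
    by (induction n) (auto simp: Y0 YS star_scaleR star_add power2_eq_square star_mult h)
  have Ybd: "norm (Yf n) \<le> yf n" for n
  proof (induction n)
    case (Suc n)
    have "norm ((Yf n)\<^sup>2) \<le> (yf n)\<^sup>2"
      using Suc norm_power_ineq[of "Yf n" 2] power_mono[of "norm (Yf n)" "yf n" 2] by simp
    then have "norm (h + (Yf n)\<^sup>2) \<le> 1 + (yf n)\<^sup>2"
      using norm_triangle_ineq[of h "(Yf n)\<^sup>2"] h(2) by simp
    then show ?case by (simp add: YS yS)
  qed (simp add: Y0 y0)
  have inc: "norm (Yf (Suc n) - Yf n) \<le> yf (Suc n) - yf n" for n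
  proof (induction n)
    case 0
    then show ?case using h(2) by (simp add: Y0 y0 YS yS)
  next
    case (Suc n)
    let ?A = "Yf (Suc n)" and ?B = "Yf n" and ?a = "yf (Suc n)" and ?b = "yf n"
    \<comment> \<open>Commutation of successive iterates is not tracked, so the difference of
      squares is written symmetrically.\<close>
    have eq: "?A\<^sup>2 - ?B\<^sup>2 = (1/2) *\<^sub>R ((?A - ?B) * (?A + ?B) + (?A + ?B) * (?A - ?B))"
    proof -
      have "2 *\<^sub>R (?A\<^sup>2 - ?B\<^sup>2) = (?A - ?B) * (?A + ?B) + (?A + ?B) * (?A - ?B)"
        by (simp add: power2_eq_square algebra_simps scaleR_2)
      then show ?thesis
        by (metis (no_types) scaleR_half_double scaleR_2)
    qed
    have s: "norm (?A + ?B) \<le> ?a + ?b"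
      using norm_triangle_ineq[of ?A ?B] Ybd[of n] Ybd[of "Suc n"] by linarith
    have 1: "norm ((?A - ?B) * (?A + ?B)) \<le> (?a - ?b) * (?a + ?b)"
      by (rule order_trans[OF norm_mult_ineq]) (rule mult_mono, use Suc s ybd order_trans[OF norm_ge_zero Suc] in auto)
    have 2: "norm ((?A + ?B) * (?A - ?B)) \<le> (?a + ?b) * (?a - ?b)"
      by (rule order_trans[OF norm_mult_ineq]) (rule mult_mono, use Suc s ybd order_trans[OF norm_ge_zero s] in auto)
    have "norm (?A\<^sup>2 - ?B\<^sup>2) \<le> ?a\<^sup>2 - ?b\<^sup>2"
    proof -
      have "norm ((?A - ?B) * (?A + ?B) + (?A + ?B) * (?A - ?B)) \<le> 2 * (?a\<^sup>2 - ?b\<^sup>2)"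
        by (rule order_trans[OF norm_triangle_ineq])
           (use add_mono[OF 1 2] in \<open>simp add: power2_eq_square algebra_simps\<close>)
      then show ?thesis unfolding eq norm_scaleR by simp
    qed
    moreover have "Yf (Suc (Suc n)) - ?A = (1/2) *\<^sub>R (?A\<^sup>2 - ?B\<^sup>2)"
      unfolding YS[of "Suc n"] by (subst (2) YS) (simp add: scaleR_right_diff_distrib scaleR_right_distrib)
    moreover have "yf (Suc (Suc n)) - ?a = (1/2) * (?a\<^sup>2 - ?b\<^sup>2)"
      unfolding yS[of "Suc n"] by (subst (2) yS) (simp add: field_simps)
    ultimately show ?case by simp
  qed
  have ysum: "summable (\<lambda>n. yf (Suc n) - yf n)"
  proof (rule summableI_nonneg_bounded[where x = 1])
    show "0 \<le> yf (Suc n) - yf n" for n using inc[of n] norm_ge_zero order_trans by blast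
    show "(\<Sum>i<n. yf (Suc i) - yf i) \<le> 1" for n
      using ybd[of n] by (simp add: sum_lessThan_telescope y0)
  qed
  have "summable (\<lambda>n. Yf (Suc n) - Yf n)"
    by (rule summable_comparison_test'[OF ysum, of 0]) (use inc in auto)
  then obtain Y where "(\<lambda>n. \<Sum>i<n. Yf (Suc i) - Yf i) \<longlonglongrightarrow> Y"
    unfolding summable_def sums_def by blast
  then have lim: "Yf \<longlonglongrightarrow> Y" by (simp add: sum_lessThan_telescope Y0)
  have "(\<lambda>n. Yf (Suc n)) \<longlonglongrightarrow> (1/2) *\<^sub>R (h + Y\<^sup>2)"
    unfolding YS by (intro tendsto_intros lim)
  moreover have "(\<lambda>n. Yf (Suc n)) \<longlonglongrightarrow> Y" using lim by (rule LIMSEQ_Suc)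
  ultimately have fixpt: "Y = (1/2) *\<^sub>R (h + Y\<^sup>2)" by (rule LIMSEQ_unique[symmetric])
  have "Y + Y = 2 *\<^sub>R ((1/2) *\<^sub>R (h + Y\<^sup>2))"
    by (subst fixpt[symmetric]) (simp add: scaleR_2)
  then have YY: "Y + Y = h + Y * Y" by (simp add: power2_eq_square)
  have "(1 - Y)\<^sup>2 = 1 - (Y + Y) + Y * Y"
    by (simp add: power2_eq_square algebra_simps)
  also have "\<dots> = 1 - h" unfolding YY by simp
  finally have "(1 - Y)\<^sup>2 = 1 - h" .
  moreover have "Y \<in> C" using csub_closed YC lim by (rule closed_sequentially)
  moreover have "star Y = Y"
  proof -
    have "(\<lambda>n. star (Yf n)) \<longlonglongrightarrow> star Y"
      by (rule bounded_linear.tendsto[OF bounded_linear_star lim])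
    then have "Yf \<longlonglongrightarrow> star Y" unfolding Yst .
    then show ?thesis using lim by (rule LIMSEQ_unique)
  qed
  moreover have "norm Y \<le> 1"
  proof (rule LIMSEQ_le_const2[OF tendsto_norm[OF lim]], intro exI allI impI)
    show "norm (Yf n) \<le> 1" for n using Ybd[of n] ybd[of n] by linarith
  qed
  ultimately show ?thesis using that by blast
qed

end

lemma csub_UNIV: "closed_star_subalgebra (UNIV :: 'a::cstar_algebra set)"
  by (simp add: closed_star_subalgebra_def)

text \<open>If \<open>j\<close> is a square root of 1 - k^2 commuting with \<open>k\<close>, then u
  = j + i k is unitary and \<open>j\<close> is its real part, so the norm of \<open>j\<close> is at
  most 1. This replaces functional calculus.\<close>

lemma norm_one_minus_square_le:
  fixes k :: "'a::cstar_algebra"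
  assumes k: "star k = k" "norm k \<le> 1"
  shows "norm (1 - k\<^sup>2) \<le> 1"
proof -
  have C: "closed_star_subalgebra {y\<in>UNIV. y * k = k * y}"
    by (rule csub_commutant[OF csub_UNIV k(1)])
  have "norm (k\<^sup>2) \<le> 1"
    using norm_power_ineq[of k 2] power_mono[OF k(2), of 2] by simp
  moreover have "star (k\<^sup>2) = k\<^sup>2" by (simp add: power2_eq_square star_mult k)
  moreover have "k\<^sup>2 \<in> {y\<in>UNIV. y * k = k * y}" by (simp add: power2_eq_square mult.assoc)
  ultimately obtain Y where Y: "Y * k = k * Y" "star Y = Y" "(1 - Y)\<^sup>2 = 1 - k\<^sup>2"
    using sqrt_one_minus[OF C, of "k\<^sup>2"] by blast
  define j where "j = 1 - Y"
  have j: "star j = j" "j * k = k * j" "j * j = 1 - k * k"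
    using Y by (simp_all add: j_def star_diff algebra_simps power2_eq_square)
  define u where "u = j + cscale \<i> k"
  have us: "star u = j - cscale \<i> k"
    by (simp add: u_def star_add star_cscale j k cscale_minus_left)
  have "star u * u = j * j + cscale \<i> (j * k) - cscale \<i> (k * j) + k * k"
    unfolding us by (simp add: u_def distrib_left left_diff_distrib cscale_mult_left
        cscale_mult_right cscale_cscale cscale_minus_left
        cscale_add_right cscale_diff_right)
  then have "star u * u = 1" by (simp add: j)
  then have "(norm u)\<^sup>2 = 1" using cstar_identity[of u] by simp
  then have "norm u = 1" using norm_ge_zero[of u] by (auto simp: power2_eq_1_iff)
  moreover have "2 *\<^sub>R j = u + star u" unfolding us by (simp add: u_def scaleR_2)
  then have "2 * norm j \<le> norm u + norm (star u)"
    using norm_triangle_ineq[of u "star u"] by (metis norm_scaleR abs_numeral)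
  ultimately have "norm j \<le> 1" by simp
  have "norm (1 - k\<^sup>2) = (norm j)\<^sup>2"
    using cstar_identity[of j] by (simp add: j power2_eq_square)
  then show ?thesis using \<open>norm j \<le> 1\<close> by (simp add: power_le_one)
qed

lemma neumann_inverse:
  fixes h :: "'a::cstar_algebra"
  assumes C: "closed_star_subalgebra C" and h: "h \<in> C" "norm h < 1"
  obtains q where "q \<in> C" "q * (1 - h) = 1" "(1 - h) * q = 1"
proof -
  obtain q where q: "(\<lambda>n. \<Sum>i<n. h ^ i) \<longlonglongrightarrow> q"
    using complete_algebra_summable_geometric[OF h(2)] unfolding summable_def sums_def by blast
  have hn: "(\<lambda>n. h ^ n) \<longlonglongrightarrow> 0" using LIMSEQ_power_zero[OF h(2)] .
  have e1: "(\<Sum>i<n. h ^ i) * (1 - h) = 1 - h ^ n" for n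
    by (induction n) (simp_all add: distrib_right, simp add: right_diff_distrib power_commutes)
  have e2: "(1 - h) * (\<Sum>i<n. h ^ i) = 1 - h ^ n" for n
    by (induction n) (simp_all add: distrib_left, simp add: left_diff_distrib)
  have "(\<lambda>n. (\<Sum>i<n. h ^ i) * (1 - h)) \<longlonglongrightarrow> q * (1 - h)" by (intro tendsto_intros q)
  moreover have "(\<lambda>n. 1 - h ^ n) \<longlonglongrightarrow> 1 - 0" by (intro tendsto_intros hn)
  ultimately have 1: "q * (1 - h) = 1" unfolding e1 using LIMSEQ_unique by fastforce
  have "(\<lambda>n. (1 - h) * (\<Sum>i<n. h ^ i)) \<longlonglongrightarrow> (1 - h) * q" by (intro tendsto_intros q)
  moreover have "(\<lambda>n. 1 - h ^ n) \<longlonglongrightarrow> 1 - 0" by (intro tendsto_intros hn)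
  ultimately have 2: "(1 - h) * q = 1" unfolding e2 using LIMSEQ_unique by fastforce
  have "q \<in> C"
    by (rule closed_sequentially[OF csub_closed[OF C] _ q])
       (intro csub_sum[OF C] csub_power[OF C] h)
  then show ?thesis using 1 2 that by blast
qed

text \<open>After scaling \<open>k\<close> to norm at most 1, the previous bound on 1 - k^2 makes
  k^2 + e a multiple of 1 - h with the norm of \<open>h\<close> below 1, so the Neumann series
  applies.\<close>

lemma square_plus_invertible:
  fixes k :: "'a::cstar_algebra"
  assumes C: "closed_star_subalgebra C" and k: "star k = k" "k \<in> C" and e: "0 < (e::real)"
  obtains q where "q \<in> C" "q * (k\<^sup>2 + e *\<^sub>R 1) = 1" "(k\<^sup>2 + e *\<^sub>R 1) * q = 1"
proof -
  define m where "m = norm k + 1"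
  have m: "m > 0" "norm k \<le> m" unfolding m_def by (simp_all add: add_nonneg_pos)
  define k' where "k' = (1/m) *\<^sub>R k"
  have "star k' = k'" "norm k' \<le> 1" using m by (simp_all add: k'_def star_scaleR k divide_le_eq)
  then have n: "norm (1 - k'\<^sup>2) \<le> 1" by (rule norm_one_minus_square_le)
  \<comment> \<open>Chosen so that (m^2 + e) (1 - r) = e, which leaves exactly k^2 + e after
    expanding.\<close>
  define r where "r = m\<^sup>2 / (m\<^sup>2 + e)"
  have mm: "m\<^sup>2 + e > 0" "m\<^sup>2 > 0" using e m by (simp_all add: add_pos_pos)
  have r: "0 \<le> r" "r < 1"
    unfolding r_def using mm e divide_less_eq_1_pos[OF mm(1), of "m\<^sup>2"] by (auto intro: divide_nonneg_pos)
  define h where "h = r *\<^sub>R (1 - k'\<^sup>2)"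
  have kk: "k'\<^sup>2 = (1/m\<^sup>2) *\<^sub>R k\<^sup>2" by (simp add: k'_def power2_eq_square)
  have "norm h \<le> r * 1" unfolding h_def norm_scaleR using r n by (intro mult_mono) auto
  then have "norm h < 1" using r by simp
  moreover have "h \<in> C" unfolding h_def k'_def power2_eq_square
    by (intro csub_scaleR[OF C] csub_diff[OF C] csub_mult[OF C] csub_one[OF C] k)
  ultimately obtain q where q: "q \<in> C" "q * (1 - h) = 1" "(1 - h) * q = 1"
    using neumann_inverse[OF C] by blast
  have "(m\<^sup>2 + e) * r = m\<^sup>2" using mm by (simp add: r_def)
  then have eq: "k\<^sup>2 + e *\<^sub>R 1 = (m\<^sup>2 + e) *\<^sub>R (1 - h)"
    using mm unfolding h_def scaleR_right_diff_distrib scaleR_scaleR kk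
    by (simp add: scaleR_right_diff_distrib scaleR_left_distrib)
  show ?thesis
  proof (rule that)
    show "(1/(m\<^sup>2 + e)) *\<^sub>R q \<in> C" by (rule csub_scaleR[OF C q(1)])
    show "(1/(m\<^sup>2 + e)) *\<^sub>R q * (k\<^sup>2 + e *\<^sub>R 1) = 1"
      "(k\<^sup>2 + e *\<^sub>R 1) * (1/(m\<^sup>2 + e)) *\<^sub>R q = 1"
      unfolding eq using mm q by simp_all
  qed
qed

section \<open>Positivity with respect to a faithful trace\<close>

locale faithful_trace =
  fixes \<tau> :: "'a::cstar_algebra \<Rightarrow> complex"
  assumes faithful: "faithful_tracial_state \<tau>"
begin

lemma trace_add: "\<tau> (x + y) = \<tau> x + \<tau> y"
  and trace_cscale: "\<tau> (cscale c x) = c * \<tau> x"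
  and trace_one: "\<tau> 1 = 1"
  and trace_square: "\<tau> (star x * x) \<in> \<real>\<^sub>\<ge>\<^sub>0"
  and trace_faithful: "\<tau> (star x * x) = 0 \<Longrightarrow> x = 0"
  using faithful unfolding faithful_tracial_state_def by blast+

lemma trace_scaleR: "\<tau> (r *\<^sub>R x) = r *\<^sub>R \<tau> x"
  using trace_cscale[of "complex_of_real r" x] by (simp add: cscale_of_real scaleR_conv_of_real)

lemma trace_zero [simp]: "\<tau> 0 = 0"
  using trace_scaleR[of 0 0] by simp

lemma trace_minus: "\<tau> (- x) = - \<tau> x"
  using trace_scaleR[of "-1" x] by simp

lemma trace_diff: "\<tau> (x - y) = \<tau> x - \<tau> y"
  using trace_add[of x "- y"] by (simp add: trace_minus)

text \<open>Polarization: \<tau> is real on the squares of \<open>x\<close>, \<open>1 + x\<close>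
  and \<open>1 + cscale \<i> x\<close>, which fixes the imaginary and the real part.\<close>

lemma trace_star: "\<tau> (star x) = cnj (\<tau> x)"
proof -
  have im: "Im (\<tau> (star y * y)) = 0" for y
    using trace_square[of y] by (auto simp: complex_nonneg_Reals_iff)
  have "Im (\<tau> (star x) + \<tau> x) = 0"
    using im[of "1 + x"] im[of x]
    by (simp add: star_add algebra_simps trace_add trace_one)
  moreover have "Im (\<i> * \<tau> x - \<i> * \<tau> (star x)) = 0"
    using im[of "1 + cscale \<i> x"] im[of x]
    by (simp add: star_add star_cscale algebra_simps trace_add trace_one trace_cscale
        cscale_mult_left cscale_mult_right cscale_cscale cscale_diff_right trace_diff)
  ultimately show ?thesis by (simp add: complex_eq_iff)
qed

text \<open>Quadratic forms of hermitian matrices are real, so the real part of the trace inner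
  product is enough and gives an ordinary real inner product.\<close>

definition rip :: "'a \<Rightarrow> 'a \<Rightarrow> real"
  where "rip x y = Re (\<tau> (star x * y))"

lemma rip_add_left: "rip (x + y) z = rip x z + rip y z"
  and rip_add_right: "rip x (y + z) = rip x y + rip x z"
  and rip_scaleR_left: "rip (r *\<^sub>R x) y = r * rip x y"
  and rip_scaleR_right: "rip x (r *\<^sub>R y) = r * rip x y"
  and rip_minus_right: "rip x (- y) = - rip x y"
  and rip_diff_left: "rip (x - y) z = rip x z - rip y z"
  and rip_diff_right: "rip x (y - z) = rip x y - rip x z"
  and rip_zero_left: "rip 0 y = 0"
  and rip_zero_right: "rip x 0 = 0"
  by (simp_all add: rip_def star_add distrib_left distrib_right trace_add star_scaleR trace_scaleR
      star_minus trace_minus star_diff left_diff_distrib right_diff_distrib trace_diff)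

lemma rip_sum_left: "rip (\<Sum>i\<in>I. f i) y = (\<Sum>i\<in>I. rip (f i) y)"
  by (induction I rule: infinite_finite_induct) (simp_all add: rip_zero_left rip_add_left)

lemma rip_sum_right: "rip x (\<Sum>i\<in>I. f i) = (\<Sum>i\<in>I. rip x (f i))"
  by (induction I rule: infinite_finite_induct) (simp_all add: rip_zero_right rip_add_right)

lemma rip_commute: "rip x y = rip y x"
proof -
  have "\<tau> (star x * y) = cnj (\<tau> (star y * x))"
    by (subst trace_star[symmetric]) (simp add: star_mult star_star)
  then show ?thesis by (simp add: rip_def)
qed

lemma rip_mult_left: "rip (x * y) z = rip y (star x * z)"
  by (simp add: rip_def star_mult mult.assoc)

lemma rip_nonneg: "0 \<le> rip x x"
  using trace_square[of x] by (simp add: rip_def complex_nonneg_Reals_iff)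

lemma rip_eq_0: "rip x x = 0 \<Longrightarrow> x = 0"
  using trace_square[of x] trace_faithful[of x]
  by (simp add: rip_def complex_nonneg_Reals_iff complex_eq_iff)

text \<open>Up to scaling, the difference of the two sides is the square length of (1 - Y) y, where
  (1 - Y)^2 is 1 minus the normalised \<open>star x * x\<close>.\<close>

lemma rip_mult_le: "rip (x * y) (x * y) \<le> (norm x)\<^sup>2 * rip y y"
proof (cases "x = 0")
  case False
  define h where "h = (1 / (norm x)\<^sup>2) *\<^sub>R (star x * x)"
  have "star h = h" by (simp add: h_def star_scaleR star_mult star_star)
  moreover have "norm h \<le> 1" using False by (simp add: h_def cstar_identity)
  ultimately obtain Y where Y: "star Y = Y" "(1 - Y)\<^sup>2 = 1 - h"
    using sqrt_one_minus[OF csub_UNIV, of h] by auto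
  have "0 \<le> rip ((1 - Y) * y) ((1 - Y) * y)" by (rule rip_nonneg)
  also have "\<dots> = rip y ((1 - Y)\<^sup>2 * y)"
    by (simp add: rip_mult_left star_diff Y(1) power2_eq_square mult.assoc)
  also have "\<dots> = rip y y - rip y (h * y)"
    by (simp add: Y(2) left_diff_distrib rip_diff_right)
  also have "rip y (h * y) = (1 / (norm x)\<^sup>2) * rip (x * y) (x * y)"
    by (simp add: h_def rip_scaleR_right rip_mult_left mult.assoc)
  finally show ?thesis using False by (simp add: field_simps)
qed (simp add: rip_zero_left)

lemma abs_rip_le: "\<bar>rip x y\<bar> \<le> (rip x x + rip y y) / 2"
  using rip_nonneg[of "x + y"] rip_nonneg[of "x - y"]
  by (simp add: rip_add_left rip_add_right rip_diff_left rip_diff_right rip_commute)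

lemma rip_le_norm: "rip x x \<le> (norm x)\<^sup>2"
  using rip_mult_le[of x 1] by (simp add: rip_def trace_one)

text \<open>The crude factor 2 comes from estimating real and imaginary part separately; the aim is
  continuity of \<tau>.\<close>

lemma norm_trace_le: "norm (\<tau> x) \<le> 2 * norm x"
proof (cases "x = 0")
  case False
  have re: "\<bar>Re (\<tau> z)\<bar> \<le> 1" if "norm z = 1" for z
    using abs_rip_le[of 1 z] rip_le_norm[of z] rip_le_norm[of 1] that by (simp add: rip_def)
  have re: "\<bar>Re (\<tau> z)\<bar> \<le> norm z" for z
  proof (cases "z = 0")
    case False
    then show ?thesis using re[of "(1 / norm z) *\<^sub>R z"]
      by (simp add: trace_scaleR abs_mult divide_le_eq)
  qed simp
  have "\<bar>Im (\<tau> x)\<bar> \<le> norm x" using re[of "cscale (- \<i>) x"] by (simp add: trace_cscale norm_cscale)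
  then show ?thesis using re[of x] cmod_le[of "\<tau> x"] by linarith
qed simp

lemma bounded_linear_trace: "bounded_linear \<tau>"
  using norm_trace_le
  by (intro bounded_linear_intro[where K = 2]) (simp_all add: trace_add trace_scaleR mult.commute)

lemma tendsto_rip:
  assumes "(f \<longlongrightarrow> x) F" "(g \<longlongrightarrow> y) F"
  shows "((\<lambda>n. rip (f n) (g n)) \<longlongrightarrow> rip x y) F"
  unfolding rip_def
  by (intro tendsto_intros bounded_linear.tendsto[OF bounded_linear_trace]
      bounded_linear.tendsto[OF bounded_linear_star] assms)

text \<open>With \<open>r = |p|\<close> a square one has \<open>(r - p) (r + p) = 0\<close>; positivity of \<open>r + p\<close> and
  faithfulness force \<open>r = p\<close>.\<close>

lemma coercive_imp_square:
  assumes C: "closed_star_subalgebra C" and p: "star p = p" "p \<in> C" and c: "0 < c"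
    and pos: "\<And>y. y \<in> C \<Longrightarrow> c * rip y y \<le> rip y (p * y)"
  obtains k where "star k = k" "k \<in> C" "p = k\<^sup>2"
proof -
  have normalised: "\<exists>k. star k = k \<and> k \<in> C \<and> p = k\<^sup>2"
    if p: "star p = p" "p \<in> C" and c: "0 < c" and n: "norm p \<le> 1"
      and pos: "\<And>y. y \<in> C \<Longrightarrow> c * rip y y \<le> rip y (p * y)" for p c
  proof -
    \<comment> \<open>In the commutant of \<open>p\<close> the root \<open>r\<close> of p^2 commutes
      with \<open>p\<close>, which is what makes (r + p) (r - p) vanish.\<close>
    let ?C = "{y\<in>C. y * p = p * y}"
    have C': "closed_star_subalgebra ?C" by (rule csub_commutant[OF C p(1)])
    have "p\<^sup>2 \<in> ?C" using p csub_mult[OF C] by (simp add: power2_eq_square mult.assoc)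
    then have "1 - p\<^sup>2 \<in> ?C" using csub_diff[OF C' csub_one[OF C']] by blast
    moreover have "norm (1 - p\<^sup>2) \<le> 1" by (rule norm_one_minus_square_le[OF p(1) n])
    moreover have "star (1 - p\<^sup>2) = 1 - p\<^sup>2" by (simp add: star_diff star_mult power2_eq_square p)
    ultimately obtain Y where Y: "Y \<in> ?C" "star Y = Y" "norm Y \<le> 1" "(1 - Y)\<^sup>2 = 1 - (1 - p\<^sup>2)"
      using sqrt_one_minus[OF C'] by blast
    \<comment> \<open>A second root, this time of \<open>r\<close> itself: writing r = k^2 shows
      that \<open>r\<close> is positive for the trace form.\<close>
    obtain Y' where Y': "Y' \<in> C" "star Y' = Y'" "(1 - Y')\<^sup>2 = 1 - Y"
      using sqrt_one_minus[OF C, of Y] Y by blast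
    define r where "r = 1 - Y"
    define k where "k = 1 - Y'"
    have k: "star k = k" "k \<in> C" "k * k = r"
      using Y' csub_diff[OF C csub_one[OF C]] by (auto simp: k_def r_def star_diff power2_eq_square)
    have r: "star r = r" "r \<in> C" "r * p = p * r" "r * r = p * p"
      using Y csub_diff[OF C csub_one[OF C]]
      by (auto simp: r_def star_diff power2_eq_square algebra_simps)
    define W where "W = r - p"
    have W: "W \<in> C" "star W = W" using csub_diff[OF C] r p by (auto simp: W_def star_diff)
    have "(r + p) * W = 0" by (simp add: W_def algebra_simps r)
    then have "rip W (r * W) + rip W (p * W) = 0"
      by (simp add: rip_add_right[symmetric] distrib_right[symmetric] rip_zero_right)
    moreover have "rip W (r * W) = rip (k * W) (k * W)"
      by (simp add: rip_mult_left k mult.assoc[symmetric])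
    ultimately have "c * rip W W \<le> 0" using pos[OF W(1)] rip_nonneg[of "k * W"] by linarith
    then have "rip W W = 0" using c rip_nonneg[of W] by (simp add: mult_le_0_iff)
    then have "W = 0" by (rule rip_eq_0)
    then show ?thesis using k by (intro exI[of _ k]) (simp add: W_def power2_eq_square)
  qed
  define m where "m = norm p + 1"
  have m: "m > 0" "norm p \<le> m" unfolding m_def by (simp_all add: add_nonneg_pos)
  have "\<exists>k. star k = k \<and> k \<in> C \<and> (1/m) *\<^sub>R p = k\<^sup>2"
  proof (rule normalised[where c = "c / m"])
    show "norm ((1 / m) *\<^sub>R p) \<le> 1" using m by (simp add: divide_le_eq)
    show "c / m * rip y y \<le> rip y ((1 / m) *\<^sub>R p * y)" if "y \<in> C" for y
      using pos[OF that] m by (simp add: rip_scaleR_right divide_right_mono)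
  qed (use p csub_scaleR[OF C] c m in \<open>simp_all add: star_scaleR\<close>)
  then obtain k where k: "star k = k" "k \<in> C" "(1/m) *\<^sub>R p = k\<^sup>2" by blast
  have "p = m *\<^sub>R k\<^sup>2" using m by (simp flip: k(3))
  also have "\<dots> = (sqrt m *\<^sub>R k)\<^sup>2" using m by (simp add: power2_eq_square)
  finally show ?thesis using that[of "sqrt m *\<^sub>R k"] k csub_scaleR[OF C] by (simp add: star_scaleR)
qed

text \<open>Half of the coercivity is set aside: p - c/2 is still coercive, hence a square, and a
  square plus the positive number c/2 is invertible inside \<open>C\<close>.\<close>

lemma coercive_imp_inverse:
  assumes C: "closed_star_subalgebra C" and p: "star p = p" "p \<in> C" and c: "0 < c"
    and pos: "\<And>y. y \<in> C \<Longrightarrow> c * rip y y \<le> rip y (p * y)"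
  obtains q where "q \<in> C" "star q = q" "q * p = 1" "p * q = 1"
proof -
  let ?p = "p - (c/2) *\<^sub>R 1"
  obtain k where k: "star k = k" "k \<in> C" "?p = k\<^sup>2"
  proof (rule coercive_imp_square[OF C])
    show "0 < c / 2" using c by simp
    show "star ?p = ?p" by (simp add: star_diff star_scaleR p)
    show "?p \<in> C" by (intro csub_diff[OF C] csub_scaleR[OF C] csub_one[OF C] p)
    show "c / 2 * rip y y \<le> rip y (?p * y)" if "y \<in> C" for y
      using pos[OF that] by (simp add: left_diff_distrib rip_diff_right rip_scaleR_right)
  qed blast
  then have eq: "p = k\<^sup>2 + (c/2) *\<^sub>R 1" by (simp add: algebra_simps)
  obtain q where q: "q \<in> C" "q * p = 1" "p * q = 1"
    using square_plus_invertible[OF C k(1,2), of "c/2"] c unfolding eq by auto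
  have "star q * p = 1" using arg_cong[OF q(3), of star] by (simp add: star_mult p)
  then have "star q = q" using q(3) by (metis mult.assoc mult_1_left mult_1_right)
  then show ?thesis using q that by blast
qed

end

section \<open>Matrices over a C*-algebra\<close>

lemma cadj_nth [simp]: "cadj T $ i $ j = star (T $ j $ i)"
  by (simp add: cadj_def)

lemma cadj_cadj [simp]: "cadj (cadj T) = T"
  by (simp add: vec_eq_iff star_star)

lemma cadj_add: "cadj (S + T) = cadj S + cadj T"
  and cadj_diff: "cadj (S - T) = cadj S - cadj T"
  and cadj_minus: "cadj (- T) = - cadj T"
  and cadj_scaleR: "cadj (r *\<^sub>R T) = r *\<^sub>R cadj T"
  by (simp_all add: vec_eq_iff star_add star_diff star_minus star_scaleR)

lemma cadj_sum: "cadj (\<Sum>i\<in>I. f i) = (\<Sum>i\<in>I. cadj (f i))"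
  by (induction I rule: infinite_finite_induct) (simp_all add: cadj_add vec_eq_iff)

lemma cadj_mat: "cadj (mat c) = mat (star c)"
  by (simp add: vec_eq_iff mat_def)

lemma cadj_matrix_mult: "cadj (S ** T) = cadj T ** cadj S"
  by (simp add: vec_eq_iff matrix_matrix_mult_def star_sum star_mult)

lemma matrix_scaleR_mult_vector:
  fixes T :: "'a::real_algebra_1^'m^'d"
  shows "(r *\<^sub>R T) *v v = r *\<^sub>R (T *v v)" "T *v (r *\<^sub>R v) = r *\<^sub>R (T *v v)"
  by (simp_all add: vec_eq_iff matrix_vector_mult_def scaleR_sum_right)

lemma matrix_minus_mult_vector:
  fixes T :: "'a::ring_1^'m^'d"
  shows "(- T) *v v = - (T *v v)" "T *v (- v) = - (T *v v)"
  by (simp_all add: vec_eq_iff matrix_vector_mult_def sum_negf)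

lemma matrix_sum_mult_vector:
  fixes f :: "'i \<Rightarrow> 'a::semiring_1^'m^'d"
  shows "(\<Sum>i\<in>I. f i) *v v = (\<Sum>i\<in>I. f i *v v)"
  by (induction I rule: infinite_finite_induct) (simp_all add: matrix_vector_mult_add_rdistrib)

lemma mat_mult_vector: "mat c *v v = (\<chi> k. c * v $ k)"
  by (simp add: vec_eq_iff matrix_vector_mult_def mat_def if_distrib if_distribR cong: if_cong)

lemma matrix_minus_mult:
  fixes S :: "'a::ring_1^'m^'d" and T :: "'a^'k^'m"
  shows "(- S) ** T = - (S ** T)" "S ** (- T) = - (S ** T)"
  by (simp_all add: vec_eq_iff matrix_matrix_mult_def sum_negf)

lemma matrix_scaleR_mult:
  fixes S :: "'a::real_algebra_1^'m^'d" and T :: "'a^'k^'m"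
  shows "(r *\<^sub>R S) ** T = r *\<^sub>R (S ** T)" "S ** (r *\<^sub>R T) = r *\<^sub>R (S ** T)"
  by (simp_all add: vec_eq_iff matrix_matrix_mult_def scaleR_sum_right)

lemma matrix_add_rdistrib:
  fixes S T :: "'a::semiring_1^'m^'d" and U :: "'a^'k^'m"
  shows "(S + T) ** U = S ** U + T ** U"
  by (simp add: vec_eq_iff matrix_matrix_mult_def distrib_right sum.distrib)

lemma invertible_minus:
  fixes T :: "'a::ring_1^'d^'d"
  shows "invertible (- T) \<longleftrightarrow> invertible T"
proof -
  have "invertible (- S)" if S: "invertible S" for S :: "'a^'d^'d"
  proof -
    obtain R where "S ** R = mat 1" "R ** S = mat 1" using S unfolding invertible_def by blast
    then have "(- S) ** (- R) = mat 1" "(- R) ** (- S) = mat 1"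
      by (simp_all add: matrix_minus_mult)
    then show ?thesis unfolding invertible_def by blast
  qed
  from this[of T] this[of "- T"] show ?thesis by auto
qed

lemma square_le_mult_if_quadratic_nonneg:
  fixes a b c :: real
  assumes nonneg: "\<And>t. 0 \<le> a + 2 * t * b + t\<^sup>2 * c" and "0 \<le> c"
  shows "b\<^sup>2 \<le> a * c"
proof (cases "c = 0")
  case True
  have "b = 0"
  proof (rule ccontr)
    assume "b \<noteq> 0"
    \<comment> \<open>At this \<open>t\<close> the affine function a + 2 t b takes the value
      -1.\<close>
    then show False using nonneg[of "- (a + 1) / (2 * b)"] True by (simp add: field_simps)
  qed
  then show ?thesis using nonneg[of 0] True by simp
next
  case False
  then have "c > 0" using assms by simp
  then show ?thesis using nonneg[of "- b / c"] by (simp add: power2_eq_square field_simps)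
qed

section \<open>The trace form on vectors, and the spectrum of hermitian matrices\<close>

definition vecs :: "'a set \<Rightarrow> ('a^'d) set"
  where "vecs C = {v. \<forall>k. v $ k \<in> C}"

lemma matrix_vector_in_vecs:
  assumes "closed_star_subalgebra C" "\<And>i j. T $ i $ j \<in> C" "v \<in> vecs C"
  shows "T *v v \<in> vecs C"
  using assms unfolding vecs_def matrix_vector_mult_def
  by (auto intro!: csub_sum csub_mult)

context faithful_trace
begin

definition vip :: "'a^'d \<Rightarrow> 'a^'d \<Rightarrow> real"
  where "vip v w = (\<Sum>k\<in>UNIV. rip (v $ k) (w $ k))"

lemma vip_add_left: "vip (u + v) w = vip u w + vip v w"
  and vip_add_right: "vip u (v + w) = vip u v + vip u w"
  and vip_diff_left: "vip (u - v) w = vip u w - vip v w"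
  and vip_diff_right: "vip u (v - w) = vip u v - vip u w"
  and vip_minus_right: "vip u (- v) = - vip u v"
  and vip_scaleR_left: "vip (r *\<^sub>R u) v = r * vip u v"
  and vip_scaleR_right: "vip u (r *\<^sub>R v) = r * vip u v"
  by (simp_all add: vip_def rip_add_left rip_add_right rip_diff_left rip_diff_right
      rip_minus_right rip_scaleR_left rip_scaleR_right
      sum.distrib sum_subtractf sum_negf sum_distrib_left)

lemma vip_commute: "vip v w = vip w v"
  unfolding vip_def by (simp add: rip_commute)

lemma vip_nonneg: "0 \<le> vip v v"
  unfolding vip_def by (intro sum_nonneg rip_nonneg)

lemma vip_cadj: "vip (T *v v) w = vip v (cadj T *v w)"
proof -
  have "vip (T *v v) w = (\<Sum>i\<in>UNIV. \<Sum>j\<in>UNIV. rip (v $ j) (star (T $ i $ j) * w $ i))"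
    by (simp add: vip_def matrix_vector_mult_def rip_sum_left rip_mult_left)
  also have "\<dots> = (\<Sum>j\<in>UNIV. \<Sum>i\<in>UNIV. rip (v $ j) (star (T $ i $ j) * w $ i))"
    by (rule sum.swap)
  also have "\<dots> = vip v (cadj T *v w)"
    by (simp add: vip_def matrix_vector_mult_def rip_sum_right)
  finally show ?thesis .
qed

lemma abs_vip_le: "\<bar>vip v w\<bar> \<le> (vip v v + vip w w) / 2"
  using vip_nonneg[of "v + w"] vip_nonneg[of "v - w"]
  by (simp add: vip_add_left vip_add_right vip_diff_left vip_diff_right vip_commute)

lemma rip_sum_le:
  "rip (\<Sum>i\<in>I. f i) (\<Sum>i\<in>I. f i) \<le> card I * (\<Sum>i\<in>I. rip (f i) (f i))"
proof -
  have "rip (\<Sum>i\<in>I. f i) (\<Sum>i\<in>I. f i) = (\<Sum>i\<in>I. \<Sum>j\<in>I. rip (f i) (f j))"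
    by (simp only: rip_sum_left[of _ I "\<Sum>i\<in>I. f i"]) (simp only: rip_sum_right)
  also have "\<dots> \<le> (\<Sum>i\<in>I. \<Sum>j\<in>I. (rip (f i) (f i) + rip (f j) (f j)) / 2)"
    by (intro sum_mono order_trans[OF abs_ge_self abs_rip_le])
  also have "\<dots> = card I * (\<Sum>i\<in>I. rip (f i) (f i))"
    by (simp add: add_divide_distrib sum.distrib sum_distrib_left sum_divide_distrib
        flip: sum_distrib_right)
  finally show ?thesis .
qed

lemma vip_matrix_bounded:
  fixes T :: "'a^'m^'d"
  obtains K where "0 \<le> K" "\<And>v. vip (T *v v) (T *v v) \<le> K * vip v v"
proof -
  define M where "M = (\<Sum>i\<in>UNIV. \<Sum>j\<in>UNIV. (norm (T $ i $ j))\<^sup>2)"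
  have M: "(norm (T $ i $ j))\<^sup>2 \<le> M" for i j
    unfolding M_def
    by (rule order_trans[OF _ member_le_sum[of i]]) (auto intro: member_le_sum sum_nonneg)
  have row: "rip ((T *v v) $ i) ((T *v v) $ i) \<le> CARD('m) * (M * vip v v)" for v i
  proof -
    have "rip ((T *v v) $ i) ((T *v v) $ i)
        \<le> CARD('m) * (\<Sum>j\<in>UNIV. rip (T $ i $ j * v $ j) (T $ i $ j * v $ j))"
      unfolding matrix_vector_mult_def using rip_sum_le[of "\<lambda>j. T $ i $ j * v $ j" UNIV] by simp
    also have "\<dots> \<le> CARD('m) * (\<Sum>j\<in>UNIV. M * rip (v $ j) (v $ j))"
      by (intro mult_left_mono sum_mono order_trans[OF rip_mult_le] mult_right_mono M rip_nonneg) auto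
    finally show ?thesis by (simp add: vip_def sum_distrib_left)
  qed
  have "vip (T *v v) (T *v v) \<le> (CARD('d) * (CARD('m) * M)) * vip v v" for v
  proof -
    have "vip (T *v v) (T *v v) \<le> (\<Sum>i\<in>(UNIV::'d set). CARD('m) * (M * vip v v))"
      unfolding vip_def[of "T *v v"] by (intro sum_mono row)
    then show ?thesis by (simp add: mult.assoc)
  qed
  moreover have "0 \<le> CARD('d) * (CARD('m) * M)" by (simp add: M_def sum_nonneg)
  ultimately show ?thesis by (rule that[rotated])
qed

lemma vip_Cauchy_Schwarz:
  assumes C: "closed_star_subalgebra C" and T: "hermitian T"
    and pos: "\<And>v. v \<in> vecs C \<Longrightarrow> 0 \<le> vip v (T *v v)"
    and v: "v \<in> vecs C" and w: "w \<in> vecs C"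
  shows "(vip v (T *v w))\<^sup>2 \<le> vip v (T *v v) * vip w (T *v w)"
proof (rule square_le_mult_if_quadratic_nonneg)
  fix t :: real
  have "v + t *\<^sub>R w \<in> vecs C"
    using v w by (auto simp: vecs_def intro: csub_add[OF C] csub_scaleR[OF C])
  then have "0 \<le> vip (v + t *\<^sub>R w) (T *v (v + t *\<^sub>R w))" by (rule pos)
  moreover have "vip w (T *v v) = vip v (T *v w)"
    using T by (metis hermitian_def vip_cadj vip_commute)
  ultimately show "0 \<le> vip v (T *v v) + 2 * t * vip v (T *v w) + t\<^sup>2 * vip w (T *v w)"
    by (simp add: matrix_vector_right_distrib matrix_scaleR_mult_vector vip_add_left vip_add_right
        vip_scaleR_left vip_scaleR_right power2_eq_square algebra_simps)
qed (rule pos[OF w])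

text \<open>Gaussian elimination: the pivot is coercive, hence invertible, and the Schur complement
  inherits coercivity.\<close>

lemma coercive_system_solvable:
  assumes C: "closed_star_subalgebra C" and "finite S" and c: "0 < c"
    and "\<And>i j. i \<in> S \<Longrightarrow> j \<in> S \<Longrightarrow> T i j \<in> C"
    and "\<And>i j. i \<in> S \<Longrightarrow> j \<in> S \<Longrightarrow> star (T i j) = T j i"
    and "\<And>v. (\<And>i. i \<in> S \<Longrightarrow> v i \<in> C) \<Longrightarrow>
      c * (\<Sum>i\<in>S. rip (v i) (v i)) \<le> (\<Sum>i\<in>S. \<Sum>j\<in>S. rip (v i) (T i j * v j))"
    and "\<And>i. i \<in> S \<Longrightarrow> w i \<in> C"
  shows "\<exists>v. (\<forall>i\<in>S. v i \<in> C) \<and> (\<forall>i\<in>S. (\<Sum>j\<in>S. T i j * v j) = w i)"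
  using assms(2,4-)
proof (induction S arbitrary: T w rule: finite_induct)
  case (insert a S)
  note TC = insert.prems(1) and Tst = insert.prems(2) and pos = insert.prems(3) and wC = insert.prems(4)
  note [simp] = insert.hyps(1,2)
  have ne: "i \<in> S \<Longrightarrow> i \<noteq> a" for i using insert.hyps by auto
  define p where "p = T a a"
  have "c * rip y y \<le> rip y (p * y)" if "y \<in> C" for y
  proof -
    have "c * (\<Sum>i\<in>insert a S. rip (if i = a then y else 0) (if i = a then y else 0))
      \<le> (\<Sum>i\<in>insert a S. \<Sum>j\<in>insert a S.
            rip (if i = a then y else 0) (T i j * (if j = a then y else 0)))"
      by (rule pos) (use that csub_zero[OF C] in auto)
    moreover have "(\<Sum>i\<in>S. rip (if i = a then y else 0) (if i = a then y else 0)) = 0"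
      by (intro sum.neutral) (auto simp: ne rip_zero_left)
    moreover have "(\<Sum>i\<in>S. \<Sum>j\<in>insert a S.
            rip (if i = a then y else 0) (T i j * (if j = a then y else 0))) = 0"
      by (intro sum.neutral ballI) (auto simp: ne rip_zero_left)
    moreover have "(\<Sum>j\<in>S. rip y (T a j * (if j = a then y else 0))) = 0"
      by (intro sum.neutral) (auto simp: ne rip_zero_right)
    ultimately show ?thesis by (simp add: p_def)
  qed
  then obtain q where q: "q \<in> C" "star q = q" "q * p = 1" "p * q = 1"
    using coercive_imp_inverse[OF C, of p c] TC[of a a] Tst[of a a] c unfolding p_def by auto
  define T' where "T' i j = T i j - T i a * q * T a j" for i j
  define g where "g v = (\<Sum>j\<in>S. T a j * v j)" for v :: "'b \<Rightarrow> 'a"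
  have T'sum: "(\<Sum>j\<in>S. T' i j * v j) = (\<Sum>j\<in>S. T i j * v j) - T i a * (q * g v)" for i v
    by (simp add: T'_def g_def left_diff_distrib sum_subtractf sum_distrib_left mult.assoc)
  have gC: "g v \<in> C" if "\<And>i. i \<in> S \<Longrightarrow> v i \<in> C" for v
    unfolding g_def by (intro csub_sum[OF C] csub_mult[OF C] TC that) auto
  have "\<exists>v. (\<forall>i\<in>S. v i \<in> C) \<and> (\<forall>i\<in>S. (\<Sum>j\<in>S. T' i j * v j) = w i - T i a * (q * w a))"
  proof (rule insert.IH)
    show "T' i j \<in> C" if "i \<in> S" "j \<in> S" for i j
      unfolding T'_def using that by (intro csub_diff[OF C] csub_mult[OF C] TC q) auto
    show "star (T' i j) = T' j i" if "i \<in> S" "j \<in> S" for i j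
      using that by (simp add: T'_def star_diff star_mult Tst q mult.assoc)
    show "w i - T i a * (q * w a) \<in> C" if "i \<in> S" for i
      using that by (intro csub_diff[OF C] csub_mult[OF C] TC q wC) auto
    fix v :: "'b \<Rightarrow> 'a" assume v: "\<And>i. i \<in> S \<Longrightarrow> v i \<in> C"
    \<comment> \<open>The pivot coordinate that annihilates row \<open>a\<close>; with it the form
      of \<open>T\<close> at the extended vector equals the form of the Schur complement at
      \<open>v\<close>.\<close>
    define y where "y = - (q * g v)"
    define v' where "v' = v(a := y)"
    have v'S: "(\<Sum>j\<in>S. f j (v' j)) = (\<Sum>j\<in>S. f j (v j))" for f :: "'b \<Rightarrow> 'a \<Rightarrow> 'c::comm_monoid_add"
      by (intro sum.cong) (auto simp: v'_def ne)
    have row: "(\<Sum>j\<in>insert a S. T i j * v' j) = T i a * y + (\<Sum>j\<in>S. T i j * v j)" for i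
      using v'S[of "\<lambda>j x. T i j * x"] by (simp add: v'_def)
    have "p * y = - g v" by (simp add: y_def mult.assoc[symmetric] q)
    then have rowa: "(\<Sum>j\<in>insert a S. T a j * v' j) = 0"
      unfolding row by (simp add: p_def[symmetric] g_def)
    have rowi: "(\<Sum>j\<in>insert a S. T i j * v' j) = (\<Sum>j\<in>S. T' i j * v j)" for i
      unfolding row T'sum by (simp add: y_def)
    have "c * (\<Sum>i\<in>S. rip (v i) (v i)) \<le> c * (\<Sum>i\<in>insert a S. rip (v' i) (v' i))"
      using c rip_nonneg[of y] v'S[of "\<lambda>i x. rip x x"] by (simp add: v'_def)
    also have "\<dots> \<le> (\<Sum>i\<in>insert a S. \<Sum>j\<in>insert a S. rip (v' i) (T i j * v' j))"
    proof (rule pos)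
      have "y \<in> C" unfolding y_def by (intro csub_minus[OF C] csub_mult[OF C] q gC v)
      then show "v' i \<in> C" if "i \<in> insert a S" for i using that v by (auto simp: v'_def)
    qed
    also have "\<dots> = (\<Sum>i\<in>insert a S. rip (v' i) (\<Sum>j\<in>insert a S. T i j * v' j))"
      unfolding rip_sum_right ..
    also have "\<dots> = (\<Sum>i\<in>S. rip (v' i) (\<Sum>j\<in>insert a S. T i j * v' j))"
      using rowa by (subst sum.insert) (simp_all only: insert.hyps rip_zero_right add_0_left not_False_eq_True)
    also have "\<dots> = (\<Sum>i\<in>S. rip (v i) (\<Sum>j\<in>S. T' i j * v j))"
      unfolding rowi by (rule v'S)
    finally show "c * (\<Sum>i\<in>S. rip (v i) (v i)) \<le> (\<Sum>i\<in>S. \<Sum>j\<in>S. rip (v i) (T' i j * v j))"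
      unfolding rip_sum_right .
  qed
  then obtain v where v: "\<And>i. i \<in> S \<Longrightarrow> v i \<in> C"
    "\<And>i. i \<in> S \<Longrightarrow> (\<Sum>j\<in>S. T' i j * v j) = w i - T i a * (q * w a)" by blast
  define y where "y = q * (w a - g v)"
  define v' where "v' = v(a := y)"
  have "y \<in> C" unfolding y_def by (intro csub_diff[OF C] csub_mult[OF C] q gC v wC) auto
  then have "\<forall>i\<in>insert a S. v' i \<in> C" using v by (auto simp: v'_def)
  moreover have row: "(\<Sum>j\<in>insert a S. T i j * v' j) = T i a * y + (\<Sum>j\<in>S. T i j * v j)" for i
  proof -
    have "(\<Sum>j\<in>S. T i j * v' j) = (\<Sum>j\<in>S. T i j * v j)"
      by (intro sum.cong) (auto simp: v'_def ne)
    then show ?thesis by (simp add: v'_def)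
  qed
  have "p * y = w a - g v" by (simp add: y_def mult.assoc[symmetric] q)
  then have "(\<Sum>j\<in>insert a S. T a j * v' j) = w a"
    unfolding row by (simp add: p_def[symmetric] g_def)
  moreover have "(\<Sum>j\<in>insert a S. T i j * v' j) = w i" if "i \<in> S" for i
    using v(2)[OF that] unfolding row T'sum
    by (simp add: y_def right_diff_distrib algebra_simps)
  ultimately show ?case by (intro exI[of _ v']) auto
qed simp

text \<open>Solving for the unit vectors gives the columns of a right inverse; since
  \<open>T\<close> is hermitian, the adjoint of that matrix is a left inverse, and so the two
  agree.\<close>

lemma coercive_imp_invertible:
  fixes T :: "'a^'d^'d"
  assumes C: "closed_star_subalgebra C" and T: "hermitian T" "\<And>i j. T $ i $ j \<in> C" and c: "0 < c"
    and pos: "\<And>v. v \<in> vecs C \<Longrightarrow> c * vip v v \<le> vip v (T *v v)"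
  shows "invertible T"
proof -
  have Tst: "star (T $ i $ j) = T $ j $ i" for i j
    using T(1) cadj_nth[of T j i] by (simp add: hermitian_def)
  have "\<exists>v. (\<forall>i\<in>UNIV. v i \<in> C) \<and>
      (\<forall>i\<in>UNIV. (\<Sum>j\<in>UNIV. T $ i $ j * v j) = (if i = k then 1 else 0))" for k
  proof (rule coercive_system_solvable[OF C finite c])
    fix v :: "'d \<Rightarrow> 'a" assume "\<And>i. i \<in> UNIV \<Longrightarrow> v i \<in> C"
    then have "(\<chi> i. v i) \<in> vecs C" by (simp add: vecs_def)
    from pos[OF this]
    show "c * (\<Sum>i\<in>UNIV. rip (v i) (v i)) \<le> (\<Sum>i\<in>UNIV. \<Sum>j\<in>UNIV. rip (v i) (T $ i $ j * v j))"
      by (simp add: vip_def matrix_vector_mult_def rip_sum_right)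
  qed (use T(2) Tst csub_one[OF C] csub_zero[OF C] in auto)
  then have "\<forall>k. \<exists>v. \<forall>i. (\<Sum>j\<in>UNIV. T $ i $ j * v j) = (if i = k then 1 else 0)" by blast
  then obtain R where "\<forall>k i. (\<Sum>j\<in>UNIV. T $ i $ j * R k j) = (if i = k then 1 else 0)"
    unfolding choice_iff by blast
  then have R: "(\<Sum>j\<in>UNIV. T $ i $ j * R k j) = (if i = k then 1 else 0)" for i k by blast
  define Q where "Q = (\<chi> j k. R k j)"
  have TQ: "T ** Q = mat 1" by (simp add: vec_eq_iff matrix_matrix_mult_def Q_def R mat_def)
  have QT: "cadj Q ** T = mat 1"
    using arg_cong[OF TQ, of cadj] T(1) by (simp add: cadj_matrix_mult cadj_mat hermitian_def)
  have "cadj Q = cadj Q ** (T ** Q)" by (simp add: TQ)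
  also have "\<dots> = Q" by (simp add: matrix_mul_assoc QT)
  finally have "Q ** T = mat 1" using QT by simp
  then show ?thesis unfolding invertible_def using TQ by blast
qed

text \<open>The least bound \<open>m\<close> of the form on \<open>vecs C\<close> is the largest
  real spectral value: beyond \<open>m\<close> the difference is coercive, hence invertible, while
  invertibility at \<open>m\<close> would allow a smaller bound.\<close>

lemma hermitian_lambda_max:
  fixes T :: "'a^'d^'d"
  assumes C: "closed_star_subalgebra C" and T: "hermitian T" "\<And>i j. T $ i $ j \<in> C"
  shows lambda_max_upper: "\<And>v. v \<in> vecs C \<Longrightarrow> vip v (T *v v) \<le> lambda_max T * vip v v"
    and lambda_max_least: "\<And>l. (\<And>v. v \<in> vecs C \<Longrightarrow> vip v (T *v v) \<le> l * vip v v) \<Longrightarrow> lambda_max T \<le> l"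
proof -
  define U where "U = {l. \<forall>v\<in>vecs C. vip v (T *v v) \<le> l * vip v v}"
  obtain K where K: "0 \<le> K" "\<And>v. vip (T *v v) (T *v v) \<le> K * vip v v"
    using vip_matrix_bounded[of T] by blast
  have "vip v (T *v v) \<le> (1 + K) / 2 * vip v v" for v
    using abs_vip_le[of v "T *v v"] K(2)[of v] by (simp add: algebra_simps)
  then have "(1 + K) / 2 \<in> U" by (simp add: U_def)
  then have ne: "U \<noteq> {}" by blast
  \<comment> \<open>One test vector of nonzero length, which bounds the admissible constants from
    below.\<close>
  define o1 :: "'a^'d" where "o1 = (\<chi> k. 1)"
  have o1: "o1 \<in> vecs C" using csub_one[OF C] by (simp add: o1_def vecs_def)
  have vo1: "vip o1 o1 = CARD('d)" by (simp add: vip_def o1_def rip_def trace_one)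
  have low: "vip v (T *v v) / vip v v \<le> l" if "l \<in> U" "v \<in> vecs C" "vip v v > 0" for v l
    using that by (simp add: U_def divide_le_eq)
  have bdd: "bdd_below U" using low[OF _ o1] by (intro bdd_belowI) (auto simp: vo1)
  define m where "m = Inf U"
  have mU: "m \<in> U" unfolding U_def
  proof (intro CollectI ballI)
    fix v :: "'a^'d" assume v: "v \<in> vecs C"
    show "vip v (T *v v) \<le> m * vip v v"
    proof (cases "vip v v = 0")
      case True
      obtain l where "l \<in> U" using ne by blast
      then have "vip v (T *v v) \<le> l * vip v v" using v by (simp add: U_def)
      then show ?thesis using True by simp
    next
      case False
      then have "vip v v > 0" using vip_nonneg[of v] by simp
      then have "vip v (T *v v) / vip v v \<le> m"
        unfolding m_def using low v by (intro cInf_greatest[OF ne]) auto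
      then show ?thesis using \<open>vip v v > 0\<close> by (simp add: divide_le_eq)
    qed
  qed
  have mle: "m \<le> l" if "l \<in> U" for l unfolding m_def using bdd that by (rule cInf_lower[rotated])
  have M: "(mat (t *\<^sub>R 1) - T) *v v = t *\<^sub>R v - T *v v" for t :: real and v
    by (simp add: matrix_vector_mult_diff_rdistrib mat_mult_vector vec_eq_iff)
  have Mh: "hermitian (mat (t *\<^sub>R 1) - T)" for t
    using T(1) by (simp add: hermitian_def cadj_diff cadj_mat star_scaleR)
  have MC: "(mat (t *\<^sub>R 1) - T) $ i $ j \<in> C" for t i j
    using T(2) csub_scaleR[OF C csub_one[OF C]] csub_zero[OF C]
    by (auto simp: mat_def intro: csub_diff[OF C] csub_minus[OF C])
  have spec: "complex_of_real t \<in> spectrum T \<longleftrightarrow> \<not> invertible (mat (t *\<^sub>R 1) - T)" for t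
    using invertible_minus[of "mat (t *\<^sub>R 1) - T"] by (simp add: spectrum_def cscale_of_real)
  have "lambda_max T = m"
    unfolding lambda_max_def
  proof (rule cSup_eq_maximum)
    fix t assume "t \<in> {t. complex_of_real t \<in> spectrum T}"
    then have ninv: "\<not> invertible (mat (t *\<^sub>R 1) - T)" using spec by blast
    show "t \<le> m"
    proof (rule ccontr)
      assume "\<not> t \<le> m"
      have "(t - m) * vip v v \<le> vip v ((mat (t *\<^sub>R 1) - T) *v v)" if "v \<in> vecs C" for v
        using that mU by (simp add: M vip_diff_right vip_scaleR_right U_def left_diff_distrib)
      with coercive_imp_invertible[OF C Mh MC, of "t - m" t] ninv \<open>\<not> t \<le> m\<close>
      show False by auto
    qed
  next
    \<comment> \<open>Cauchy-Schwarz for the nonnegative form of \<open>S\<close> bounds the square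
      length of S v by a multiple of the form at \<open>v\<close>. A left inverse then makes
      \<open>S\<close> coercive, so \<open>m\<close> could be lowered. The inverse may have entries
      outside \<open>C\<close>; only its boundedness enters.\<close>
    have False if inv: "invertible (mat (m *\<^sub>R 1) - T)"
    proof -
      define S where "S = mat (m *\<^sub>R 1) - T"
      have S: "hermitian S" "\<And>i j. S $ i $ j \<in> C" using Mh MC by (auto simp: S_def)
      have Spos: "0 \<le> vip v (S *v v)" if "v \<in> vecs C" for v
        using that mU by (simp add: S_def M vip_diff_right vip_scaleR_right U_def)
      obtain Q where Q: "Q ** S = mat 1" using inv unfolding invertible_def S_def by blast
      obtain K1 where K1: "0 \<le> K1" "\<And>v. vip (Q *v v) (Q *v v) \<le> K1 * vip v v"
        using vip_matrix_bounded[of Q] by blast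
      obtain K2 where K2: "0 \<le> K2" "\<And>v. vip (S *v v) (S *v v) \<le> K2 * vip v v"
        using vip_matrix_bounded[of S] by blast
      define K3 where "K3 = (1 + K2) / 2"
      have K3: "0 \<le> K3" "vip v (S *v v) \<le> K3 * vip v v" for v
        using abs_vip_le[of v "S *v v"] K2(1) K2(2)[of v] by (auto simp: K3_def field_simps)
      \<comment> \<open>The summand 1 keeps \<open>k\<close> positive even when
        \<open>K1 * K3\<close> is zero.\<close>
      define k where "k = K1 * K3 + 1"
      have k: "k > 0" using K1(1) K3(1) by (simp add: k_def add_nonneg_pos)
      have "m - 1 / k \<in> U" unfolding U_def
      proof (intro CollectI ballI)
        fix v :: "'a^'d" assume v: "v \<in> vecs C"
        define w where "w = S *v v"
        have w: "w \<in> vecs C" unfolding w_def by (rule matrix_vector_in_vecs[OF C S(2) v])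
        have "(vip w w)\<^sup>2 \<le> vip w (S *v w) * vip v (S *v v)"
          using vip_Cauchy_Schwarz[OF C S(1) Spos w v] by (simp add: w_def)
        also have "\<dots> \<le> (K3 * vip w w) * vip v (S *v v)"
          by (intro mult_right_mono K3 Spos v)
        finally have le: "vip w w * vip w w \<le> vip w w * (K3 * vip v (S *v v))"
          by (simp add: power2_eq_square mult_ac)
        have "vip w w \<le> K3 * vip v (S *v v)"
        proof (cases "vip w w = 0")
          case True
          then show ?thesis using K3(1) Spos[OF v] by simp
        next
          case False
          then have "vip w w > 0" using vip_nonneg[of w] by simp
          then show ?thesis using le by simp
        qed
        then have "K1 * vip w w \<le> K1 * (K3 * vip v (S *v v))" using K1(1) by (rule mult_left_mono)
        moreover have "vip v v \<le> K1 * vip w w"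
          using K1(2)[of w] by (simp add: w_def matrix_vector_mul_assoc Q)
        ultimately have "vip v v \<le> k * vip v (S *v v)"
          using Spos[OF v] by (simp add: k_def algebra_simps)
        then have "vip v v / k \<le> vip v (S *v v)" using k by (simp add: divide_le_eq mult.commute)
        then show "vip v (T *v v) \<le> (m - 1 / k) * vip v v"
          by (simp add: S_def M vip_diff_right vip_scaleR_right left_diff_distrib)
      qed
      then show False using mle[of "m - 1 / k"] k by simp
    qed
    then show "m \<in> {t. complex_of_real t \<in> spectrum T}" using spec by blast
  qed
  then show "\<And>v. v \<in> vecs C \<Longrightarrow> vip v (T *v v) \<le> lambda_max T * vip v v"
    "\<And>l. (\<And>v. v \<in> vecs C \<Longrightarrow> vip v (T *v v) \<le> l * vip v v) \<Longrightarrow> lambda_max T \<le> l"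
    using mU mle by (auto simp: U_def)
qed

end

lemma lambda_min_eq: "lambda_min T = - lambda_max (- T)"
proof -
  have "complex_of_real t \<in> spectrum (- T) \<longleftrightarrow> complex_of_real (- t) \<in> spectrum T" for t
  proof -
    have "- T - mat (cscale (complex_of_real t) 1) = - (T - mat (cscale (complex_of_real (- t)) 1))"
      by (simp add: vec_eq_iff mat_def cscale_minus_left)
    then show ?thesis unfolding spectrum_def mem_Collect_eq by (simp only: invertible_minus)
  qed
  then have "{t. complex_of_real t \<in> spectrum (- T)} = {t. - t \<in> {t. complex_of_real t \<in> spectrum T}}"
    by simp
  also have "\<dots> = uminus ` {t. complex_of_real t \<in> spectrum T}"
    by (rule set_eqI) (metis (mono_tags) image_iff mem_Collect_eq minus_minus)
  finally have "{t. complex_of_real t \<in> spectrum (- T)} = uminus ` {t. complex_of_real t \<in> spectrum T}" .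
  \<comment> \<open>The real \<open>Inf\<close> is by definition minus the \<open>Sup\<close> of the
    negated set, also in the degenerate cases.\<close>
  then show ?thesis by (simp add: lambda_min_def lambda_max_def Inf_real_def)
qed

section \<open>Positive complex matrices\<close>

text \<open>The one-dimensional example: through it every result about \<open>vip\<close>
  specialises to complex matrices with the usual inner product.\<close>

lemma faithful_trace_complex: "faithful_trace (\<lambda>x::complex. x)"
  by unfold_locales
     (auto simp: faithful_tracial_state_def cscale_complex_def star_complex_def
        complex_nonneg_Reals_iff mult.commute)

lemma vip_complex_eq_inner: "faithful_trace.vip (\<lambda>x::complex. x) v w = v \<bullet> w"
  unfolding faithful_trace.vip_def[OF faithful_trace_complex]
    faithful_trace.rip_def[OF faithful_trace_complex]
  by (simp add: inner_vec_def star_complex_def inner_complex_def)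

lemma inner_cadj:
  fixes A :: "complex^'m^'d"
  shows "(A *v x) \<bullet> y = x \<bullet> (cadj A *v y)"
  using faithful_trace.vip_cadj[OF faithful_trace_complex, of A x y]
  by (simp add: vip_complex_eq_inner)

lemma inner_cadj':
  fixes A :: "complex^'m^'d"
  shows "(cadj A *v y) \<bullet> x = y \<bullet> (A *v x)"
  by (metis inner_cadj inner_commute)

lemma posdef_iff:
  "posdef P \<longleftrightarrow> hermitian P \<and> (\<forall>v. v \<noteq> 0 \<longrightarrow> 0 < v \<bullet> (P *v v))"
  by (simp add: posdef_def inner_vec_def inner_complex_def)

lemma posdefD:
  assumes "posdef P"
  shows "hermitian P" "0 \<le> v \<bullet> (P *v v)"
  using assms unfolding posdef_iff by (auto intro: less_imp_le) (cases "v = 0"; auto intro: less_imp_le)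

lemma coercive_imp_posdef:
  assumes "hermitian P" "0 < c" "\<And>v. c * (v \<bullet> v) \<le> v \<bullet> (P *v v)"
  shows "posdef P"
  unfolding posdef_iff
proof (intro conjI allI impI assms(1))
  fix v :: "complex^'a" assume "v \<noteq> 0"
  then have "0 < c * (v \<bullet> v)" using assms(2) by simp
  then show "0 < v \<bullet> (P *v v)" using assms(3)[of v] by linarith
qed

lemma matrix_quadratic_bounded:
  fixes P :: "complex^'d^'d"
  obtains L where "\<And>v. \<bar>v \<bullet> (P *v v)\<bar> \<le> L * (v \<bullet> v)"
proof -
  interpret faithful_trace "\<lambda>x::complex. x" by (rule faithful_trace_complex)
  obtain K where "0 \<le> K" "\<And>v. vip (P *v v) (P *v v) \<le> K * vip v v"
    using vip_matrix_bounded[of P] by blast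
  then have "\<bar>v \<bullet> (P *v v)\<bar> \<le> (1 + K) / 2 * (v \<bullet> v)" for v
    using abs_vip_le[of v "P *v v"] by (simp add: vip_complex_eq_inner algebra_simps) (smt (verit))
  then show ?thesis by (rule that)
qed

lemma complex_lambda_max:
  fixes T :: "complex^'d^'d"
  assumes "hermitian T"
  shows complex_lambda_max_upper: "v \<bullet> (T *v v) \<le> lambda_max T * (v \<bullet> v)"
    and complex_lambda_max_least: "(\<And>v. v \<bullet> (T *v v) \<le> l * (v \<bullet> v)) \<Longrightarrow> lambda_max T \<le> l"
proof -
  interpret faithful_trace "\<lambda>x::complex. x" by (rule faithful_trace_complex)
  show "v \<bullet> (T *v v) \<le> lambda_max T * (v \<bullet> v)"
    using lambda_max_upper[OF csub_UNIV assms, of v] by (simp add: vecs_def vip_complex_eq_inner)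
  show "lambda_max T \<le> l" if "\<And>v. v \<bullet> (T *v v) \<le> l * (v \<bullet> v)"
    using lambda_max_least[OF csub_UNIV assms, of l] that by (simp add: vip_complex_eq_inner)
qed

lemma posdef_inverse:
  fixes P :: "complex^'d^'d"
  assumes P: "posdef P"
  shows matrix_inv_right: "P ** matrix_inv P = mat 1"
    and matrix_inv_left: "matrix_inv P ** P = mat 1"
    and posdef_matrix_inv: "posdef (matrix_inv P)"
proof -
  have "inj ((*v) P)"
  proof (rule injI)
    fix x y assume "P *v x = P *v y"
    then have "(x - y) \<bullet> (P *v (x - y)) = 0" by (simp add: matrix_vector_mult_diff_distrib)
    then have "x - y = 0" using P unfolding posdef_iff by (metis less_irrefl)
    then show "x = y" by simp
  qed
  then obtain R where "R ** P = mat 1" using matrix_left_invertible_injective[of P] by blast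
  then have ex: "\<exists>R. P ** R = mat 1 \<and> R ** P = mat 1" using matrix_left_right_inverse by blast
  then show 1: "P ** matrix_inv P = mat 1" and 2: "matrix_inv P ** P = mat 1"
    using someI_ex[OF ex] unfolding matrix_inv_def by auto
  have cP: "cadj P = P" using posdefD(1)[OF P] by (simp add: hermitian_def)
  have "cadj (matrix_inv P) ** P = mat 1"
    using arg_cong[OF 1, of cadj] by (simp add: cadj_matrix_mult cadj_mat cP)
  then have h: "hermitian (matrix_inv P)"
    unfolding hermitian_def using 1 by (metis matrix_mul_assoc matrix_mul_lid matrix_mul_rid)
  show "posdef (matrix_inv P)" unfolding posdef_iff
  proof (intro conjI allI impI h)
    fix v :: "complex^'d" assume v: "v \<noteq> 0"
    define w where "w = matrix_inv P *v v"
    have Pw: "P *v w = v" by (simp add: w_def matrix_vector_mul_assoc 1)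
    then have "w \<noteq> 0" using v by auto
    then have "0 < w \<bullet> (P *v w)" using P unfolding posdef_iff by blast
    then show "0 < v \<bullet> (matrix_inv P *v v)" by (simp add: Pw w_def[symmetric] inner_commute)
  qed
qed

lemma matrix_inv_eqI:
  fixes P :: "complex^'d^'d"
  assumes P: "posdef P" and R: "P ** R = mat 1"
  shows "matrix_inv P = R"
  by (metis P R matrix_inv_left matrix_mul_assoc matrix_mul_lid matrix_mul_rid)

lemma hermitian_inner_commute:
  fixes P :: "complex^'d^'d"
  shows "hermitian P \<Longrightarrow> (P *v x) \<bullet> y = x \<bullet> (P *v y)"
  by (simp add: inner_cadj hermitian_def)

text \<open>This is the nonnegativity of the form of \<open>P\<close> at v - r, where P r = q. It is
  the completed square behind all later estimates.\<close>

lemma inverse_quadratic_bound: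
  fixes P :: "complex^'d^'d"
  assumes P: "posdef P"
  shows "2 * (v \<bullet> q) \<le> v \<bullet> (P *v v) + q \<bullet> (matrix_inv P *v q)"
proof -
  define r where "r = matrix_inv P *v q"
  have Pr: "P *v r = q" by (simp add: r_def matrix_vector_mul_assoc matrix_inv_right[OF P])
  have "0 \<le> (v - r) \<bullet> (P *v (v - r))" by (rule posdefD(2)[OF P])
  moreover have "r \<bullet> (P *v v) = q \<bullet> v"
    using hermitian_inner_commute[OF posdefD(1)[OF P], of r v] by (simp add: Pr)
  ultimately show ?thesis
    by (simp add: matrix_vector_mult_diff_distrib Pr inner_diff_left inner_diff_right r_def[symmetric]
        inner_commute)
qed

text \<open>Apply the previous bound for \<open>Q\<close> at the solution \<open>r\<close> of P r =
  v, where the form of \<open>P\<close> equals the inner product of \<open>r\<close> and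
  \<open>v\<close>; one of the two copies cancels.\<close>

lemma matrix_inv_antimono:
  fixes P Q :: "complex^'d^'d"
  assumes P: "posdef P" and Q: "posdef Q" and le: "\<And>v. v \<bullet> (Q *v v) \<le> v \<bullet> (P *v v)"
  shows "v \<bullet> (matrix_inv P *v v) \<le> v \<bullet> (matrix_inv Q *v v)"
proof -
  define r where "r = matrix_inv P *v v"
  have Pr: "P *v r = v" by (simp add: r_def matrix_vector_mul_assoc matrix_inv_right[OF P])
  show ?thesis
    using inverse_quadratic_bound[OF Q, of r v] le[of r] by (simp add: Pr r_def[symmetric] inner_commute)
qed

section \<open>Limits of hermitian matrices\<close>

lemma tendsto_matrix_vector_mult:
  fixes f :: "nat \<Rightarrow> complex^'m^'d"
  assumes "f \<longlonglongrightarrow> A"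
  shows "(\<lambda>n. f n *v v) \<longlonglongrightarrow> A *v v"
  unfolding matrix_vector_mult_def
  by (intro tendsto_vec_lambda tendsto_intros tendsto_vec_nth assms)

lemma tendsto_matrix_mult:
  fixes f :: "nat \<Rightarrow> complex^'m^'d" and g :: "nat \<Rightarrow> complex^'k^'m"
  assumes "f \<longlonglongrightarrow> A" "g \<longlonglongrightarrow> B"
  shows "(\<lambda>n. f n ** g n) \<longlonglongrightarrow> A ** B"
  unfolding matrix_matrix_mult_def
  by (intro tendsto_vec_lambda tendsto_intros tendsto_vec_nth assms)

lemma tendsto_quadratic_le:
  fixes f :: "nat \<Rightarrow> complex^'d^'d"
  assumes "f \<longlonglongrightarrow> A" "\<And>n. c \<le> v \<bullet> (f n *v v)"
  shows "c \<le> v \<bullet> (A *v v)"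
proof (rule LIMSEQ_le_const)
  show "(\<lambda>n. v \<bullet> (f n *v v)) \<longlonglongrightarrow> v \<bullet> (A *v v)"
    by (intro tendsto_inner tendsto_const tendsto_matrix_vector_mult assms(1))
  show "\<exists>N. \<forall>n\<ge>N. c \<le> v \<bullet> (f n *v v)" using assms(2) by blast
qed

lemma tendsto_hermitian:
  fixes f :: "nat \<Rightarrow> complex^'d^'d"
  assumes lim: "f \<longlonglongrightarrow> A" and h: "\<And>n. hermitian (f n)"
  shows "hermitian A"
proof -
  have "(\<lambda>n. cadj (f n)) \<longlonglongrightarrow> cadj A"
    unfolding cadj_def
    by (intro tendsto_vec_lambda bounded_linear.tendsto[OF bounded_linear_star] tendsto_vec_nth lim)
  then have "f \<longlonglongrightarrow> cadj A" using h by (simp add: hermitian_def)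
  then show ?thesis unfolding hermitian_def using lim by (rule LIMSEQ_unique)
qed

lemma matrix_vector_axis: "(A *v axis j 1) $ i = A $ i $ j"
  by (simp add: matrix_vector_mult_def axis_def if_distrib cong: if_cong)

lemma tendsto_matrixI:
  fixes f :: "nat \<Rightarrow> complex^'m^'d"
  assumes "\<And>v. (\<lambda>n. f n *v v) \<longlonglongrightarrow> A *v v"
  shows "f \<longlonglongrightarrow> A"
proof (rule vec_tendstoI, rule vec_tendstoI)
  fix i j show "(\<lambda>n. f n $ i $ j) \<longlonglongrightarrow> A $ i $ j"
    using tendsto_vec_nth[OF assms[of "axis j 1"], of i] unfolding matrix_vector_axis .
qed

text \<open>Uniform coercivity bounds all inverses by 1/c, so the error of the n-th solution is at
  most 1/c times the residual of the limit solution in the n-th equation.\<close>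

lemma tendsto_matrix_inv:
  fixes f :: "nat \<Rightarrow> complex^'d^'d"
  assumes lim: "f \<longlonglongrightarrow> A" and h: "\<And>n. hermitian (f n)" and c: "0 < c"
    and pos: "\<And>n v. c * (v \<bullet> v) \<le> v \<bullet> (f n *v v)"
  shows "(\<lambda>n. matrix_inv (f n)) \<longlonglongrightarrow> matrix_inv A"
proof (rule tendsto_matrixI)
  fix u
  have A: "posdef A"
  proof (rule coercive_imp_posdef[OF tendsto_hermitian[OF lim h] c])
    show "c * (v \<bullet> v) \<le> v \<bullet> (A *v v)" for v
      using pos by (intro tendsto_quadratic_le[OF lim])
  qed
  have f: "posdef (f n)" for n using h c pos by (rule coercive_imp_posdef)
  have lower: "norm y \<le> norm (f n *v y) / c" for n y
  proof (cases "y = 0")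
    case False
    have "c * (norm y * norm y) \<le> norm y * norm (f n *v y)"
      using order_trans[OF pos[of y n] norm_cauchy_schwarz[of y "f n *v y"]]
      unfolding dot_square_norm power2_eq_square .
    then have "norm y * (c * norm y) \<le> norm y * norm (f n *v y)" by (simp only: mult.left_commute)
    then have "c * norm y \<le> norm (f n *v y)" using False by simp
    then show ?thesis using c by (simp add: le_divide_eq mult.commute)
  qed simp
  define x where "x = matrix_inv A *v u"
  have Ax: "A *v x = u" by (simp add: x_def matrix_vector_mul_assoc matrix_inv_right[OF A])
  have "norm (matrix_inv (f n) *v u - x) \<le> norm (u - f n *v x) / c" for n
    using lower[of "matrix_inv (f n) *v u - x" n]
    by (simp add: matrix_vector_mult_diff_distrib matrix_vector_mul_assoc matrix_inv_right[OF f])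
  moreover have "(\<lambda>n. norm (u - f n *v x) / c) \<longlonglongrightarrow> norm (u - A *v x) / c"
    by (rule tendsto_divide[OF tendsto_norm[OF tendsto_diff[OF tendsto_const
            tendsto_matrix_vector_mult[OF lim]]] tendsto_const]) (use c in simp)
  then have "(\<lambda>n. norm (u - f n *v x) / c) \<longlonglongrightarrow> 0" by (simp add: Ax)
  ultimately have "(\<lambda>n. matrix_inv (f n) *v u - x) \<longlonglongrightarrow> 0"
    by (rule Lim_null_comparison[OF always_eventually[OF allI]])
  then show "(\<lambda>n. matrix_inv (f n) *v u) \<longlonglongrightarrow> matrix_inv A *v u"
    unfolding x_def by (rule LIM_zero_cancel)
qed

text \<open>Evaluate the form at the sum of the i-th unit vector and \<open>c\<close> times the
  j-th, the phase \<open>c\<close> being chosen to turn the off-diagonal entry into minus its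
  modulus.\<close>

lemma psd_entry_le:
  fixes M :: "complex^'d^'d"
  assumes h: "hermitian M" and pos: "\<And>v. 0 \<le> v \<bullet> (M *v v)"
  shows "2 * cmod (M $ i $ j) \<le> Re (M $ i $ i) + Re (M $ j $ j)"
proof -
  define c where "c = (if M $ i $ j = 0 then 1 else - cnj (M $ i $ j) / cmod (M $ i $ j))"
  have c: "cmod c = 1" "c * M $ i $ j = - complex_of_real (cmod (M $ i $ j))"
    by (auto simp: c_def norm_divide complex_norm_square[symmetric] power2_eq_square mult.commute)
  define q where "q v w = (\<Sum>k\<in>UNIV. cnj (v $ k) * (M *v w) $ k)" for v w :: "complex^'d"
  have re: "Re (q v v) = v \<bullet> (M *v v)" for v by (simp add: q_def inner_vec_def inner_complex_def)
  define v :: "complex^'d" where "v = axis i 1 + (\<chi> k. c * axis j 1 $ k)"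
  have "(M *v v) $ k = (M *v axis i 1) $ k + c * (M *v axis j 1) $ k" for k
    by (simp add: v_def matrix_vector_mult_def distrib_left sum.distrib sum_distrib_left
        mult.left_commute)
  then have Mv: "(M *v v) $ k = M $ k $ i + c * M $ k $ j" for k
    unfolding matrix_vector_axis .
  have "cnj (v $ k) * g k = (if k = i then g k else 0) + (if k = j then cnj c * g k else 0)" for k g
    by (auto simp: v_def axis_def distrib_right)
  then have vq: "(\<Sum>k\<in>UNIV. cnj (v $ k) * g k) = g i + cnj c * g j" for g
    by (simp add: sum.distrib)
  have "q v v = (M $ i $ i + c * M $ i $ j) + cnj c * (M $ j $ i + c * M $ j $ j)"
    unfolding q_def vq Mv ..
  also have "M $ j $ i = cnj (M $ i $ j)"
    using h cadj_nth[of M j i] by (simp add: hermitian_def star_complex_def)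
  also have "cnj c * (cnj (M $ i $ j) + c * M $ j $ j) = cnj (c * M $ i $ j) + M $ j $ j"
    using c(1) complex_norm_square[of c] by (simp add: algebra_simps)
  finally have "Re (q v v) = Re (M $ i $ i) + Re (M $ j $ j) - 2 * cmod (M $ i $ j)"
    unfolding c(2) by simp
  then show ?thesis using pos[of v] by (simp add: re)
qed

text \<open>Diagonal entries are monotone and bounded, hence Cauchy; \<open>psd_entry_le\<close> for
  the positive differences \<open>f m - f n\<close> passes this on to the other entries.\<close>

lemma decreasing_hermitian_convergent:
  fixes f :: "nat \<Rightarrow> complex^'d^'d"
  assumes h: "\<And>n. hermitian (f n)" and dec: "\<And>n v. v \<bullet> (f (Suc n) *v v) \<le> v \<bullet> (f n *v v)"
    and low: "\<And>n v. 0 \<le> v \<bullet> (f n *v v)"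
  obtains A where "f \<longlonglongrightarrow> A"
proof -
  have mono: "v \<bullet> (f n *v v) \<le> v \<bullet> (f m *v v)" if "m \<le> n" for m n v
    using that by (induction rule: dec_induct) (use dec order_trans in blast)+
  have diag: "Re (f n $ i $ i) = axis i 1 \<bullet> (f n *v axis i 1)" for n i
    by (simp add: inner_axis' matrix_vector_axis inner_complex_def)
  have dconv: "Cauchy (\<lambda>n. Re (f n $ i $ i))" for i
  proof -
    have "decseq (\<lambda>n. Re (f n $ i $ i))"
      unfolding decseq_def diag using mono by blast
    moreover have "bdd_below (range (\<lambda>n. Re (f n $ i $ i)))"
      unfolding diag using low by (intro bdd_belowI[of _ 0]) auto
    ultimately show ?thesis by (intro LIMSEQ_imp_Cauchy[OF LIMSEQ_decseq_INF])
  qed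
  have "Cauchy (\<lambda>n. f n $ i $ j)" for i j
  proof (rule CauchyI)
    fix e :: real assume e: "0 < e"
    obtain N where N: "\<And>m n. m \<ge> N \<Longrightarrow> n \<ge> N \<Longrightarrow> norm (Re (f m $ i $ i) - Re (f n $ i $ i)) < e"
      using CauchyD[OF dconv e] by blast
    obtain N' where N': "\<And>m n. m \<ge> N' \<Longrightarrow> n \<ge> N' \<Longrightarrow> norm (Re (f m $ j $ j) - Re (f n $ j $ j)) < e"
      using CauchyD[OF dconv e] by blast
    have main: "cmod (f m $ i $ j - f n $ i $ j) < e" if "max N N' \<le> m" "m \<le> n" for m n
    proof -
      have "2 * cmod ((f m - f n) $ i $ j) \<le> Re ((f m - f n) $ i $ i) + Re ((f m - f n) $ j $ j)"
      proof (rule psd_entry_le)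
        show "hermitian (f m - f n)" using h by (simp add: hermitian_def cadj_diff)
        show "0 \<le> v \<bullet> ((f m - f n) *v v)" for v
          using mono[OF that(2)] by (simp add: matrix_vector_mult_diff_rdistrib inner_diff_right)
      qed
      then show ?thesis using N[of m n] N'[of m n] that by auto
    qed
    show "\<exists>M. \<forall>m\<ge>M. \<forall>n\<ge>M. norm (f m $ i $ j - f n $ i $ j) < e"
    proof (intro exI[of _ "max N N'"] allI impI)
      fix m n assume "max N N' \<le> m" "max N N' \<le> n"
      then show "cmod (f m $ i $ j - f n $ i $ j) < e"
        using main[of m n] main[of n m] by (cases "m \<le> n") (auto simp: norm_minus_commute)
    qed
  qed
  then have "\<exists>l. (\<lambda>n. f n $ i $ j) \<longlonglongrightarrow> l" for i j
    unfolding Cauchy_convergent_iff convergent_def .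
  then obtain l where "\<And>i j. (\<lambda>n. f n $ i $ j) \<longlonglongrightarrow> l i j" by metis
  then have "(\<lambda>n. f n $ i $ j) \<longlonglongrightarrow> (\<chi> i j. l i j) $ i $ j" for i j by simp
  then have "f \<longlonglongrightarrow> (\<chi> i j. l i j)" by (rule vec_tendstoI[OF vec_tendstoI])
  then show ?thesis by (rule that)
qed

section \<open>Quadratic forms on words\<close>

definition words :: "nat \<Rightarrow> 'n list set"
  where "words N = {w. length w \<le> N}"

lemma finite_words [simp]: "finite (words N :: 'n::finite list set)"
  using finite_lists_length_le[of "UNIV :: 'n set" N] by (simp add: words_def)

lemma Nil_in_words [simp]: "[] \<in> words N"
  by (simp add: words_def)

lemma sum_words_Cons:
  fixes f :: "'n::finite list \<Rightarrow> 'b::comm_monoid_add"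
  shows "(\<Sum>w\<in>words (Suc N). f w) = f [] + (\<Sum>i\<in>UNIV. \<Sum>w\<in>words N. f (i # w))"
proof -
  have eq: "words (Suc N) - {[]} = (\<lambda>(i, w). i # w) ` (UNIV \<times> words N :: ('n \<times> 'n list) set)"
  proof (intro set_eqI iffI)
    fix w :: "'n list" assume "w \<in> words (Suc N) - {[]}"
    then show "w \<in> (\<lambda>(i, w). i # w) ` (UNIV \<times> words N)"
      by (cases w) (auto simp: words_def image_iff)
  qed (auto simp: words_def)
  have inj: "inj_on (\<lambda>(i, w). i # w) (UNIV \<times> words N :: ('n \<times> 'n list) set)"
    by (auto simp: inj_on_def)
  have "(\<Sum>w\<in>words (Suc N). f w) = f [] + (\<Sum>w\<in>words (Suc N) - {[]}. f w)"
    by (rule sum.remove) simp_all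
  then show ?thesis
    unfolding eq sum.reindex[OF inj] by (simp add: sum.cartesian_product case_prod_unfold)
qed

text \<open>The last letter tells in which branch at the root a word lies, whereas
  \<open>sum_words_Cons\<close> groups words by their parent. Reversal of words exchanges the
  two.\<close>

lemma sum_words_snoc:
  fixes f :: "'n::finite list \<Rightarrow> 'b::comm_monoid_add"
  shows "(\<Sum>w\<in>words (Suc N). f w) = f [] + (\<Sum>i\<in>UNIV. \<Sum>w\<in>words N. f (w @ [i]))"
proof -
  have rev: "(\<Sum>w\<in>words M. g (rev w)) = (\<Sum>w\<in>words M. g w)" for M and g :: "'n list \<Rightarrow> 'b"
    by (rule sum.reindex_bij_witness[of _ rev rev]) (auto simp: words_def)
  have "(\<Sum>w\<in>words (Suc N). f w) = (\<Sum>w\<in>words (Suc N). f (rev w))" by (simp add: rev)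
  also have "\<dots> = f [] + (\<Sum>i\<in>UNIV. \<Sum>w\<in>words N. f (rev w @ [i]))"
    by (simp add: sum_words_Cons)
  also have "\<dots> = f [] + (\<Sum>i\<in>UNIV. \<Sum>w\<in>words N. f (w @ [i]))"
    using rev[of "\<lambda>w. f (w @ [_])"] by simp
  finally show ?thesis .
qed

lemma sum_words_mono:
  fixes f :: "'n::finite list \<Rightarrow> 'b::comm_monoid_add"
  assumes "N \<le> M" "\<And>w. N < length w \<Longrightarrow> f w = 0"
  shows "(\<Sum>w\<in>words M. f w) = (\<Sum>w\<in>words N. f w)"
  by (rule sum.mono_neutral_right[OF finite_words]) (use assms in \<open>auto simp: words_def\<close>)

lemma sum_words_0: "(\<Sum>w\<in>words 0. f w) = f []"
  by (simp add: words_def)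

text \<open>\<open>D\<close> stands for \<epsilon> (b - t).\<close>

locale word_form =
  fixes a :: "'n::finite \<Rightarrow> complex^'m^'d" and D :: "complex^'d^'d" and \<epsilon> :: real
  assumes D: "hermitian D" and sign: "\<epsilon> = 1 \<or> \<epsilon> = -1"
begin

lemma sign_square [simp]: "\<epsilon> * \<epsilon> = 1" "\<epsilon> * (\<epsilon> * x) = x"
  using sign by auto

text \<open>The iteration map is cut into \<open>kap\<close>, \<open>om\<close> and
  \<open>psi\<close> so that \<kappa> = 0, which no \<open>P\<close> need produce, can start it: the
  first iterate is \<open>psi (mat 1)\<close>.\<close>

definition kap :: "complex^'d^'d \<Rightarrow> complex^'m^'m"
  where "kap P = (\<Sum>j\<in>UNIV. cadj (a j) ** matrix_inv P ** a j)"

definition om :: "complex^'m^'m \<Rightarrow> complex^'m^'m"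
  where "om K = matrix_inv (mat 1 + \<epsilon> *\<^sub>R K)"

definition psi :: "complex^'m^'m \<Rightarrow> complex^'d^'d"
  where "psi W = D + \<epsilon> *\<^sub>R (\<Sum>i\<in>UNIV. a i ** W ** cadj (a i))"

definition parent :: "('n list \<Rightarrow> complex^'d) \<Rightarrow> 'n list \<Rightarrow> complex^'m"
  where "parent v w = (case w of [] \<Rightarrow> 0 | i # w' \<Rightarrow> cadj (a i) *v v w')"

text \<open>\<open>up v w\<close> is the coefficient of the word \<open>w\<close> in \<open>x\<^sup>* v\<close>: the semicircular \<open>s\<^sub>j\<close> adds or
  removes the letter \<open>j\<close> at the front.\<close>

definition up :: "('n list \<Rightarrow> complex^'d) \<Rightarrow> 'n list \<Rightarrow> complex^'m"
  where "up v w = (\<Sum>j\<in>UNIV. cadj (a j) *v v (j # w)) + parent v w"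

text \<open>\<open>up\<close> reaches one letter further than \<open>v\<close>; with
  \<open>Suc N\<close> nothing is cut off when \<open>v\<close> is supported on
  \<open>words N\<close>.\<close>

definition energy :: "nat \<Rightarrow> ('n list \<Rightarrow> complex^'d) \<Rightarrow> real"
  where "energy N v = (\<Sum>w\<in>words N. v w \<bullet> (D *v v w)) + \<epsilon> * (\<Sum>w\<in>words (Suc N). up v w \<bullet> up v w)"

definition supported :: "nat \<Rightarrow> ('n list \<Rightarrow> complex^'d) \<Rightarrow> bool"
  where "supported N v \<longleftrightarrow> (\<forall>w. N < length w \<longrightarrow> v w = 0)"

lemma parent_simps [simp]: "parent v [] = 0" "parent v (i # w) = cadj (a i) *v v w"
  by (simp_all add: parent_def)

lemma kap_quadratic: "y \<bullet> (kap P *v y) = (\<Sum>j\<in>UNIV. (a j *v y) \<bullet> (matrix_inv P *v (a j *v y)))"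
  by (simp add: kap_def matrix_sum_mult_vector inner_sum_right matrix_vector_mul_assoc[symmetric]
      inner_cadj)

lemma psi_quadratic:
  "u \<bullet> (psi W *v u) = u \<bullet> (D *v u) + \<epsilon> * (\<Sum>i\<in>UNIV. (cadj (a i) *v u) \<bullet> (W *v (cadj (a i) *v u)))"
  by (simp add: psi_def matrix_sum_mult_vector inner_sum_right matrix_vector_mul_assoc[symmetric]
      inner_cadj' matrix_vector_mult_add_rdistrib matrix_scaleR_mult_vector inner_add_right)

lemma hermitian_kap: "posdef P \<Longrightarrow> hermitian (kap P)"
  using posdefD(1)[OF posdef_matrix_inv, of P]
  by (simp add: hermitian_def kap_def cadj_sum cadj_matrix_mult matrix_mul_assoc)

lemma hermitian_psi: "hermitian W \<Longrightarrow> hermitian (psi W)"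
  using D by (simp add: hermitian_def psi_def cadj_add cadj_scaleR cadj_sum cadj_matrix_mult
      matrix_mul_assoc)

lemma hermitian_one_plus: "hermitian K \<Longrightarrow> hermitian (mat 1 + \<epsilon> *\<^sub>R K)"
  by (simp add: hermitian_def cadj_add cadj_scaleR cadj_mat)

lemma one_plus_quadratic:
  fixes K :: "complex^'m^'m"
  shows "y \<bullet> ((mat 1 + \<epsilon> *\<^sub>R K) *v y) = y \<bullet> y + \<epsilon> * (y \<bullet> (K *v y))"
  by (simp add: matrix_vector_mult_add_rdistrib matrix_scaleR_mult_vector inner_add_right)

lemma kap_nonneg: "posdef P \<Longrightarrow> 0 \<le> y \<bullet> (kap P *v y)"
  unfolding kap_quadratic using posdefD(2)[OF posdef_matrix_inv] by (intro sum_nonneg)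

lemma node_inequality:
  fixes r :: "'n \<Rightarrow> complex^'d" and p :: "complex^'m"
  assumes P: "posdef P" and Q: "posdef (mat 1 + \<epsilon> *\<^sub>R kap P)"
    and q: "q = (\<Sum>j\<in>UNIV. cadj (a j) *v r j)"
  shows "0 \<le> (\<Sum>j\<in>UNIV. r j \<bullet> (P *v r j))
    + \<epsilon> * ((q + p) \<bullet> (q + p) - p \<bullet> (om (kap P) *v p))"
proof -
  let ?S = "\<Sum>j\<in>UNIV. r j \<bullet> (P *v r j)"
  have qy: "q \<bullet> y = (\<Sum>j\<in>UNIV. r j \<bullet> (a j *v y))" for y
    by (simp add: q inner_sum_left inner_cadj')
  have sum_bound: "2 * (\<epsilon>' * (q \<bullet> y)) \<le> ?S + y \<bullet> (kap P *v y)" if "\<epsilon>' = 1 \<or> \<epsilon>' = -1" for y \<epsilon>'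
  proof -
    have "2 * (r j \<bullet> (\<epsilon>' *\<^sub>R (a j *v y))) \<le> r j \<bullet> (P *v r j)
        + (a j *v y) \<bullet> (matrix_inv P *v (a j *v y))" for j
      using inverse_quadratic_bound[OF P, of "r j" "\<epsilon>' *\<^sub>R (a j *v y)"] that
      by (auto simp: matrix_scaleR_mult_vector matrix_minus_mult_vector)
    then have "(\<Sum>j\<in>UNIV. 2 * (r j \<bullet> (\<epsilon>' *\<^sub>R (a j *v y)))) \<le> (\<Sum>j\<in>UNIV. r j \<bullet> (P *v r j)
        + (a j *v y) \<bullet> (matrix_inv P *v (a j *v y)))"
      by (intro sum_mono)
    then show ?thesis by (simp add: kap_quadratic qy sum.distrib sum_distrib_left)
  qed
  show ?thesis
  proof (cases "\<epsilon> = 1")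
    case True
    \<comment> \<open>The value of q + p at the minimiser.\<close>
    define y where "y = om (kap P) *v p"
    have Qy: "(mat 1 + \<epsilon> *\<^sub>R kap P) *v y = p"
      unfolding y_def om_def by (simp add: matrix_vector_mul_assoc matrix_inv_right[OF Q])
    have "y \<bullet> p = y \<bullet> y + y \<bullet> (kap P *v y)"
      using one_plus_quadratic[of y "kap P"] unfolding Qy using True by simp
    moreover have "0 \<le> (q + p - y) \<bullet> (q + p - y)" by simp
    moreover have "2 * (- 1 * (q \<bullet> y)) \<le> ?S + y \<bullet> (kap P *v y)" by (rule sum_bound) simp
    ultimately show ?thesis using True unfolding y_def[symmetric]
      by (simp add: inner_add_left inner_add_right inner_diff_left inner_diff_right inner_commute)
  next
    case False
    then have e: "\<epsilon> = -1" using sign by simp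
    \<comment> \<open>Now \<open>y\<close> is the actual q + p. The square being subtracted is
      controlled by the bound for 1 - \<kappa>, so positivity of that matrix is essential.\<close>
    define y where "y = q + p"
    have "2 * (y \<bullet> p) \<le> y \<bullet> y - y \<bullet> (kap P *v y) + p \<bullet> (om (kap P) *v p)"
      using inverse_quadratic_bound[OF Q, of y p] unfolding one_plus_quadratic om_def[symmetric]
      by (simp add: e)
    moreover have "2 * (1 * (q \<bullet> y)) \<le> ?S + y \<bullet> (kap P *v y)" by (rule sum_bound) simp
    moreover have "y \<bullet> y = q \<bullet> y + y \<bullet> p" by (simp add: y_def inner_add_left inner_add_right inner_commute)
    ultimately show ?thesis unfolding y_def[symmetric] by (simp add: e)
  qed
qed

text \<open>The sum over the tree telescopes: the hypothesis supplies the form of \<open>P\<close>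
  at every word, and \<open>node_inequality\<close> at the parent of that word spends it. Only the
  root term is left over, and it is nonnegative.\<close>

lemma energy_lower_bound:
  assumes P: "posdef P" and Q: "posdef (mat 1 + \<epsilon> *\<^sub>R kap P)"
    and le: "\<And>u. u \<bullet> (P *v u) + c * (u \<bullet> u) \<le> u \<bullet> (psi (om (kap P)) *v u)"
    and v: "supported N v"
  shows "c * (\<Sum>w\<in>words N. v w \<bullet> v w) \<le> energy N v"
proof -
  let ?om = "\<lambda>p. p \<bullet> (om (kap P) *v p)"
  let ?P = "\<lambda>p. p \<bullet> (P *v p)"
  have "(\<Sum>w\<in>words N. ?P (v w) + c * (v w \<bullet> v w)) \<le> (\<Sum>w\<in>words N. v w \<bullet> (psi (om (kap P)) *v v w))"
    by (intro sum_mono le)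
  then have 1: "(\<Sum>w\<in>words N. ?P (v w)) + c * (\<Sum>w\<in>words N. v w \<bullet> v w)
      \<le> (\<Sum>w\<in>words N. v w \<bullet> (D *v v w)) + \<epsilon> * (\<Sum>w\<in>words N. \<Sum>i\<in>UNIV. ?om (cadj (a i) *v v w))"
    by (simp add: psi_quadratic sum.distrib sum_distrib_left)
  have 2: "(\<Sum>w\<in>words N. \<Sum>i\<in>UNIV. ?om (cadj (a i) *v v w)) = (\<Sum>w\<in>words (Suc N). ?om (parent v w))"
    by (subst sum_words_Cons) (simp add: sum.swap[of _ UNIV])
  \<comment> \<open>The nodes range over \<open>words (Suc N)\<close>, so their children have up to
    \<open>Suc (Suc N)\<close> letters; \<open>v\<close> vanishes on the added words.\<close>
  have "(\<Sum>w\<in>words N. ?P (v w)) = (\<Sum>w\<in>words (Suc (Suc N)). ?P (v w))"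
    by (rule sum_words_mono[symmetric]) (use v in \<open>auto simp: supported_def\<close>)
  also have "\<dots> = ?P (v []) + (\<Sum>w\<in>words (Suc N). \<Sum>j\<in>UNIV. ?P (v (j # w)))"
    by (subst sum_words_Cons) (simp add: sum.swap[of _ UNIV])
  finally have 3: "(\<Sum>w\<in>words (Suc N). \<Sum>j\<in>UNIV. ?P (v (j # w))) \<le> (\<Sum>w\<in>words N. ?P (v w))"
    using posdefD(2)[OF P, of "v []"] by linarith
  have "0 \<le> (\<Sum>w\<in>words (Suc N). (\<Sum>j\<in>UNIV. ?P (v (j # w))) + \<epsilon> * (up v w \<bullet> up v w - ?om (parent v w)))"
    unfolding up_def by (intro sum_nonneg node_inequality P Q refl)
  then have "0 \<le> (\<Sum>w\<in>words (Suc N). \<Sum>j\<in>UNIV. ?P (v (j # w)))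
      + \<epsilon> * ((\<Sum>w\<in>words (Suc N). up v w \<bullet> up v w) - (\<Sum>w\<in>words (Suc N). ?om (parent v w)))"
    by (simp only: sum.distrib sum_distrib_left[symmetric] sum_subtractf)
  with 1 3 show ?thesis unfolding energy_def 2 right_diff_distrib by linarith
qed

section \<open>Gluing trees: the iterates as energies\<close>

definition graft :: "complex^'d \<Rightarrow> ('n \<Rightarrow> 'n list \<Rightarrow> complex^'d) \<Rightarrow> 'n list \<Rightarrow> complex^'d"
  where "graft u V w = (if w = [] then u else V (last w) (butlast w))"

lemma graft_simps [simp]: "graft u V [] = u" "graft u V (w @ [j]) = V j w"
  by (simp_all add: graft_def)

text \<open>Letters are added and removed in front, so the branch named by the last letter is
  undisturbed except at its top word, which now has the root as its parent.\<close>

lemma up_graft: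
  "up (graft u V) [] = (\<Sum>j\<in>UNIV. cadj (a j) *v V j [])"
  "up (graft u V) (w @ [j]) = up (V j) w + (if w = [] then cadj (a j) *v u else 0)"
proof -
  have g1: "graft u V [k] = V k []" for k by (simp add: graft_def)
  have g2: "graft u V [k, j] = V j [k]" "graft u V (k # i # w @ [j]) = V j (k # i # w)" for k i w
    by (simp_all add: graft_def)
  show "up (graft u V) [] = (\<Sum>j\<in>UNIV. cadj (a j) *v V j [])" by (simp add: up_def g1)
  show "up (graft u V) (w @ [j]) = up (V j) w + (if w = [] then cadj (a j) *v u else 0)"
    by (cases w) (auto simp: up_def g2)
qed

lemma supported_graft:
  assumes "\<And>j. supported N (V j)" shows "supported (Suc N) (graft u V)"
  using assms by (auto simp: supported_def graft_def)

lemma energy_graft: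
  "energy (Suc N) (graft u V) = u \<bullet> (D *v u)
    + \<epsilon> * ((\<Sum>j\<in>UNIV. cadj (a j) *v V j []) \<bullet> (\<Sum>j\<in>UNIV. cadj (a j) *v V j []))
    + (\<Sum>j\<in>UNIV. energy N (V j) + \<epsilon> * ((up (V j) [] + cadj (a j) *v u) \<bullet> (up (V j) [] + cadj (a j) *v u)
        - up (V j) [] \<bullet> up (V j) []))"
proof -
  have *: "(\<Sum>w\<in>words (Suc N). up (graft u V) (w @ [j]) \<bullet> up (graft u V) (w @ [j]))
      = (\<Sum>w\<in>words (Suc N). up (V j) w \<bullet> up (V j) w)
      + ((up (V j) [] + cadj (a j) *v u) \<bullet> (up (V j) [] + cadj (a j) *v u) - up (V j) [] \<bullet> up (V j) [])"
    for j
    unfolding up_graft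
    by (simp add: sum.remove[of "words (Suc N)" "[]"])
  show ?thesis
    unfolding energy_def sum_words_snoc[of _ "Suc N"] sum_words_snoc[of "\<lambda>w. graft u V w \<bullet> _ w" for w]
    by (simp add: sum_words_snoc[of "\<lambda>w. graft u V w \<bullet> (D *v graft u V w)"] * up_graft(1)
        sum.distrib sum_distrib_left algebra_simps del: matrix_vector_mult_diff_rdistrib)
qed

text \<open>A realizable form inherits every lower bound of the energy; this is how coercivity
  reaches the iterates.\<close>

definition realizable :: "nat \<Rightarrow> complex^'d^'d \<Rightarrow> bool"
  where "realizable N P \<longleftrightarrow> (\<exists>V. \<forall>u. supported N (V u) \<and> V u [] = u \<and> energy N (V u) = u \<bullet> (P *v u))"

lemma realizable_base: "realizable 0 (psi (mat 1))"
  unfolding realizable_def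
proof (intro exI allI conjI)
  fix u :: "complex^'d"
  define v where "v = (\<lambda>w::'n list. if w = [] then u else 0)"
  have vn: "v [] = u" "v (j # w) = 0" for j w by (simp_all add: v_def)
  show "supported 0 (\<lambda>w::'n list. if w = [] then u else 0)" by (auto simp: supported_def)
  show "(\<lambda>w::'n list. if w = [] then u else 0) [] = u" by simp
  have "energy 0 v = u \<bullet> (psi (mat 1) *v u)"
    unfolding energy_def sum_words_0 sum_words_Cons psi_quadratic by (simp add: up_def vn)
  then show "energy 0 (\<lambda>w::'n list. if w = [] then u else 0) = u \<bullet> (psi (mat 1) *v u)" by (simp add: v_def)
qed

text \<open>\<open>x\<^sup>*\<close> changes word lengths by one, so even and odd words do not mix
  in the form. The children of the root are therefore left empty and the old trees are planted at
  the grandchildren, whence two more letters.\<close>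

lemma realizable_step:
  assumes P: "posdef P" and Q: "posdef (mat 1 + \<epsilon> *\<^sub>R kap P)" and R: "realizable N P"
  shows "realizable (Suc (Suc N)) (psi (om (kap P)))"
proof -
  obtain V where V: "\<And>u. supported N (V u)" "\<And>u. V u [] = u" "\<And>u. energy N (V u) = u \<bullet> (P *v u)"
    using R unfolding realizable_def by blast
  define y where "y u i = om (kap P) *v (cadj (a i) *v u)" for u i
  \<comment> \<open>The minimiser of \<open>node_inequality\<close> at the word \<open>[i]\<close>,
    whose parent contributes \<open>cadj (a i) *v u\<close>.\<close>
  define U where "U u i j = - \<epsilon> *\<^sub>R (matrix_inv P *v (a j *v y u i))" for u i j
  define X where "X u = graft u (\<lambda>i. graft 0 (\<lambda>j. V (U u i j)))" for u
  have Qy: "y u i + \<epsilon> *\<^sub>R (kap P *v y u i) = cadj (a i) *v u" for u i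
  proof -
    have "(mat 1 + \<epsilon> *\<^sub>R kap P) *v y u i = cadj (a i) *v u"
      unfolding y_def om_def by (simp add: matrix_vector_mul_assoc[of _ _ "cadj (a i) *v u"] matrix_inv_right[OF Q])
    then show ?thesis by (simp add: matrix_vector_mult_add_rdistrib matrix_scaleR_mult_vector)
  qed
  have sumU: "(\<Sum>j\<in>UNIV. cadj (a j) *v U u i j) = - \<epsilon> *\<^sub>R (kap P *v y u i)" for u i
    by (simp add: U_def kap_def matrix_sum_mult_vector matrix_scaleR_mult_vector
        matrix_minus_mult_vector matrix_vector_mul_assoc scaleR_sum_right sum_negf matrix_mul_assoc)
  have eU: "energy N (V (U u i j)) = (a j *v y u i) \<bullet> (matrix_inv P *v (a j *v y u i))" for u i j
  proof -
    have "P *v U u i j = - \<epsilon> *\<^sub>R (a j *v y u i)"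
      by (simp add: U_def matrix_scaleR_mult_vector matrix_minus_mult_vector
          matrix_vector_mul_assoc[of P] matrix_inv_right[OF P])
    then show ?thesis unfolding V(3) by (simp add: U_def inner_commute)
  qed
  have "energy (Suc (Suc N)) (X u) = u \<bullet> (psi (om (kap P)) *v u)" for u
  proof -
    have up0: "up (graft 0 (\<lambda>j. V (U u i j))) [] = - \<epsilon> *\<^sub>R (kap P *v y u i)" for i
      by (simp add: up_graft V(2) sumU)
    have e0: "energy (Suc N) (graft 0 (\<lambda>j. V (U u i j)))
        = \<epsilon> * (up (graft 0 (\<lambda>j. V (U u i j))) [] \<bullet> up (graft 0 (\<lambda>j. V (U u i j))) [])
          + y u i \<bullet> (kap P *v y u i)" for i
      unfolding energy_graft up_graft by (simp add: V(2) eU kap_quadratic)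
    have yi: "up (graft 0 (\<lambda>j. V (U u i j))) [] + cadj (a i) *v u = y u i" for i
      unfolding up0 Qy[of u i, symmetric] by simp
    have node: "\<epsilon> * (y u i \<bullet> y u i) + y u i \<bullet> (kap P *v y u i)
        = \<epsilon> * ((cadj (a i) *v u) \<bullet> (om (kap P) *v (cadj (a i) *v u)))" for i
    proof -
      have "(cadj (a i) *v u) \<bullet> (om (kap P) *v (cadj (a i) *v u))
          = y u i \<bullet> y u i + \<epsilon> * (y u i \<bullet> (kap P *v y u i))"
        unfolding y_def[symmetric] by (subst Qy[symmetric]) (simp add: inner_add_left inner_add_right inner_commute)
      then show ?thesis by (simp add: distrib_left)
    qed
    have "energy (Suc (Suc N)) (X u) = u \<bullet> (D *v u)
        + (\<Sum>i\<in>UNIV. \<epsilon> * (y u i \<bullet> y u i) + y u i \<bullet> (kap P *v y u i))"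
      unfolding X_def energy_graft[of "Suc N"] e0 yi by (simp add: right_diff_distrib add.commute)
    then show ?thesis by (simp add: psi_quadratic sum_distrib_left node)
  qed
  moreover have "supported (Suc (Suc N)) (X u)" for u
    unfolding X_def by (intro supported_graft V)
  moreover have "X u [] = u" for u by (simp add: X_def)
  ultimately show ?thesis unfolding realizable_def by blast
qed

section \<open>Monotonicity and convergence of the iteration\<close>

lemma om_mono:
  assumes "posdef (mat 1 + \<epsilon> *\<^sub>R K)" "posdef (mat 1 + \<epsilon> *\<^sub>R K')"
    and le: "\<And>y. y \<bullet> (K' *v y) \<le> y \<bullet> (K *v y)"
  shows "\<epsilon> * (y \<bullet> (om K *v y)) \<le> \<epsilon> * (y \<bullet> (om K' *v y))"
proof (cases "\<epsilon> = 1")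
  case True
  have "y \<bullet> (om K *v y) \<le> y \<bullet> (om K' *v y)"
    unfolding om_def
    by (rule matrix_inv_antimono[OF assms(1,2)]) (unfold one_plus_quadratic, use le True in auto)
  then show ?thesis using True by simp
next
  case False
  then have e: "\<epsilon> = -1" using sign by simp
  have "y \<bullet> (om K' *v y) \<le> y \<bullet> (om K *v y)"
    unfolding om_def
    by (rule matrix_inv_antimono[OF assms(2,1)]) (unfold one_plus_quadratic, use le e in auto)
  then show ?thesis using e by simp
qed

text \<open>The sign outside \<open>om\<close> cancels the one inside, so a larger \<open>K\<close>
  lowers the form for both values of \<epsilon>.\<close>

lemma psi_om_mono:
  assumes "posdef (mat 1 + \<epsilon> *\<^sub>R K)" "posdef (mat 1 + \<epsilon> *\<^sub>R K')"
    and "\<And>y. y \<bullet> (K' *v y) \<le> y \<bullet> (K *v y)"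
  shows "u \<bullet> (psi (om K) *v u) \<le> u \<bullet> (psi (om K') *v u)"
  unfolding psi_quadratic sum_distrib_left
  by (intro add_left_mono sum_mono om_mono assms)

lemma kap_antimono:
  assumes "posdef P" "posdef P'" "\<And>u. u \<bullet> (P *v u) \<le> u \<bullet> (P' *v u)"
  shows "y \<bullet> (kap P' *v y) \<le> y \<bullet> (kap P *v y)"
  unfolding kap_quadratic by (intro sum_mono matrix_inv_antimono assms)

context
  fixes \<delta> :: real
  assumes \<delta>: "0 < \<delta>"
    and coercive: "\<And>N v. supported N v \<Longrightarrow> \<delta> * (\<Sum>w\<in>words N. v w \<bullet> v w) \<le> energy N v"
begin

lemma realizable_coercive:
  assumes "realizable N P"
  shows "\<delta> * (u \<bullet> u) \<le> u \<bullet> (P *v u)"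
proof -
  obtain v where v: "supported N v" "v [] = u" "energy N v = u \<bullet> (P *v u)"
    using assms unfolding realizable_def by blast
  have "v [] \<bullet> v [] \<le> (\<Sum>w\<in>words N. v w \<bullet> v w)" by (rule member_le_sum) simp_all
  then have "\<delta> * (v [] \<bullet> v []) \<le> \<delta> * (\<Sum>w\<in>words N. v w \<bullet> v w)"
    using \<delta> by (intro mult_left_mono) auto
  with coercive[OF v(1)] v show ?thesis by simp
qed

text \<open>For \<open>\<epsilon> = -1\<close> the vector \<open>\<Sum>\<^sub>j P\<inverse> a\<^sub>j y\<close> planted at the children of an empty root has energy
  \<open>\<langle>y, (\<kappa> - \<kappa>\<^sup>2) y\<rangle>\<close>; its coercivity keeps \<open>\<kappa>\<close> away from \<open>1\<close>.\<close>

lemma one_plus_kap_coercive: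
  assumes P: "posdef P" and R: "realizable N P" and L: "\<And>u. u \<bullet> (P *v u) \<le> L * (u \<bullet> u)"
  shows "\<delta> \<le> L" "\<delta> / L * (y \<bullet> y) \<le> y \<bullet> ((mat 1 + \<epsilon> *\<^sub>R kap P) *v y)"
proof -
  define o1 :: "complex^'d" where "o1 = (\<chi> i. 1)"
  have "o1 \<noteq> 0" by (simp add: o1_def vec_eq_iff)
  then have o1: "0 < o1 \<bullet> o1" by simp
  have "\<delta> * (o1 \<bullet> o1) \<le> L * (o1 \<bullet> o1)" using realizable_coercive[OF R, of o1] L[of o1] by linarith
  then show dL: "\<delta> \<le> L" using o1 by simp
  then have Lp: "L > 0" and dL1: "\<delta> / L \<le> 1" using \<delta> by auto
  show "\<delta> / L * (y \<bullet> y) \<le> y \<bullet> ((mat 1 + \<epsilon> *\<^sub>R kap P) *v y)"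
  proof (cases "\<epsilon> = 1")
    case True
    have "\<delta> / L * (y \<bullet> y) \<le> 1 * (y \<bullet> y)" by (intro mult_right_mono dL1) simp
    then show ?thesis using kap_nonneg[OF P, of y] True unfolding one_plus_quadratic by simp
  next
    case False
    then have e: "\<epsilon> = -1" using sign by simp
    obtain V where V: "\<And>u. supported N (V u)" "\<And>u. V u [] = u" "\<And>u. energy N (V u) = u \<bullet> (P *v u)"
      using R unfolding realizable_def by blast
    define u where "u j = matrix_inv P *v (a j *v y)" for j
    have Pu: "P *v u j = a j *v y" for j
      by (simp add: u_def matrix_vector_mul_assoc[of P] matrix_inv_right[OF P])
    define k where "k = y \<bullet> (kap P *v y)"
    have k: "k = (\<Sum>j\<in>UNIV. u j \<bullet> (P *v u j))"
      unfolding k_def kap_quadratic Pu u_def[symmetric] by (simp add: inner_commute)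
    have ksum: "(\<Sum>j\<in>UNIV. cadj (a j) *v u j) = kap P *v y"
      by (simp add: u_def kap_def matrix_sum_mult_vector matrix_vector_mul_assoc matrix_mul_assoc)
    define v where "v = graft 0 (\<lambda>j. V (u j))"
    have en: "energy (Suc N) v = \<epsilon> * ((kap P *v y) \<bullet> (kap P *v y)) + k"
      unfolding v_def energy_graft by (simp add: V ksum k)
    have "(\<Sum>j\<in>UNIV. u j \<bullet> u j) \<le> (\<Sum>j\<in>UNIV. \<Sum>w\<in>words N. V (u j) w \<bullet> V (u j) w)"
    proof (rule sum_mono)
      fix j
      have "V (u j) [] \<bullet> V (u j) [] \<le> (\<Sum>w\<in>words N. V (u j) w \<bullet> V (u j) w)"
        by (rule member_le_sum) simp_all
      then show "u j \<bullet> u j \<le> (\<Sum>w\<in>words N. V (u j) w \<bullet> V (u j) w)" by (simp add: V)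
    qed
    also have "\<dots> = (\<Sum>w\<in>words (Suc N). v w \<bullet> v w)" by (simp add: sum_words_snoc v_def)
    finally have "\<delta> * (\<Sum>j\<in>UNIV. u j \<bullet> u j) \<le> \<delta> * (\<Sum>w\<in>words (Suc N). v w \<bullet> v w)"
      using \<delta> by (intro mult_left_mono) auto
    also have "\<dots> \<le> energy (Suc N) v"
      by (rule coercive) (simp add: v_def supported_graft V)
    finally have c1: "\<delta> * (\<Sum>j\<in>UNIV. u j \<bullet> u j) \<le> k - (kap P *v y) \<bullet> (kap P *v y)"
      unfolding en by (simp add: e)
    \<comment> \<open>The bound \<open>L\<close> for \<open>P\<close> turns the lengths of the
      \<open>u j\<close> into the form of \<kappa>. Hence the square length of \<kappa> y is at most
      (1 - \<delta>/L) \<open>k\<close>, and Cauchy-Schwarz gives \<kappa> \<le> 1 -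
      \<delta>/L.\<close>
    have "k \<le> L * (\<Sum>j\<in>UNIV. u j \<bullet> u j)" unfolding k sum_distrib_left by (intro sum_mono L)
    then have "\<delta> / L * k \<le> \<delta> / L * (L * (\<Sum>j\<in>UNIV. u j \<bullet> u j))"
      using \<delta> Lp by (intro mult_left_mono) auto
    also have "\<dots> = \<delta> * (\<Sum>j\<in>UNIV. u j \<bullet> u j)" using Lp by simp
    finally have c2: "(kap P *v y) \<bullet> (kap P *v y) \<le> (1 - \<delta> / L) * k"
      using c1 by (simp add: left_diff_distrib)
    have k0: "0 \<le> k" unfolding k_def by (rule kap_nonneg[OF P])
    have "k * k \<le> (y \<bullet> y) * ((kap P *v y) \<bullet> (kap P *v y))"
      unfolding k_def using Cauchy_Schwarz_ineq[of y "kap P *v y"] by (simp add: power2_eq_square)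
    also have "\<dots> \<le> (y \<bullet> y) * ((1 - \<delta> / L) * k)" by (intro mult_left_mono c2) simp
    finally have kk: "k * k \<le> k * ((1 - \<delta> / L) * (y \<bullet> y))" by (simp add: mult_ac)
    have "k \<le> (1 - \<delta> / L) * (y \<bullet> y)"
    proof (cases "k = 0")
      case True
      then show ?thesis using dL1 by simp
    next
      case False
      then show ?thesis using kk k0 by simp
    qed
    then show ?thesis unfolding one_plus_quadratic k_def[symmetric] by (simp add: e left_diff_distrib)
  qed
qed

text \<open>All iterates lie below the first one, so a single \<open>L\<close> bounds them, and
  \<open>one_plus_kap_coercive\<close> gives the uniform constant \<delta>/L. Both inverses in the
  iteration are then continuous along the sequence. \<open>S\<close> will be the algebra
  \<open>B\<close>.\<close>

lemma fixed_point_exists: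
  assumes S: "closed S" "psi (mat 1) \<in> S"
    and step: "\<And>P. P \<in> S \<Longrightarrow> posdef P \<Longrightarrow> posdef (mat 1 + \<epsilon> *\<^sub>R kap P) \<Longrightarrow> psi (om (kap P)) \<in> S"
  obtains P where "P \<in> S" "posdef P" "posdef (mat 1 + \<epsilon> *\<^sub>R kap P)" "psi (om (kap P)) = P"
proof -
  obtain L where "\<And>u. \<bar>u \<bullet> (psi (mat 1) *v u)\<bar> \<le> L * (u \<bullet> u)"
    using matrix_quadratic_bounded[of "psi (mat 1)"] by blast
  then have L: "u \<bullet> (psi (mat 1) *v u) \<le> L * (u \<bullet> u)" for u using abs_le_D1 by blast
  define F where "F k = ((\<lambda>P. psi (om (kap P))) ^^ k) (psi (mat 1))" for k
  have F0: "F 0 = psi (mat 1)" and FS: "\<And>k. F (Suc k) = psi (om (kap (F k)))"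
    by (simp_all add: F_def)
  have one: "posdef (mat 1 + \<epsilon> *\<^sub>R (0::complex^'m^'m))"
    by (rule coercive_imp_posdef[where c = 1]) (simp_all add: hermitian_def cadj_mat)
  have om0: "om 0 = mat 1" unfolding om_def by (rule matrix_inv_eqI[OF one]) simp
  have herm1: "hermitian (mat 1 :: complex^'m^'m)" by (simp add: hermitian_def cadj_mat)
  define good where "good P \<longleftrightarrow> P \<in> S \<and> posdef P \<and> (\<exists>N. realizable N P) \<and>
    (\<forall>u. u \<bullet> (P *v u) \<le> L * (u \<bullet> u))" for P
  have goodQ: "posdef (mat 1 + \<epsilon> *\<^sub>R kap P)" if P: "good P" for P
  proof -
    obtain N where N: "realizable N P" "posdef P" "\<And>u. u \<bullet> (P *v u) \<le> L * (u \<bullet> u)"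
      using P unfolding good_def by blast
    note c = one_plus_kap_coercive[OF N(2,1,3)]
    show ?thesis
      by (rule coercive_imp_posdef[OF hermitian_one_plus[OF hermitian_kap[OF N(2)]] _ c(2)])
         (use c(1) \<delta> in simp)
  qed
  have realiz_pos: "posdef P" if "realizable N P" "hermitian P" for N P
    using that(2) \<delta> realizable_coercive[OF that(1)] by (rule coercive_imp_posdef)
  \<comment> \<open>The first iterate belongs to \<kappa> = 0, and every \<open>kap P\<close> is
    nonnegative.\<close>
  have below: "u \<bullet> (psi (om (kap P)) *v u) \<le> u \<bullet> (psi (mat 1) *v u)" if "good P" for P u
    using psi_om_mono[OF goodQ[OF that] one, of u] kap_nonneg that by (simp add: om0 good_def)
  have good: "good (F k)" for k
  proof (induction k)
    case 0
    show ?case unfolding F0 good_def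
      using S realizable_base L realiz_pos[OF realizable_base hermitian_psi[OF herm1]] by blast
  next
    case (Suc k)
    then obtain N where N: "realizable N (F k)" "posdef (F k)" "F k \<in> S" unfolding good_def by blast
    note Q = goodQ[OF Suc]
    have R: "realizable (Suc (Suc N)) (F (Suc k))" unfolding FS by (rule realizable_step[OF N(2) Q N(1)])
    have "hermitian (om (kap (F k)))" unfolding om_def using posdefD(1)[OF posdef_matrix_inv[OF Q]] .
    then have "posdef (F (Suc k))" using realiz_pos[OF R] hermitian_psi unfolding FS by blast
    moreover have "F (Suc k) \<in> S" unfolding FS by (rule step[OF N(3,2) Q])
    moreover have "u \<bullet> (F (Suc k) *v u) \<le> L * (u \<bullet> u)" for u
      unfolding FS using below[OF Suc, of u] L[of u] by linarith
    ultimately show ?case unfolding good_def using R by blast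
  qed
  have pos: "posdef (F k)" for k using good unfolding good_def by blast
  \<comment> \<open>The map is monotone in \<open>P\<close> and its first application decreases, so
    every later one does too.\<close>
  have dec: "u \<bullet> (F (Suc k) *v u) \<le> u \<bullet> (F k *v u)" for k u
  proof (induction k arbitrary: u)
    case 0
    show ?case unfolding FS F0[symmetric] using below[OF good[of 0], of u] by (simp add: F0)
  next
    case (Suc k)
    show ?case unfolding FS[of "Suc k"] FS[of k]
      using kap_antimono[OF pos pos Suc]
      by (intro psi_om_mono goodQ[OF good] goodQ[OF good, of "Suc k", unfolded FS]) (simp add: FS)
  qed
  have low: "\<delta> * (u \<bullet> u) \<le> u \<bullet> (F k *v u)" for k u
    using good[of k] realizable_coercive unfolding good_def by blast
  have lowQ: "\<delta> / L * (y \<bullet> y) \<le> y \<bullet> ((mat 1 + \<epsilon> *\<^sub>R kap (F k)) *v y)" and dL: "\<delta> \<le> L" for k y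
    using good[of k] one_plus_kap_coercive[of "F k"] unfolding good_def by blast+
  have cL: "0 < \<delta> / L" using \<delta> dL by simp
  have herm: "hermitian (F k)" for k by (rule posdefD(1)[OF pos])
  have hermQ: "hermitian (mat 1 + \<epsilon> *\<^sub>R kap (F k))" for k
    by (intro hermitian_one_plus hermitian_kap pos)
  obtain P where P: "F \<longlonglongrightarrow> P"
    using decreasing_hermitian_convergent[of F] herm dec posdefD(2)[OF pos] by blast
  have hP: "hermitian P" by (rule tendsto_hermitian[OF P herm])
  have posP: "posdef P"
    using hP \<delta> tendsto_quadratic_le[OF P low] by (rule coercive_imp_posdef)
  have inv: "(\<lambda>k. matrix_inv (F k)) \<longlonglongrightarrow> matrix_inv P"
    using P herm \<delta> low by (rule tendsto_matrix_inv)
  have kapl: "(\<lambda>k. kap (F k)) \<longlonglongrightarrow> kap P"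
    unfolding kap_def by (intro tendsto_sum tendsto_matrix_mult tendsto_const inv)
  have Ql: "(\<lambda>k. mat 1 + \<epsilon> *\<^sub>R kap (F k)) \<longlonglongrightarrow> mat 1 + \<epsilon> *\<^sub>R kap P"
    by (intro tendsto_add tendsto_scaleR tendsto_const kapl)
  have posQ: "posdef (mat 1 + \<epsilon> *\<^sub>R kap P)"
    using hermitian_one_plus[OF hermitian_kap[OF posP]] cL tendsto_quadratic_le[OF Ql lowQ]
    by (rule coercive_imp_posdef)
  have oml: "(\<lambda>k. om (kap (F k))) \<longlonglongrightarrow> om (kap P)"
    unfolding om_def using Ql hermQ cL lowQ by (rule tendsto_matrix_inv)
  have "(\<lambda>k. psi (om (kap (F k)))) \<longlonglongrightarrow> psi (om (kap P))"
    unfolding psi_def by (intro tendsto_add tendsto_scaleR tendsto_sum tendsto_matrix_mult tendsto_const oml)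
  moreover have "(\<lambda>k. psi (om (kap (F k)))) \<longlonglongrightarrow> P"
    unfolding FS[symmetric] using P by (rule LIMSEQ_Suc)
  ultimately have "psi (om (kap P)) = P" by (rule LIMSEQ_unique)
  moreover have "P \<in> S"
    by (rule closed_sequentially[OF S(1) _ P]) (use good in \<open>auto simp: good_def\<close>)
  ultimately show ?thesis using posP posQ that by blast
qed

end

end

section \<open>Semicircular families act on words\<close>

text \<open>Chebyshev polynomials of the second kind in x/2, the orthogonal polynomials of the
  semicircle law.\<close>

fun cheb :: "'b::ring_1 \<Rightarrow> nat \<Rightarrow> 'b" where
  "cheb x 0 = 1"
| "cheb x (Suc 0) = x"
| "cheb x (Suc (Suc k)) = x * cheb x (Suc k) - cheb x k"

lemma cheb_cos: "cheb (2 * cos \<theta>) k * sin \<theta> = sin (real (Suc k) * \<theta>)"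
proof (induction "2 * cos \<theta>" k rule: cheb.induct)
  case 2
  then show ?case using sin_double[of \<theta>] by simp
next
  case (3 k)
  have "sin (real (Suc (Suc (Suc k))) * \<theta>) + sin (real (Suc k) * \<theta>)
      = 2 * cos \<theta> * sin (real (Suc (Suc k)) * \<theta>)"
  proof -
    have "sin (\<phi> + \<theta>) + sin (\<phi> - \<theta>) = 2 * cos \<theta> * sin \<phi>" for \<phi> :: real
      by (simp add: sin_add sin_diff)
    from this[of "real (Suc (Suc k)) * \<theta>"] show ?thesis by (simp add: algebra_simps)
  qed
  then show ?case using 3 by (simp add: algebra_simps)
qed simp

lemma continuous_cheb: "continuous_on A (\<lambda>t::real. cheb t k)"
proof (induction k rule: less_induct)
  case (less k)
  consider "k = 0" | "k = 1" | m where "k = Suc (Suc m)" by (metis One_nat_def nat.exhaust)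
  then show ?case by cases (auto intro!: continuous_intros less)
qed

lemma cheb_orthogonal_one:
  assumes "0 < k"
  shows "((\<lambda>t. cheb t k * (1 / (2 * pi) * sqrt (4 - t\<^sup>2))) has_integral 0) {-2..2}"
proof -
  \<comment> \<open>With t = 2 cos \<theta> the integrand becomes sin((k+1) \<theta>) / pi;
    multiplied by dt/d\<theta> it is a difference of two cosines, whose primitive this is. It
    vanishes at \<theta> = 0 and \<theta> = pi.\<close>
  define F where "F t = - (sin (real k * arccos (t / 2)) / real k
    - sin (real (k + 2) * arccos (t / 2)) / real (k + 2)) / pi" for t
  have "((\<lambda>t. cheb t k * (1 / (2 * pi) * sqrt (4 - t\<^sup>2))) has_integral F 2 - F (-2)) {-2..2}"
  \<comment> \<open>The interior version is used because \<open>arccos\<close> has no derivative at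
    the end points.\<close>
  proof (rule fundamental_theorem_of_calculus_interior)
    show "continuous_on {-2..2} F"
      unfolding F_def by (intro continuous_intros) (use assms in auto)
    fix t :: real assume t: "t \<in> {-2<..<2}"
    define \<theta> where "\<theta> = arccos (t / 2)"
    have t2: "t = 2 * cos \<theta>" using t by (simp add: \<theta>_def)
    have sin: "sin \<theta> = sqrt (1 - (t / 2)\<^sup>2)" using t by (simp add: \<theta>_def sin_arccos)
    have "(t / 2)\<^sup>2 < 1" using t by (simp add: power2_less_1_iff abs_if)
    then have sp: "sin \<theta> > 0" unfolding sin by simp
    have sq: "sqrt (4 - t\<^sup>2) = 2 * sin \<theta>"
    proof -
      have "4 - t\<^sup>2 = 4 * (1 - (t / 2)\<^sup>2)" by (simp add: field_simps)
      then show ?thesis unfolding sin by (simp only: real_sqrt_mult) simp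
    qed
    have dtheta: "((\<lambda>t. arccos (t / 2)) has_real_derivative - (1 / (2 * sin \<theta>))) (at t)"
    proof -
      have "(arccos has_real_derivative inverse (- sqrt (1 - (t / 2)\<^sup>2))) (at (t / 2))"
        using t by (intro DERIV_arccos) auto
      then have "((\<lambda>t. arccos (t / 2)) has_real_derivative inverse (- sqrt (1 - (t / 2)\<^sup>2)) * (1 / 2)) (at t)"
        by (rule DERIV_chain2) (auto intro!: derivative_eq_intros)
      then show ?thesis unfolding sin[symmetric] by (simp add: field_simps)
    qed
    have "(F has_real_derivative
        - (cos (real k * \<theta>) - cos (real (k + 2) * \<theta>)) / pi * - (1 / (2 * sin \<theta>))) (at t)"
    proof -
      define G where "G \<phi> = - (sin (real k * \<phi>) / real k - sin (real (k + 2) * \<phi>) / real (k + 2)) / pi" for \<phi>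
      have "(G has_real_derivative - (cos (real k * \<phi>) - cos (real (k + 2) * \<phi>)) / pi) (at \<phi>)" for \<phi>
        unfolding G_def using assms by (auto intro!: derivative_eq_intros simp del: of_nat_add)
      from DERIV_chain2[OF this dtheta] have
        "((\<lambda>t. G (arccos (t / 2))) has_real_derivative
          - (cos (real k * \<theta>) - cos (real (k + 2) * \<theta>)) / pi * - (1 / (2 * sin \<theta>))) (at t)"
        unfolding \<theta>_def .
      then show ?thesis unfolding G_def F_def .
    qed
    also have "cos (real k * \<theta>) - cos (real (k + 2) * \<theta>) = 2 * sin (real (Suc k) * \<theta>) * sin \<theta>"
    proof -
      have "cos (\<phi> - \<theta>) - cos (\<phi> + \<theta>) = 2 * sin \<phi> * sin \<theta>" for \<phi> :: real
        by (simp add: cos_add cos_diff)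
      from this[of "real (Suc k) * \<theta>"] show ?thesis by (simp add: algebra_simps)
    qed
    also have "- (2 * sin (real (Suc k) * \<theta>) * sin \<theta>) / pi * - (1 / (2 * sin \<theta>))
        = cheb t k * (1 / (2 * pi) * sqrt (4 - t\<^sup>2))"
    proof -
      have "sin (real (Suc k) * \<theta>) = cheb t k * sin \<theta>" unfolding t2 by (rule cheb_cos[symmetric])
      then show ?thesis unfolding sq using sp by simp
    qed
    finally show "(F has_vector_derivative cheb t k * (1 / (2 * pi) * sqrt (4 - t\<^sup>2))) (at t)"
      by (simp add: has_real_derivative_iff_has_vector_derivative)
  qed simp
  moreover have "F 2 = 0" by (simp add: F_def)
  moreover have "F (-2) = 0"
    unfolding F_def using sin_npi[of k] sin_npi[of "k + 2"] by simp
  ultimately show ?thesis by simp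
qed

section \<open>Orthonormal words in a free semicircular family\<close>

locale semicircular = faithful_trace \<tau> for \<tau> :: "'a::cstar_algebra \<Rightarrow> complex" +
  fixes s :: "'n::finite \<Rightarrow> 'a"
  assumes family: "free_semicircular_family \<tau> s"
begin

lemma star_s [simp]: "star (s i) = s i"
  using family unfolding free_semicircular_family_def standard_semicircular_def by blast

lemma trace_commute: "\<tau> (x * y) = \<tau> (y * x)"
  using faithful unfolding faithful_tracial_state_def by blast

text \<open>The extra power absorbs the factor \<open>s i\<close> of the recursion, so that the
  moments alone start the induction.\<close>

lemma trace_cheb:
  "\<tau> (cheb (s i) k * s i ^ m)
    = complex_of_real (integral {-2..2} (\<lambda>t. cheb t k * t ^ m * (1 / (2 * pi) * sqrt (4 - t\<^sup>2))))"
proof (induction k arbitrary: m rule: less_induct)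
  case (less k)
  have int: "(\<lambda>t. cheb t j * t ^ m * (1 / (2 * pi) * sqrt (4 - t\<^sup>2))) integrable_on {-2..2}" for j m
    by (intro integrable_continuous_interval continuous_intros continuous_cheb)
  have mom: "\<tau> (s i ^ m) = complex_of_real (integral {-2..2} (\<lambda>t. t ^ m * (1 / (2 * pi) * sqrt (4 - t\<^sup>2))))" for m
    using family unfolding free_semicircular_family_def standard_semicircular_def by blast
  consider "k = 0" | "k = 1" | j where "k = Suc (Suc j)" by (metis One_nat_def nat.exhaust)
  then show ?case
  proof cases
    case 1
    then show ?thesis by (simp add: mom)
  next
    case 2
    then show ?thesis using mom[of "Suc m"] by simp
  next
    case (3 j)
    have "cheb t k * t ^ m * (1 / (2 * pi) * sqrt (4 - t\<^sup>2))
      = cheb t (Suc j) * t ^ Suc m * (1 / (2 * pi) * sqrt (4 - t\<^sup>2))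
        - cheb t j * t ^ m * (1 / (2 * pi) * sqrt (4 - t\<^sup>2))" for t
      by (simp add: 3 algebra_simps diff_divide_distrib)
    then have "integral {-2..2} (\<lambda>t. cheb t k * t ^ m * (1 / (2 * pi) * sqrt (4 - t\<^sup>2)))
      = integral {-2..2} (\<lambda>t. cheb t (Suc j) * t ^ Suc m * (1 / (2 * pi) * sqrt (4 - t\<^sup>2)))
        - integral {-2..2} (\<lambda>t. cheb t j * t ^ m * (1 / (2 * pi) * sqrt (4 - t\<^sup>2)))"
      by (simp only: integral_diff[OF int int])
    then have "complex_of_real (integral {-2..2} (\<lambda>t. cheb t k * t ^ m * (1 / (2 * pi) * sqrt (4 - t\<^sup>2))))
      = \<tau> (cheb (s i) (Suc j) * s i ^ Suc m) - \<tau> (cheb (s i) j * s i ^ m)"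
      using less[of "Suc j" "Suc m"] less[of j m] 3 by simp
    also have "\<tau> (cheb (s i) (Suc j) * s i ^ Suc m) = \<tau> (s i * cheb (s i) (Suc j) * s i ^ m)"
      using trace_commute[of "cheb (s i) (Suc j) * s i ^ m" "s i"]
      by (simp only: power_Suc2 mult.assoc)
    finally show ?thesis by (simp add: 3 left_diff_distrib trace_diff)
  qed
qed

lemma trace_cheb_eq_0: "0 < k \<Longrightarrow> \<tau> (cheb (s i) k) = 0"
  using trace_cheb[of i k 0] integral_unique[OF cheb_orthogonal_one[of k]] by simp

text \<open>Under the isomorphism with the free Fock space \<open>ew w\<close> corresponds to the basis vector \<open>w\<close>.\<close>

fun ew :: "'n list \<Rightarrow> 'a" where
  "ew [] = 1"
| "ew [i] = s i"
| "ew (i # j # w) = s i * ew (j # w) - (if i = j then ew w else 0)"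

lemma s_mult_ew:
  "s i * ew w = ew (i # w) + (case w of [] \<Rightarrow> 0 | j # w' \<Rightarrow> if i = j then ew w' else 0)"
  by (cases w) simp_all

lemma ew_replicate:
  assumes "w = [] \<or> hd w \<noteq> i"
  shows "ew (replicate k i @ w) = cheb (s i) k * ew w"
proof (induction k rule: less_induct)
  case (less k)
  consider "k = 0" | "k = 1" | j where "k = Suc (Suc j)" by (metis One_nat_def nat.exhaust)
  then show ?case
  proof cases
    case 2
    then show ?thesis using assms by (cases w) auto
  next
    case (3 j)
    then show ?thesis
      using less[of j] less[of "Suc j"] by (simp add: left_diff_distrib mult.assoc)
  qed simp
qed

lemma cheb_generated: "cheb x k \<in> star_algebra_generated {x}"
proof (induction x k rule: cheb.induct)
  case (3 x k)
  have "cheb x (Suc (Suc k)) = x * cheb x (Suc k) + cscale (-1) (cheb x k)"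
    by (simp add: cscale_minus_left)
  then show ?case
    by (simp only:) (intro star_algebra_generated.intros 3 singletonI)
qed (auto intro: star_algebra_generated.intros)

text \<open>Cut the word into maximal runs of one letter. Each run is a Chebyshev polynomial of
  positive degree, hence centred, and neighbouring runs differ, as freeness demands. Tracking the
  first letter lets the induction see that the new run differs from the next one.\<close>

lemma ew_alternating:
  "w \<noteq> [] \<Longrightarrow> \<exists>ws. ws \<noteq> [] \<and> distinct_adj (map fst ws) \<and> fst (hd ws) = hd w \<and>
    (\<forall>(i, x)\<in>set ws. x \<in> star_algebra_generated {s i} \<and> \<tau> x = 0) \<and>
    prod_list (map snd ws) = ew w"
proof (induction "length w" arbitrary: w rule: less_induct)
  case less
  define i where "i = hd w"
  define k where "k = length (takeWhile (\<lambda>j. j = i) w)"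
  define w' where "w' = dropWhile (\<lambda>j. j = i) w"
  have "takeWhile (\<lambda>j. j = i) w = replicate k i"
    unfolding k_def by (rule replicate_eqI) (auto dest: set_takeWhileD)
  then have w: "w = replicate k i @ w'"
    unfolding w'_def using takeWhile_dropWhile_id[of "\<lambda>j. j = i" w] by simp
  have k: "0 < k" using less.prems by (cases w) (auto simp: k_def i_def)
  have w': "w' = [] \<or> hd w' \<noteq> i"
    unfolding w'_def using hd_dropWhile[of "\<lambda>j. j = i" w] by blast
  have e: "ew w = cheb (s i) k * ew w'" using ew_replicate[OF w'] w by simp
  have x: "cheb (s i) k \<in> star_algebra_generated {s i}" "\<tau> (cheb (s i) k) = 0"
    using cheb_generated trace_cheb_eq_0[OF k] by auto
  show ?case
  proof (cases "w' = []")
    case True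
    then show ?thesis using x e by (intro exI[of _ "[(i, cheb (s i) k)]"]) (simp add: i_def)
  next
    case False
    have "length w' < length w" using k by (subst w) simp
    from less.hyps[OF this False] obtain ws where ws: "ws \<noteq> []" "distinct_adj (map fst ws)"
      "fst (hd ws) = hd w'" "\<forall>(i, x)\<in>set ws. x \<in> star_algebra_generated {s i} \<and> \<tau> x = 0"
      "prod_list (map snd ws) = ew w'" by blast
    have "i \<noteq> fst (hd ws)" using ws(3) w' False by auto
    then have "distinct_adj (i # map fst ws)" using ws(1,2) by (cases ws) (auto simp: distinct_adj_Cons)
    then show ?thesis using ws x e
      by (intro exI[of _ "(i, cheb (s i) k) # ws"]) (auto simp: i_def)
  qed
qed

lemma trace_ew: "\<tau> (ew w) = (if w = [] then 1 else 0)"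
proof (cases "w = []")
  case False
  obtain ws where ws: "ws \<noteq> []" "distinct_adj (map fst ws)"
    "\<forall>(i, x)\<in>set ws. x \<in> star_algebra_generated {s i} \<and> \<tau> x = 0" "prod_list (map snd ws) = ew w"
    using ew_alternating[OF False] by blast
  have "freely_independent \<tau> s" using family unfolding free_semicircular_family_def by blast
  then have "\<tau> (prod_list (map snd ws)) = 0"
    using ws(1-3) unfolding freely_independent_def by (elim allE[of _ ws]) auto
  then show ?thesis using False ws by simp
qed (simp add: trace_one)

text \<open>The first letter of \<open>u\<close> moves to the other side as \<open>s i\<close>.
  There its creation part cancels against the correction term in the recursion for
  \<open>ew u\<close>, and its annihilation part strips the same letter from
  \<open>w\<close>.\<close>

lemma trace_ew_ew: "\<tau> (star (ew u) * ew w) = (if u = w then 1 else 0)"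
proof (induction u arbitrary: w rule: ew.induct)
  case 1
  then show ?case by (auto simp: trace_ew)
next
  case (2 i)
  have "\<tau> (star (ew [i]) * ew w)
      = \<tau> (ew (i # w)) + \<tau> (case w of [] \<Rightarrow> 0 | j # w' \<Rightarrow> if i = j then ew w' else 0)"
    by (simp add: s_mult_ew trace_add del: ew.simps(3))
  then show ?case by (cases w) (auto simp: trace_ew simp del: ew.simps)
next
  case (3 i j u)
  have "star (ew (i # j # u)) * ew w
      = star (ew (j # u)) * (s i * ew w) - (if i = j then star (ew u) * ew w else 0)"
    by (simp add: star_diff star_mult left_diff_distrib mult.assoc)
  also have "\<tau> \<dots> = \<tau> (star (ew (j # u)) * ew (i # w))
      + \<tau> (star (ew (j # u)) * (case w of [] \<Rightarrow> 0 | j # w' \<Rightarrow> if i = j then ew w' else 0))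
      - (if i = j then \<tau> (star (ew u) * ew w) else 0)"
    unfolding s_mult_ew by (simp add: trace_diff distrib_left trace_add)
  also have "\<dots> = (if i # j # u = w then 1 else 0)"
    using 3(2) by (cases w) (auto simp: 3(1) simp del: ew.simps)
  finally show ?case .
qed

lemma rip_cscale_ew: "rip (cscale \<alpha> (ew u)) (cscale \<beta> (ew w)) = (if u = w then \<alpha> \<bullet> \<beta> else 0)"
  by (simp add: rip_def star_cscale cscale_mult_left cscale_mult_right trace_cscale trace_ew_ew
      inner_complex_def)

definition emb :: "nat \<Rightarrow> ('n list \<Rightarrow> complex^'k) \<Rightarrow> 'a^'k"
  where "emb N c = (\<chi> k. \<Sum>w\<in>words N. cscale (c w $ k) (ew w))"

lemma vip_emb: "vip (emb N c) (emb N c') = (\<Sum>w\<in>words N. c w \<bullet> c' w)"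
proof -
  have "vip (emb N c) (emb N c') = (\<Sum>k\<in>UNIV. \<Sum>u\<in>words N. \<Sum>w\<in>words N. if u = w then c u $ k \<bullet> c' w $ k else 0)"
    by (simp add: vip_def emb_def rip_sum_left rip_sum_right rip_cscale_ew)
  also have "\<dots> = (\<Sum>k\<in>UNIV. \<Sum>u\<in>words N. c u $ k \<bullet> c' u $ k)" by simp
  also have "\<dots> = (\<Sum>w\<in>words N. c w \<bullet> c' w)" unfolding inner_vec_def by (rule sum.swap)
  finally show ?thesis .
qed

section \<open>The generated algebra, the span of the words and the norm closure\<close>

abbreviation generated :: "'a set"
  where "generated \<equiv> star_algebra_generated (range s)"

definition ew_span :: "'a set"
  where "ew_span = {y. \<exists>N c. (\<forall>w. N < length w \<longrightarrow> c w = 0) \<and> y = (\<Sum>w\<in>words N. cscale (c w) (ew w))}"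

lemma ew_span_sum_eq:
  assumes "\<forall>w. N < length w \<longrightarrow> c w = 0" "N \<le> M"
  shows "(\<Sum>w\<in>words M. cscale (c w) (ew w)) = (\<Sum>w\<in>words N. cscale (c w) (ew w))"
  using assms by (intro sum_words_mono) auto

lemma ew_span_add: assumes "x \<in> ew_span" "y \<in> ew_span" shows "x + y \<in> ew_span"
proof -
  obtain N c where x: "\<forall>w. N < length w \<longrightarrow> c w = 0" "x = (\<Sum>w\<in>words N. cscale (c w) (ew w))"
    using assms(1) unfolding ew_span_def by blast
  obtain M d where y: "\<forall>w. M < length w \<longrightarrow> d w = 0" "y = (\<Sum>w\<in>words M. cscale (d w) (ew w))"
    using assms(2) unfolding ew_span_def by blast
  have "x + y = (\<Sum>w\<in>words (max N M). cscale (c w + d w) (ew w))"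
    using ew_span_sum_eq[OF x(1), of "max N M"] ew_span_sum_eq[OF y(1), of "max N M"]
    by (simp add: x(2) y(2) cscale_add_left sum.distrib)
  moreover have "\<forall>w. max N M < length w \<longrightarrow> c w + d w = 0" using x(1) y(1) by auto
  ultimately show ?thesis unfolding ew_span_def
    by (intro CollectI exI[of _ "max N M"] exI[of _ "\<lambda>w. c w + d w"] conjI)
qed

lemma ew_span_cscale: assumes "x \<in> ew_span" shows "cscale a x \<in> ew_span"
proof -
  obtain N c where x: "\<forall>w. N < length w \<longrightarrow> c w = 0" "x = (\<Sum>w\<in>words N. cscale (c w) (ew w))"
    using assms(1) unfolding ew_span_def by blast
  have "cscale a x = (\<Sum>w\<in>words N. cscale (a * c w) (ew w))"
    by (simp add: x(2) cscale_sum_right cscale_cscale)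
  moreover have "\<forall>w. N < length w \<longrightarrow> a * c w = 0" using x(1) by simp
  ultimately show ?thesis unfolding ew_span_def
    by (intro CollectI exI[of _ N] exI[of _ "\<lambda>w. a * c w"] conjI)
qed

lemma ew_in_span: "ew u \<in> ew_span"
proof -
  have "(\<Sum>w\<in>words (length u). cscale (if w = u then 1 else 0) (ew w)) = (\<Sum>w\<in>words (length u). if w = u then ew u else 0)"
    by (intro sum.cong) auto
  also have "\<dots> = ew u" by (simp add: words_def[of "length u"] finite_words[unfolded words_def])
  finally show ?thesis unfolding ew_span_def
    by (intro CollectI exI[of _ "length u"] exI[of _ "\<lambda>w. if w = u then 1 else 0"] conjI) auto
qed

lemma ew_span_sum: "(\<And>i. i \<in> I \<Longrightarrow> f i \<in> ew_span) \<Longrightarrow> (\<Sum>i\<in>I. f i) \<in> ew_span"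
proof (induction I rule: infinite_finite_induct)
  case (insert i I)
  then show ?case by (auto intro: ew_span_add)
qed (use ew_span_cscale[OF ew_in_span, of 0] in auto)

lemma s_mult_ew_span: assumes "x \<in> ew_span" shows "s i * x \<in> ew_span"
proof -
  obtain N c where x: "x = (\<Sum>w\<in>words N. cscale (c w) (ew w))"
    using assms(1) unfolding ew_span_def by blast
  have "s i * ew w \<in> ew_span" for w
    unfolding s_mult_ew using ew_span_cscale[OF ew_in_span, of 0]
    by (intro ew_span_add ew_in_span) (auto split: list.split intro: ew_in_span)
  then show ?thesis unfolding x sum_distrib_left cscale_mult_right
    by (intro ew_span_sum ew_span_cscale)
qed

text \<open>Letting generated elements act on the span reduces products of words to multiplication
  by a single \<open>s i\<close>. The clause for \<open>star y\<close> carries the induction through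
  the star rule.\<close>

lemma generated_mult_ew_span:
  assumes "y \<in> generated"
  shows "g \<in> ew_span \<Longrightarrow> y * g \<in> ew_span \<and> star y * g \<in> ew_span"
  using assms
proof (induction y arbitrary: g rule: star_algebra_generated.induct)
  case (gen x)
  then show ?case by (auto intro: s_mult_ew_span)
next
  case (mult x y)
  then show ?case by (simp add: star_mult mult.assoc)
qed (auto simp: star_add distrib_right star_cscale cscale_mult_left star_star
    intro: ew_span_add ew_span_cscale)

lemma generated_subset_span: "y \<in> generated \<Longrightarrow> y \<in> ew_span"
  using generated_mult_ew_span[of y 1] ew_in_span[of "[]"] by simp

lemma ew_generated: "ew w \<in> generated"
proof (induction w rule: ew.induct)
  case (3 i j w)
  have m: "s i * ew (j # w) \<in> generated"
    by (rule star_algebra_generated.mult[OF star_algebra_generated.gen[OF rangeI] 3(1)])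
  show ?case
  proof (cases "i = j")
    case True
    have "s i * ew (j # w) + cscale (-1) (ew w) \<in> generated"
      using m star_algebra_generated.scale[OF 3(2)[OF True]] by (rule star_algebra_generated.add)
    then show ?thesis using True by (simp add: cscale_minus_left)
  qed (use m in simp)
qed (auto intro: star_algebra_generated.intros)

lemma generated_sum: "(\<And>i. i \<in> I \<Longrightarrow> f i \<in> generated) \<Longrightarrow> (\<Sum>i\<in>I. f i) \<in> generated"
proof (induction I rule: infinite_finite_induct)
  case (insert i I)
  then show ?case by (auto intro: star_algebra_generated.add)
qed (use star_algebra_generated.scale[OF star_algebra_generated.one, of 0 "range s"] in auto)

lemma emb_in_vecs: "emb N c \<in> vecs generated"
  unfolding vecs_def emb_def
  by (auto intro!: generated_sum star_algebra_generated.scale ew_generated)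

lemma vecs_generated_emb:
  fixes v :: "'a^'k"
  assumes "v \<in> vecs generated"
  obtains N c where "\<forall>w. N < length w \<longrightarrow> c w = 0" "v = emb N c"
proof -
  have "\<forall>k. \<exists>N c. (\<forall>w. N < length w \<longrightarrow> c w = 0) \<and> v $ k = (\<Sum>w\<in>words N. cscale (c w) (ew w))"
    using assms generated_subset_span unfolding vecs_def ew_span_def by blast
  then obtain N c where N: "\<And>k w. N k < length w \<Longrightarrow> c k w = 0"
    "\<And>k. v $ k = (\<Sum>w\<in>words (N k). cscale (c k w) (ew w))" by metis
  define M where "M = Max (range N)"
  have NM: "N k \<le> M" for k unfolding M_def by (rule Max_ge) auto
  define d :: "'n list \<Rightarrow> complex^'k" where "d w = (\<chi> k. c k w)" for w
  have "d w = 0" if "M < length w" for w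
    using N(1)[OF le_less_trans[OF NM that]] by (simp add: d_def vec_eq_iff)
  moreover have "v = emb M d"
    using ew_span_sum_eq[of "N k" "c k" M for k] N NM by (simp add: vec_eq_iff emb_def d_def)
  ultimately show ?thesis by (intro that) auto
qed

lemma csub_closure: "closed_star_subalgebra (closure generated)"
  unfolding closed_star_subalgebra_def
proof (intro conjI ballI allI)
  show "1 \<in> closure generated" using closure_subset star_algebra_generated.one by blast
  fix x y assume x: "x \<in> closure generated" and y: "y \<in> closure generated"
  obtain f where f: "\<And>n. f n \<in> generated" "f \<longlonglongrightarrow> x" using x unfolding closure_sequential by blast
  obtain g where g: "\<And>n. g n \<in> generated" "g \<longlonglongrightarrow> y" using y unfolding closure_sequential by blast
  show "x + y \<in> closure generated" unfolding closure_sequential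
    using f g tendsto_add[OF f(2) g(2)]
    by (intro exI[of _ "\<lambda>n. f n + g n"]) (auto intro: star_algebra_generated.add)
  show "x * y \<in> closure generated" unfolding closure_sequential
    using f g tendsto_mult[OF f(2) g(2)]
    by (intro exI[of _ "\<lambda>n. f n * g n"]) (auto intro: star_algebra_generated.mult)
next
  fix c x assume x: "x \<in> closure generated"
  obtain f where f: "\<And>n. f n \<in> generated" "f \<longlonglongrightarrow> x" using x unfolding closure_sequential by blast
  show "cscale c x \<in> closure generated" unfolding closure_sequential
    using f bounded_linear.tendsto[OF bounded_linear_cscale f(2)]
    by (intro exI[of _ "\<lambda>n. cscale c (f n)"]) (auto intro: star_algebra_generated.scale)
next
  fix x assume x: "x \<in> closure generated"
  obtain f where f: "\<And>n. f n \<in> generated" "f \<longlonglongrightarrow> x" using x unfolding closure_sequential by blast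
  show "star x \<in> closure generated" unfolding closure_sequential
    using f bounded_linear.tendsto[OF bounded_linear_star f(2)]
    by (intro exI[of _ "\<lambda>n. star (f n)"]) (auto intro: star_algebra_generated.star)
qed simp

text \<open>Word vectors exhaust \<open>vecs generated\<close> only; the inverses live in the
  closure, which continuity of \<tau> in norm reaches.\<close>

lemma vip_le_closure:
  fixes T :: "'a^'d^'d"
  assumes le: "\<And>v. v \<in> vecs generated \<Longrightarrow> c * vip v v \<le> vip v (T *v v)"
    and v: "v \<in> vecs (closure generated)"
  shows "c * vip v v \<le> vip v (T *v v)"
proof -
  have "\<forall>k. \<exists>f. (\<forall>n. f n \<in> generated) \<and> f \<longlonglongrightarrow> v $ k"
    using v unfolding vecs_def closure_sequential by blast
  then obtain f where f: "\<And>k n. f k n \<in> generated" "\<And>k. f k \<longlonglongrightarrow> v $ k" by metis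
  define g :: "nat \<Rightarrow> 'a^'d" where "g n = (\<chi> k. f k n)" for n
  have gk: "(\<lambda>n. g n $ k) \<longlonglongrightarrow> v $ k" for k using f(2)[of k] by (simp add: g_def)
  have gT: "(\<lambda>n. (T *v g n) $ k) \<longlonglongrightarrow> (T *v v) $ k" for k
    unfolding matrix_vector_mult_def vec_lambda_beta
    by (intro tendsto_sum tendsto_mult tendsto_const gk)
  have "(\<lambda>n. c * vip (g n) (g n)) \<longlonglongrightarrow> c * vip v v"
    unfolding vip_def by (intro tendsto_mult tendsto_const tendsto_sum tendsto_rip gk)
  moreover have "(\<lambda>n. vip (g n) (T *v g n)) \<longlonglongrightarrow> vip v (T *v v)"
    unfolding vip_def by (intro tendsto_sum tendsto_rip gk gT)
  moreover have "c * vip (g n) (g n) \<le> vip (g n) (T *v g n)" for n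
    by (rule le) (simp add: vecs_def g_def f)
  ultimately show ?thesis by (intro LIMSEQ_le) auto
qed

end

section \<open>Matrix subalgebras\<close>

text \<open>An injective linear map of a finite-dimensional space into itself is onto. This puts
  inverses into a subalgebra without polynomial calculus.\<close>

lemma subspace_mult_surjective:
  fixes q :: "complex^'d^'d"
  assumes S: "subspace S" and q: "\<And>y. y \<in> S \<Longrightarrow> q ** y \<in> S"
    and inj: "\<And>y. y \<in> S \<Longrightarrow> q ** y = 0 \<Longrightarrow> y = 0" and z: "z \<in> S"
  obtains y where "y \<in> S" "q ** y = z"
proof -
  let ?f = "\<lambda>y. q ** y"
  have lin: "linear ?f"
    by (intro linearI) (simp_all add: matrix_add_ldistrib matrix_scaleR_mult)
  have "inj_on ?f S"
  proof (rule inj_onI)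
    fix x y assume xy: "x \<in> S" "y \<in> S" "q ** x = q ** y"
    have "q ** (x - y) = 0"
      using xy(3) linear_diff[OF lin, of x y] by simp
    then show "x = y" using inj[of "x - y"] subspace_diff[OF S xy(1,2)] by simp
  qed
  then have "dim (?f ` S) = dim S"
    using lin by (intro dim_image_eq) (simp_all add: span_eq_iff[THEN iffD2, OF S])
  moreover have "?f ` S \<subseteq> S" using q by blast
  ultimately have "?f ` S = S"
    by (intro subspace_dim_equal linear_subspace_image[OF lin S] S) simp_all
  then obtain y where "y \<in> S" "q ** y = z" using z by (metis imageE)
  then show ?thesis by (rule that)
qed

lemma star_subalgebra_subspace:
  assumes S: "star_subalgebra S"
  shows "subspace S"
proof (rule subspaceI)
  show "0 \<in> S" "\<And>x y. x \<in> S \<Longrightarrow> y \<in> S \<Longrightarrow> x + y \<in> S"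
    using S unfolding star_subalgebra_def by blast+
  fix c :: real and x assume "x \<in> S"
  then have "(\<chi> i j. complex_of_real c * x $ i $ j) \<in> S" using S unfolding star_subalgebra_def by blast
  moreover have "(\<chi> i j. complex_of_real c * x $ i $ j) = c *\<^sub>R x"
    by (simp add: vec_eq_iff flip: scaleR_conv_of_real)
  ultimately show "c *\<^sub>R x \<in> S" by simp
qed

lemma star_subalgebra_mult: "star_subalgebra S \<Longrightarrow> y \<in> S \<Longrightarrow> z \<in> S \<Longrightarrow> y ** z \<in> S"
  unfolding star_subalgebra_def by blast

lemma matrix_eq_0_iff: "(M :: 'a::ring_1^'m^'d) = 0 \<longleftrightarrow> (\<forall>v. M *v v = 0)"
  using matrix_eq[of M 0] by simp

lemma posdef_mult_eq_0:
  assumes "posdef q" "q ** y = 0"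
  shows "y = 0"
proof -
  have "y = matrix_inv q ** (q ** y)" by (simp add: matrix_mul_assoc matrix_inv_left[OF assms(1)])
  also have "\<dots> = 0" unfolding assms(2) by (simp add: matrix_matrix_mult_def vec_eq_iff)
  finally show ?thesis .
qed

lemma matrix_inv_in_subalgebra:
  assumes S: "star_subalgebra S" and one: "mat 1 \<in> S" and P: "posdef P" "P \<in> S"
  shows "matrix_inv P \<in> S"
proof -
  obtain R where "R \<in> S" "P ** R = mat 1"
    using subspace_mult_surjective[OF star_subalgebra_subspace[OF S], of P "mat 1"]
      star_subalgebra_mult[OF S P(2)] posdef_mult_eq_0[OF P(1)] one by blast
  then show ?thesis using matrix_inv_eqI[OF P(1)] by simp
qed

lemma matrix_inv_uminus:
  assumes "posdef (- z)"
  shows "matrix_inv z = - matrix_inv (- z)"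
proof -
  let ?R = "- matrix_inv (- z)"
  have zR: "z ** ?R = mat 1" and Rz: "?R ** z = mat 1"
    using matrix_inv_right[OF assms] matrix_inv_left[OF assms] by (simp_all add: matrix_minus_mult)
  then have "\<exists>R. z ** R = mat 1 \<and> R ** z = mat 1" by blast
  then have "z ** matrix_inv z = mat 1 \<and> matrix_inv z ** z = mat 1"
    unfolding matrix_inv_def by (rule someI_ex)
  then have "matrix_inv z = (?R ** z) ** matrix_inv z" using Rz by simp
  also have "\<dots> = ?R" using \<open>z ** matrix_inv z = mat 1 \<and> _\<close> by (simp flip: matrix_mul_assoc)
  finally show ?thesis .
qed

text \<open>\<open>\<A>\<close> need not contain the identity; but \<open>h = \<Sum>\<^sub>j a\<^sub>j\<^sup>* a\<^sub>j \<in> \<A>\<close> has a right unit \<open>y \<in> \<A>\<close>, for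
  which \<open>a\<^sub>j y = a\<^sub>j\<close>.\<close>

lemma sum_a_cadj_in:
  fixes a :: "'n::finite \<Rightarrow> complex^'m^'d"
  assumes A: "star_subalgebra A" and one: "mat 1 \<in> B"
    and AB: "\<And>y. y \<in> A \<Longrightarrow> (\<Sum>i\<in>UNIV. a i ** y ** cadj (a i)) \<in> B"
    and BA: "\<And>z. z \<in> B \<Longrightarrow> (\<Sum>j\<in>UNIV. cadj (a j) ** z ** a j) \<in> A"
  shows "(\<Sum>i\<in>UNIV. a i ** mat 1 ** cadj (a i)) \<in> B"
proof -
  define h where "h = (\<Sum>j\<in>UNIV. cadj (a j) ** mat 1 ** a j)"
  have hA: "h \<in> A" unfolding h_def by (rule BA[OF one])
  have herm: "hermitian h" by (simp add: h_def hermitian_def cadj_sum cadj_matrix_mult)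
  \<comment> \<open>A hermitian matrix and its square have the same kernel.\<close>
  have hh: "h ** y = 0" if "h ** (h ** y) = 0" for y :: "complex^'m^'m"
    unfolding matrix_eq_0_iff
  proof
    fix u
    have "(h *v (y *v u)) \<bullet> (h *v (y *v u)) = (y *v u) \<bullet> ((h ** (h ** y)) *v u)"
      using hermitian_inner_commute[OF herm, of "y *v u"] by (simp flip: matrix_vector_mul_assoc)
    then show "(h ** y) *v u = 0" using that by (simp flip: matrix_vector_mul_assoc)
  qed
  \<comment> \<open>By \<open>hh\<close>, multiplication by \<open>h\<close> is injective on h A,
    hence onto h A; so h h = h (h y) for some \<open>y\<close> in \<open>A\<close>, and
    \<open>hh\<close> cancels one factor.\<close>
  let ?S = "(\<lambda>y. h ** y) ` A"
  have lin: "linear (\<lambda>y. h ** y)"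
    by (intro linearI) (simp_all add: matrix_add_ldistrib matrix_scaleR_mult)
  have S: "subspace ?S" by (rule linear_subspace_image[OF lin star_subalgebra_subspace[OF A]])
  obtain r where r: "r \<in> ?S" "h ** r = h ** h"
  proof (rule subspace_mult_surjective[OF S, of h "h ** h"])
    show "h ** y \<in> ?S" if "y \<in> ?S" for y using that star_subalgebra_mult[OF A hA] by blast
    show "y = 0" if "y \<in> ?S" "h ** y = 0" for y using that hh by blast
    show "h ** h \<in> ?S" using hA by blast
  qed blast
  then obtain y where y: "y \<in> A" "h ** (h ** y) = h ** h" by blast
  define e where "e = y - mat 1"
  have he: "h ** e = h ** y - h" using linear_diff[OF lin, of y "mat 1"] by (simp add: e_def)
  have "h ** (h ** e) = 0" unfolding he using linear_diff[OF lin, of "h ** y" h] y(2) by simp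
  then have e0: "h ** e = 0" by (rule hh)
  \<comment> \<open>The square lengths of the a_j e u add up to the form of \<open>h\<close> at e u,
    which is zero.\<close>
  have ae: "a j ** e = 0" for j
    unfolding matrix_eq_0_iff
  proof
    fix u
    have "(\<Sum>j\<in>UNIV. (a j *v (e *v u)) \<bullet> (a j *v (e *v u))) = (e *v u) \<bullet> (h *v (e *v u))"
      by (simp add: h_def matrix_sum_mult_vector inner_sum_right matrix_vector_mul_assoc[symmetric] inner_cadj)
    also have "\<dots> = 0" using e0 by (simp add: matrix_vector_mul_assoc)
    finally have "(a j *v (e *v u)) \<bullet> (a j *v (e *v u)) = 0"
      using sum_nonneg_eq_0_iff[of UNIV "\<lambda>j. (a j *v (e *v u)) \<bullet> (a j *v (e *v u))"] by simp
    then show "(a j ** e) *v u = 0" by (simp flip: matrix_vector_mul_assoc)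
  qed
  have "a j ** y = a j" for j
  proof -
    have "a j ** (e + mat 1) = a j" unfolding matrix_add_ldistrib ae by simp
    then show ?thesis by (simp add: e_def)
  qed
  then show ?thesis using AB[OF y(1)] by simp
qed

section \<open>The operator \<open>x x\<^sup>* + b\<close>\<close>

locale lehner = semicircular \<tau> s for \<tau> :: "'a::cstar_algebra \<Rightarrow> complex" and s :: "'n::finite \<Rightarrow> 'a" +
  fixes a :: "'n \<Rightarrow> complex^'m^'d" and b :: "complex^'d^'d"
  assumes b: "hermitian b"
begin

definition xmat :: "'a^'m^'d"
  where "xmat = (\<Sum>i\<in>UNIV. tensor (a i) (s i))"

definition op :: "'a^'d^'d"
  where "op = xmat ** cadj xmat + tensor b 1"

abbreviation shifted :: "real \<Rightarrow> real \<Rightarrow> complex^'d^'d"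
  where "shifted \<epsilon> t \<equiv> \<epsilon> *\<^sub>R (b - mat (complex_of_real t))"

lemma word_form: "\<epsilon> = 1 \<or> \<epsilon> = -1 \<Longrightarrow> word_form (shifted \<epsilon> t) \<epsilon>"
  using b by unfold_locales (auto simp: hermitian_def cadj_scaleR cadj_diff cadj_mat star_complex_def)

lemma op_hermitian: "hermitian op"
proof -
  have "cadj (tensor b 1) = tensor (cadj b) (1::'a)"
    by (simp add: vec_eq_iff tensor_def star_cscale star_complex_def)
  then show ?thesis using b by (simp add: hermitian_def op_def cadj_add cadj_matrix_mult)
qed

lemma op_in_closure: "op $ i $ j \<in> closure generated"
proof -
  note csub = csub_closure
  have s: "s k \<in> closure generated" for k
    using closure_subset[of generated] star_algebra_generated.gen[of "s k" "range s"] by auto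
  have x: "xmat $ i $ k \<in> closure generated" for i k
  proof -
    have "xmat $ i $ k = (\<Sum>l\<in>UNIV. cscale (a l $ i $ k) (s l))" by (simp add: xmat_def tensor_def)
    then show ?thesis using csub_sum[OF csub csub_cscale[OF csub s]] by simp
  qed
  have "(\<Sum>k\<in>UNIV. xmat $ i $ k * star (xmat $ j $ k)) \<in> closure generated"
    by (rule csub_sum[OF csub]) (rule csub_mult[OF csub x csub_star[OF csub x]])
  moreover have "cscale (b $ i $ j) 1 \<in> closure generated"
    by (rule csub_cscale[OF csub csub_one[OF csub]])
  moreover have "op $ i $ j = (\<Sum>k\<in>UNIV. xmat $ i $ k * star (xmat $ j $ k)) + cscale (b $ i $ j) 1"
    by (simp add: op_def matrix_matrix_mult_def tensor_def)
  ultimately show ?thesis using csub_add[OF csub] by simp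
qed

text \<open>The creation part of each \<open>s i\<close> produces the \<open>parent\<close> term,
  the annihilation part the sum over the children.\<close>

lemma cadj_xmat_emb:
  assumes c: "\<forall>w. N < length w \<longrightarrow> c w = 0"
  shows "cadj xmat *v emb N c = emb (Suc N) (word_form.up a c)"
proof -
  interpret word_form a "shifted 1 0" 1 by (rule word_form) simp
  have xc: "cadj xmat $ l $ k = (\<Sum>i\<in>UNIV. cscale (cadj (a i) $ l $ k) (s i))" for l k
    by (simp add: xmat_def star_sum tensor_def star_cscale star_complex_def)
  have "(cadj xmat *v emb N c) $ l = emb (Suc N) (up c) $ l" for l
  proof -
    define C where "C i w = (cadj (a i) *v c w) $ l" for i w
    let ?r = "\<lambda>i w. case w of [] \<Rightarrow> 0 | j # w' \<Rightarrow> if i = j then ew w' else 0"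
    have "(cadj xmat *v emb N c) $ l
        = (\<Sum>k\<in>UNIV. \<Sum>i\<in>UNIV. \<Sum>w\<in>words N. cscale (cadj (a i) $ l $ k * c w $ k) (s i * ew w))"
      unfolding matrix_vector_mult_def vec_lambda_beta xc emb_def sum_product cscale_mult_left
      by (simp only: cscale_mult_right cscale_cscale)
    also have "\<dots> = (\<Sum>i\<in>UNIV. \<Sum>k\<in>UNIV. \<Sum>w\<in>words N. cscale (cadj (a i) $ l $ k * c w $ k) (s i * ew w))"
      by (rule sum.swap)
    also have "\<dots> = (\<Sum>i\<in>UNIV. \<Sum>w\<in>words N. cscale (C i w) (s i * ew w))"
      unfolding C_def matrix_vector_mult_def vec_lambda_beta cscale_sum_left
      by (intro sum.cong refl) (rule sum.swap)
    also have "\<dots> = (\<Sum>i\<in>UNIV. \<Sum>w\<in>words N. cscale (C i w) (ew (i # w)))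
        + (\<Sum>i\<in>UNIV. \<Sum>w\<in>words N. cscale (C i w) (?r i w))"
      unfolding s_mult_ew cscale_add_right sum.distrib ..
    also have "(\<Sum>i\<in>UNIV. \<Sum>w\<in>words N. cscale (C i w) (?r i w))
        = (\<Sum>i\<in>UNIV. \<Sum>w\<in>words (Suc N). cscale (C i (i # w)) (ew w))"
    proof (rule sum.cong[OF refl])
      fix i
      \<comment> \<open>The range grows by two letters, on which the coefficients vanish, so that
        after removing one letter it is \<open>words (Suc N)\<close>.\<close>
      have "(\<Sum>w\<in>words N. cscale (C i w) (?r i w)) = (\<Sum>w\<in>words (Suc (Suc N)). cscale (C i w) (?r i w))"
        by (rule sum_words_mono[symmetric]) (simp_all add: C_def c)
      also have "\<dots> = (\<Sum>j\<in>UNIV. \<Sum>w\<in>words (Suc N). cscale (C i (j # w)) (if i = j then ew w else 0))"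
        by (subst sum_words_Cons) simp
      also have "\<dots> = (\<Sum>j\<in>UNIV. if i = j then (\<Sum>w\<in>words (Suc N). cscale (C i (i # w)) (ew w)) else 0)"
        by (intro sum.cong) auto
      finally show "(\<Sum>w\<in>words N. cscale (C i w) (?r i w)) = (\<Sum>w\<in>words (Suc N). cscale (C i (i # w)) (ew w))"
        by simp
    qed
    also have "(\<Sum>i\<in>UNIV. \<Sum>w\<in>words N. cscale (C i w) (ew (i # w)))
        = (\<Sum>w\<in>words (Suc N). cscale (parent c w $ l) (ew w))"
      by (subst sum_words_Cons) (simp add: C_def)
    also have "(\<Sum>i\<in>UNIV. \<Sum>w\<in>words (Suc N). cscale (C i (i # w)) (ew w))
        = (\<Sum>w\<in>words (Suc N). cscale (\<Sum>i\<in>UNIV. C i (i # w)) (ew w))"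
      unfolding cscale_sum_left by (rule sum.swap)
    finally show ?thesis
      by (simp add: emb_def up_def C_def cscale_add_left sum.distrib add.commute)
  qed
  then show ?thesis by (simp add: vec_eq_iff)
qed

lemma tensor_one_emb: "tensor b 1 *v emb N c = emb N (\<lambda>w. b *v c w)"
proof -
  have "(tensor b 1 *v emb N c) $ l = emb N (\<lambda>w. b *v c w) $ l" for l
  proof -
    have "(tensor b 1 *v emb N c) $ l = (\<Sum>k\<in>UNIV. \<Sum>w\<in>words N. cscale (b $ l $ k * c w $ k) (ew w))"
      by (simp add: matrix_vector_mult_def tensor_def emb_def sum_distrib_left cscale_mult_left cscale_cscale)
    also have "\<dots> = (\<Sum>w\<in>words N. \<Sum>k\<in>UNIV. cscale (b $ l $ k * c w $ k) (ew w))"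
      by (rule sum.swap)
    finally show ?thesis by (simp add: emb_def matrix_vector_mult_def cscale_sum_left)
  qed
  then show ?thesis by (simp add: vec_eq_iff)
qed

lemma mat_scaleR_mult_vector: "mat (t *\<^sub>R 1) *v v = t *\<^sub>R (v :: 'a^'d)"
  by (simp add: vec_eq_iff mat_mult_vector)

lemma mat_real_mult_vector: "mat (complex_of_real t) *v v = t *\<^sub>R v"
  by (simp add: vec_eq_iff mat_mult_vector flip: scaleR_conv_of_real)

lemma energy_emb:
  assumes sign: "\<epsilon> = 1 \<or> \<epsilon> = -1" and c: "\<forall>w. N < length w \<longrightarrow> c w = 0"
  shows "word_form.energy a (shifted \<epsilon> t) \<epsilon> N c
    = \<epsilon> * (vip (emb N c) (op *v emb N c) - t * vip (emb N c) (emb N c))"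
proof -
  interpret word_form a "shifted \<epsilon> t" \<epsilon> by (rule word_form[OF sign])
  have "vip (emb N c) (xmat *v (cadj xmat *v emb N c)) = vip (cadj xmat *v emb N c) (cadj xmat *v emb N c)"
    using vip_cadj[of "cadj xmat" "emb N c" "cadj xmat *v emb N c"] by simp
  also have "\<dots> = (\<Sum>w\<in>words (Suc N). up c w \<bullet> up c w)"
    unfolding cadj_xmat_emb[OF c] vip_emb ..
  finally have "vip (emb N c) (op *v emb N c)
      = (\<Sum>w\<in>words (Suc N). up c w \<bullet> up c w) + (\<Sum>w\<in>words N. c w \<bullet> (b *v c w))"
    by (simp add: op_def matrix_vector_mult_add_rdistrib vip_add_right tensor_one_emb vip_emb
        matrix_vector_mul_assoc[symmetric])
  then show ?thesis
    by (simp add: energy_def vip_emb matrix_scaleR_mult_vector matrix_vector_mult_diff_rdistrib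
        mat_real_mult_vector inner_diff_right right_diff_distrib sum_subtractf sum_distrib_left
        distrib_left)
qed

text \<open>The dictionary between \<open>z\<close> and \<open>P\<close>: the last identity turns a
  bound by \<open>t\<close> on the matrix of \<open>z\<close> into the hypothesis of
  \<open>energy_lower_bound\<close>, and equality with \<open>t\<close> into the fixed-point
  equation.\<close>

lemma lehner_matrix_eq_psi:
  assumes sign: "\<epsilon> = 1 \<or> \<epsilon> = -1" and z: "posdef (- \<epsilon> *\<^sub>R z)"
  defines "P \<equiv> matrix_inv (- \<epsilon> *\<^sub>R z)"
  shows "posdef P" "z = - \<epsilon> *\<^sub>R matrix_inv P"
    and "mat 1 + \<epsilon> *\<^sub>R word_form.kap a P = mat 1 - (\<Sum>j\<in>UNIV. cadj (a j) ** z ** a j)"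
    and "word_form.psi a (shifted \<epsilon> t) \<epsilon> (word_form.om \<epsilon> (word_form.kap a P))
      = P + \<epsilon> *\<^sub>R (lehner_matrix a b z - mat (complex_of_real t))"
proof -
  interpret word_form a "shifted \<epsilon> t" \<epsilon> by (rule word_form[OF sign])
  show P: "posdef P" unfolding P_def by (rule posdef_matrix_inv[OF z])
  have iP: "matrix_inv P = - \<epsilon> *\<^sub>R z"
    by (rule matrix_inv_eqI[OF P]) (simp only: P_def matrix_inv_left[OF z])
  show zP: "z = - \<epsilon> *\<^sub>R matrix_inv P" unfolding iP by simp
  have iz: "matrix_inv z = - \<epsilon> *\<^sub>R P"
    using sign matrix_inv_uminus[of z] z by (auto simp: P_def)
  have "\<epsilon> *\<^sub>R kap P = - (\<Sum>j\<in>UNIV. cadj (a j) ** z ** a j)"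
    using sign by (auto simp: kap_def iP matrix_minus_mult sum_negf)
  then show Q: "mat 1 + \<epsilon> *\<^sub>R kap P = mat 1 - (\<Sum>j\<in>UNIV. cadj (a j) ** z ** a j)" by simp
  have "lehner_matrix a b z = b - \<epsilon> *\<^sub>R P + (\<Sum>i\<in>UNIV. a i ** om (kap P) ** cadj (a i))"
    unfolding lehner_matrix_def iz om_def Q by simp
  then show "psi (om (kap P)) = P + \<epsilon> *\<^sub>R (lehner_matrix a b z - mat (complex_of_real t))"
    unfolding psi_def by (simp add: scaleR_right_diff_distrib scaleR_right_distrib)
qed

lemma lehner_hermitian:
  assumes sign: "\<epsilon> = 1 \<or> \<epsilon> = -1" and z: "posdef (- \<epsilon> *\<^sub>R z)"
    and Q: "posdef (mat 1 - (\<Sum>j\<in>UNIV. cadj (a j) ** z ** a j))"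
  shows "hermitian (lehner_matrix a b z)"
proof -
  interpret word_form a "shifted \<epsilon> 0" \<epsilon> by (rule word_form[OF sign])
  define P where "P = matrix_inv (- \<epsilon> *\<^sub>R z)"
  note eq = lehner_matrix_eq_psi(1-3)[OF sign z, folded P_def]
    and eq4 = lehner_matrix_eq_psi(4)[OF sign z, of 0, folded P_def]
  have "hermitian (om (kap P))" unfolding om_def eq(3) using posdefD(1)[OF posdef_matrix_inv[OF Q]] .
  then have "hermitian (psi (om (kap P)))" by (rule hermitian_psi)
  moreover have "hermitian P" by (rule posdefD(1)[OF eq(1)])
  moreover have "lehner_matrix a b z = \<epsilon> *\<^sub>R (psi (om (kap P)) - P)"
    unfolding eq4 using sign by auto
  ultimately show ?thesis by (simp add: hermitian_def cadj_scaleR cadj_diff)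
qed

text \<open>The easy half: each admissible \<open>z\<close> certifies a bound, by
  \<open>energy_lower_bound\<close> with constant 0 on word vectors and then by density.\<close>

lemma lehner_bound:
  assumes sign: "\<epsilon> = 1 \<or> \<epsilon> = -1" and z: "posdef (- \<epsilon> *\<^sub>R z)"
    and Q: "posdef (mat 1 - (\<Sum>j\<in>UNIV. cadj (a j) ** z ** a j))"
    and t: "\<And>u. 0 \<le> \<epsilon> * (u \<bullet> (lehner_matrix a b z *v u) - t * (u \<bullet> u))"
    and v: "v \<in> vecs (closure generated)"
  shows "0 \<le> \<epsilon> * (vip v (op *v v) - t * vip v v)"
proof -
  interpret word_form a "shifted \<epsilon> t" \<epsilon> by (rule word_form[OF sign])
  define P where "P = matrix_inv (- \<epsilon> *\<^sub>R z)"
  note eq = lehner_matrix_eq_psi(1-3)[OF sign z, folded P_def]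
    and eq4 = lehner_matrix_eq_psi(4)[OF sign z, of t, folded P_def]
  have le: "u \<bullet> (P *v u) + 0 * (u \<bullet> u) \<le> u \<bullet> (psi (om (kap P)) *v u)" for u
    unfolding eq4 using t[of u]
    by (simp add: matrix_vector_mult_add_rdistrib matrix_scaleR_mult_vector inner_add_right
        matrix_vector_mult_diff_rdistrib mat_real_mult_vector inner_diff_right)
  have gen: "0 * vip v v \<le> vip v ((\<epsilon> *\<^sub>R (op - mat (t *\<^sub>R 1))) *v v)" if v: "v \<in> vecs generated" for v
  proof -
    obtain N c where c: "\<forall>w. N < length w \<longrightarrow> c w = 0" "v = emb N c"
      using vecs_generated_emb[OF v] by blast
    have "supported N c" using c(1) by (simp add: supported_def)
    from energy_lower_bound[OF eq(1) Q[folded eq(3)] le this]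
    have "0 \<le> energy N c" by simp
    then show ?thesis unfolding energy_emb[OF sign c(1)] c(2)
      by (simp add: matrix_scaleR_mult_vector matrix_vector_mult_diff_rdistrib mat_scaleR_mult_vector
          vip_scaleR_right vip_diff_right)
  qed
  from vip_le_closure[OF gen v] show ?thesis
    by (simp add: matrix_scaleR_mult_vector matrix_vector_mult_diff_rdistrib mat_scaleR_mult_vector
          vip_scaleR_right vip_diff_right)
qed

text \<open>The hard half: a gap \<delta> between \<open>t\<close> and the form yields an admissible
  \<open>z\<close> whose matrix is exactly \<open>t\<close>. \<open>B\<close> is closed, being a
  finite-dimensional subspace, and it is invariant under the iteration.\<close>

lemma lehner_attained:
  assumes sign: "\<epsilon> = 1 \<or> \<epsilon> = -1" and \<delta>: "0 < \<delta>"
    and coercive: "\<And>v. v \<in> vecs (closure generated) \<Longrightarrow>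
      \<delta> * vip v v \<le> \<epsilon> * (vip v (op *v v) - t * vip v v)"
    and A: "star_subalgebra A" and B: "star_subalgebra B" "mat 1 \<in> B" "b \<in> B"
    and AB: "\<And>y. y \<in> A \<Longrightarrow> (\<Sum>i\<in>UNIV. a i ** y ** cadj (a i)) \<in> B"
    and BA: "\<And>z. z \<in> B \<Longrightarrow> (\<Sum>j\<in>UNIV. cadj (a j) ** z ** a j) \<in> A"
  obtains z where "z \<in> B" "posdef (- \<epsilon> *\<^sub>R z)"
    "posdef (mat 1 - (\<Sum>j\<in>UNIV. cadj (a j) ** z ** a j))"
    "lehner_matrix a b z = mat (complex_of_real t)"
proof -
  interpret word_form a "shifted \<epsilon> t" \<epsilon> by (rule word_form[OF sign])
  have sB: "subspace B" and sA: "subspace A"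
    using star_subalgebra_subspace A B(1) by blast+
  have en: "\<delta> * (\<Sum>w\<in>words N. v w \<bullet> v w) \<le> energy N v" if v: "supported N v" for N v
  proof -
    have v': "\<forall>w. N < length w \<longrightarrow> v w = 0" using v by (simp add: supported_def)
    have "emb N v \<in> vecs (closure generated)"
      using emb_in_vecs[of N v] closure_subset unfolding vecs_def by blast
    from coercive[OF this] show ?thesis unfolding energy_emb[OF sign v'] vip_emb .
  qed
  have one: "(\<Sum>i\<in>UNIV. a i ** mat 1 ** cadj (a i)) \<in> B"
    by (rule sum_a_cadj_in[OF A B(2) AB BA])
  have mt: "mat (complex_of_real t) \<in> B"
  proof -
    have "mat (complex_of_real t) = t *\<^sub>R (mat 1 :: complex^'d^'d)"
      by (simp add: vec_eq_iff mat_def of_real_def)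
    then show ?thesis using subspace_scale[OF sB B(2)] by simp
  qed
  have DB: "shifted \<epsilon> t \<in> B" by (intro subspace_scale[OF sB] subspace_diff[OF sB] B(3) mt)
  have psiB: "psi W \<in> B" if "(\<Sum>i\<in>UNIV. a i ** W ** cadj (a i)) \<in> B" for W
    unfolding psi_def by (intro subspace_add[OF sB] subspace_scale[OF sB] DB that)
  have step: "psi (om (kap P)) \<in> B"
    if P: "P \<in> B" "posdef P" and Q: "posdef (mat 1 + \<epsilon> *\<^sub>R kap P)" for P
  proof -
    have kA: "kap P \<in> A"
      unfolding kap_def by (rule BA[OF matrix_inv_in_subalgebra[OF B(1,2) P(2,1)]])
    \<comment> \<open>\<open>A\<close> may lack the identity, so the inverse of 1 + \<epsilon>
      \<kappa> is sought among real multiples of the identity plus elements of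
      \<open>A\<close>.\<close>
    define A1 where "A1 = {r *\<^sub>R mat 1 + y | r y. y \<in> A}"
    have A1I: "r *\<^sub>R mat 1 + y \<in> A1" if "y \<in> A" for r y using that unfolding A1_def by blast
    have sA1: "subspace A1"
    proof (rule subspaceI)
      show "0 \<in> A1" using A1I[OF subspace_0[OF sA], of 0] by simp
      show "x + y \<in> A1" if xy: "x \<in> A1" "y \<in> A1" for x y
      proof -
        obtain r u where "x = r *\<^sub>R mat 1 + u" "u \<in> A" using xy(1) unfolding A1_def by blast
        moreover obtain r' u' where "y = r' *\<^sub>R mat 1 + u'" "u' \<in> A"
          using xy(2) unfolding A1_def by blast
        ultimately show ?thesis using A1I[OF subspace_add[OF sA], of u u' "r + r'"]
          by (simp add: scaleR_left_distrib add_ac)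
      qed
      show "c *\<^sub>R x \<in> A1" if x: "x \<in> A1" for c x
      proof -
        obtain r u where "x = r *\<^sub>R mat 1 + u" "u \<in> A" using x unfolding A1_def by blast
        then show ?thesis using A1I[OF subspace_scale[OF sA], of u "c * r" c]
          by (simp add: scaleR_right_distrib)
      qed
    qed
    obtain R where R: "R \<in> A1" "(mat 1 + \<epsilon> *\<^sub>R kap P) ** R = mat 1"
    proof (rule subspace_mult_surjective[OF sA1, of "mat 1 + \<epsilon> *\<^sub>R kap P" "mat 1"])
      show "(mat 1 + \<epsilon> *\<^sub>R kap P) ** x \<in> A1" if xA: "x \<in> A1" for x
      proof -
        obtain r u where x: "x = r *\<^sub>R mat 1 + u" "u \<in> A" using xA unfolding A1_def by blast
        have "\<epsilon> *\<^sub>R kap P ** x = (\<epsilon> * r) *\<^sub>R kap P + \<epsilon> *\<^sub>R (kap P ** u)"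
          by (simp add: x(1) matrix_add_ldistrib matrix_scaleR_mult)
        then have "(mat 1 + \<epsilon> *\<^sub>R kap P) ** x
            = r *\<^sub>R mat 1 + (u + (\<epsilon> * r) *\<^sub>R kap P + \<epsilon> *\<^sub>R (kap P ** u))"
          by (simp add: x(1) matrix_add_rdistrib)
        then show ?thesis
          using A1I[OF subspace_add[OF sA subspace_add[OF sA x(2) subspace_scale[OF sA kA]]
                subspace_scale[OF sA star_subalgebra_mult[OF A kA x(2)]]]] by simp
      qed
      show "y = 0" if "(mat 1 + \<epsilon> *\<^sub>R kap P) ** y = 0" for y by (rule posdef_mult_eq_0[OF Q that])
      show "mat 1 \<in> A1" using A1I[OF subspace_0[OF sA], of 1] by simp
    qed blast
    then have "om (kap P) = R" unfolding om_def by (intro matrix_inv_eqI[OF Q])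
    moreover obtain r u where u: "R = r *\<^sub>R mat 1 + u" "u \<in> A" using R(1) unfolding A1_def by blast
    \<comment> \<open>The scalar part of \<open>R\<close> is mapped into \<open>B\<close> by
      \<open>sum_a_cadj_in\<close>, the remainder by the hypothesis on \<open>A\<close>.\<close>
    have "(\<Sum>i\<in>UNIV. a i ** R ** cadj (a i))
        = r *\<^sub>R (\<Sum>i\<in>UNIV. a i ** mat 1 ** cadj (a i)) + (\<Sum>i\<in>UNIV. a i ** u ** cadj (a i))"
      by (simp add: u(1) matrix_add_ldistrib matrix_add_rdistrib matrix_scaleR_mult
          sum.distrib scaleR_sum_right)
    then have "(\<Sum>i\<in>UNIV. a i ** R ** cadj (a i)) \<in> B"
      using subspace_add[OF sB subspace_scale[OF sB one] AB[OF u(2)]] by simp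
    ultimately show ?thesis by (intro psiB) simp
  qed
  obtain P where P: "P \<in> B" "posdef P" "posdef (mat 1 + \<epsilon> *\<^sub>R kap P)" "psi (om (kap P)) = P"
    using fixed_point_exists[OF \<delta> en closed_subspace[OF sB] psiB[OF one] step] by blast
  define z where "z = - \<epsilon> *\<^sub>R matrix_inv P"
  have ez: "- \<epsilon> *\<^sub>R z = matrix_inv P" by (simp add: z_def)
  have pz: "posdef (- \<epsilon> *\<^sub>R z)" unfolding ez by (rule posdef_matrix_inv[OF P(2)])
  have Pz: "matrix_inv (- \<epsilon> *\<^sub>R z) = P"
    by (rule matrix_inv_eqI[OF pz]) (simp only: ez matrix_inv_left[OF P(2)])
  note eq = lehner_matrix_eq_psi(1-3)[OF sign pz, unfolded Pz]
    and eq4 = lehner_matrix_eq_psi(4)[OF sign pz, of t, unfolded Pz]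
  show ?thesis
  proof (rule that)
    show "z \<in> B" unfolding z_def
      by (rule subspace_scale[OF sB matrix_inv_in_subalgebra[OF B(1,2) P(2,1)]])
    show "posdef (- \<epsilon> *\<^sub>R z)" by (rule pz)
    show "posdef (mat 1 - (\<Sum>j\<in>UNIV. cadj (a j) ** z ** a j))" using P(3) unfolding eq(3) .
    show "lehner_matrix a b z = mat (complex_of_real t)"
      using eq4 P(4) sign by auto
  qed
qed

end

text \<open>For negative \<open>z\<close> the matrix is at least the identity; the second constraint
  is thus automatic in the formula for the smallest spectral value.\<close>

lemma posdef_one_minus:
  fixes a :: "'n::finite \<Rightarrow> complex^'m^'d"
  assumes "posdef (- z)"
  shows "posdef (mat 1 - (\<Sum>j\<in>UNIV. cadj (a j) ** z ** a j))"
proof (rule coercive_imp_posdef[where c = 1])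
  have "cadj z = z" using posdefD(1)[OF assms] by (simp add: hermitian_def cadj_minus)
  then show "hermitian (mat 1 - (\<Sum>j\<in>UNIV. cadj (a j) ** z ** a j))"
    by (simp add: hermitian_def cadj_diff cadj_mat cadj_sum cadj_matrix_mult matrix_mul_assoc)
  fix v :: "complex^'m"
  have "(a j *v v) \<bullet> (z *v (a j *v v)) \<le> 0" for j
    using posdefD(2)[OF assms, of "a j *v v"] by (simp add: matrix_minus_mult_vector)
  then have "(\<Sum>j\<in>UNIV. (a j *v v) \<bullet> (z *v (a j *v v))) \<le> 0" by (intro sum_nonpos)
  then show "1 * (v \<bullet> v) \<le> v \<bullet> ((mat 1 - (\<Sum>j\<in>UNIV. cadj (a j) ** z ** a j)) *v v)"
    by (simp add: matrix_vector_mult_diff_rdistrib inner_diff_right matrix_sum_mult_vector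
        inner_sum_right matrix_vector_mul_assoc[symmetric] inner_cadj)
qed simp

theorem lemma1p4:
  fixes a :: "'n::finite \<Rightarrow> complex^'m^'d"
    and b :: "complex^'d^'d"
    and \<tau> :: "'a::cstar_algebra \<Rightarrow> complex"
    and s :: "'n \<Rightarrow> 'a"
    and x :: "'a^'m^'d"
    and A :: "(complex^'m^'m) set"
    and B :: "(complex^'d^'d) set"
  assumes "faithful_tracial_state \<tau>"
    and "free_semicircular_family \<tau> s"
    and "hermitian b"
    and "x = (\<Sum>i\<in>UNIV. tensor (a i) (s i))"
    and "star_subalgebra A"
    and "star_subalgebra B"
    and "mat 1 \<in> B"
    and "b \<in> B"
    and "\<And>y. y \<in> A \<Longrightarrow> (\<Sum>i\<in>UNIV. a i ** y ** cadj (a i)) \<in> B"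
    and "\<And>z. z \<in> B \<Longrightarrow> (\<Sum>j\<in>UNIV. cadj (a j) ** z ** a j) \<in> A"
  shows "(ereal (lambda_max (x ** cadj x + tensor b 1)) =
      (INF z\<in>{z\<in>B. posdef z \<and> posdef (mat 1 - (\<Sum>j\<in>UNIV. cadj (a j) ** z ** a j))}.
        ereal (lambda_max (lehner_matrix a b z)))) \<and>
    (ereal (lambda_min (x ** cadj x + tensor b 1)) =
      (SUP z\<in>{z\<in>B. posdef (- z)}. ereal (lambda_min (lehner_matrix a b z)))) \<and>
    (ereal (lambda_max (x ** cadj x + tensor b 1)) =
      (INF z\<in>{z\<in>B. posdef z \<and> posdef (mat 1 - (\<Sum>j\<in>UNIV. cadj (a j) ** z ** a j)) \<and>
          (\<exists>c. lehner_matrix a b z = mat c)}.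
        ereal (lambda_max (lehner_matrix a b z)))) \<and>
    (ereal (lambda_min (x ** cadj x + tensor b 1)) =
      (SUP z\<in>{z\<in>B. posdef (- z) \<and> (\<exists>c. lehner_matrix a b z = mat c)}.
        ereal (lambda_min (lehner_matrix a b z))))"
proof -
  interpret lehner \<tau> s a b by unfold_locales (rule assms)+
  have X: "x ** cadj x + tensor b 1 = op" unfolding op_def xmat_def assms(4) ..
  let ?C = "closure generated"
  let ?L = "lehner_matrix a b"
  let ?Q = "\<lambda>z. mat 1 - (\<Sum>j\<in>UNIV. cadj (a j) ** z ** a j)"
  note attained = lehner_attained[OF _ _ _ assms(5-8) assms(9,10)]
  have op_max: "v \<in> vecs ?C \<Longrightarrow> vip v (op *v v) \<le> lambda_max op * vip v v"
    and op_max_le: "(\<And>v. v \<in> vecs ?C \<Longrightarrow> vip v (op *v v) \<le> l * vip v v) \<Longrightarrow> lambda_max op \<le> l" for v l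
    using lambda_max_upper[OF csub_closure op_hermitian op_in_closure]
      lambda_max_least[OF csub_closure op_hermitian op_in_closure] by blast+
  \<comment> \<open>The smallest spectral value is treated as the largest one of
    \<open>- op\<close>.\<close>
  have mh: "hermitian (- op)" "(- op) $ i $ j \<in> ?C" for i j
    using op_hermitian op_in_closure[of i j] csub_minus[OF csub_closure]
    by (auto simp: hermitian_def cadj_minus)
  have op_min: "lambda_min op * vip v v \<le> vip v (op *v v)" if "v \<in> vecs ?C" for v
    using lambda_max_upper[OF csub_closure mh that]
    by (simp add: lambda_min_eq matrix_minus_mult_vector vip_minus_right)
  have op_min_ge: "l \<le> lambda_min op" if "\<And>v. v \<in> vecs ?C \<Longrightarrow> l * vip v v \<le> vip v (op *v v)" for l
    using lambda_max_least[OF csub_closure mh, of "- l"] that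
    by (simp add: lambda_min_eq matrix_minus_mult_vector vip_minus_right)

  have max_le: "lambda_max op \<le> lambda_max (?L z)" if z: "posdef z" "posdef (?Q z)" for z
  proof (rule op_max_le)
    fix v :: "'a^'d" assume v: "v \<in> vecs ?C"
    have h: "hermitian (?L z)" using lehner_hermitian[of "-1" z] z by simp
    show "vip v (op *v v) \<le> lambda_max (?L z) * vip v v"
      using lehner_bound[of "-1" z "lambda_max (?L z)" v] z v complex_lambda_max_upper[OF h] by simp
  qed
  \<comment> \<open>The gap \<open>t - lambda_max op\<close> serves as the coercivity
    constant.\<close>
  have max_attained: "\<exists>z\<in>B. posdef z \<and> posdef (?Q z) \<and> ?L z = mat (complex_of_real t)"
    if t: "lambda_max op < t" for t
  proof -
    have "(t - lambda_max op) * vip v v \<le> -1 * (vip v (op *v v) - t * vip v v)" if "v \<in> vecs ?C" for v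
      using op_max[OF that] by (simp add: left_diff_distrib)
    from attained[OF _ _ this] t show ?thesis by force
  qed
  have min_ge: "lambda_min (?L z) \<le> lambda_min op" if z: "posdef (- z)" for z
  proof (rule op_min_ge)
    fix v :: "'a^'d" assume v: "v \<in> vecs ?C"
    have Q: "posdef (?Q z)" by (rule posdef_one_minus[OF z])
    have h: "hermitian (- ?L z)"
      using lehner_hermitian[of 1 z] z Q by (simp add: hermitian_def cadj_minus)
    have "lambda_min (?L z) * (u \<bullet> u) \<le> u \<bullet> (?L z *v u)" for u
      using complex_lambda_max_upper[OF h, of u] by (simp add: lambda_min_eq matrix_minus_mult_vector)
    then show "lambda_min (?L z) * vip v v \<le> vip v (op *v v)"
      using lehner_bound[of 1 z "lambda_min (?L z)" v] z Q v by simp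
  qed
  have min_attained: "\<exists>z\<in>B. posdef (- z) \<and> ?L z = mat (complex_of_real t)"
    if t: "t < lambda_min op" for t
  proof -
    have "(lambda_min op - t) * vip v v \<le> 1 * (vip v (op *v v) - t * vip v v)" if "v \<in> vecs ?C" for v
      using op_min[OF that] by (simp add: left_diff_distrib)
    from attained[OF _ _ this] t show ?thesis by force
  qed
  have max_mat: "lambda_max (mat (complex_of_real t) :: complex^'d^'d) \<le> t" for t
    by (rule complex_lambda_max_least)
       (simp_all add: hermitian_def cadj_mat star_complex_def mat_real_mult_vector)
  have min_mat: "t \<le> lambda_min (mat (complex_of_real t) :: complex^'d^'d)" for t
  proof -
    have "lambda_max (- mat (complex_of_real t) :: complex^'d^'d) \<le> - t"
      by (rule complex_lambda_max_least)
         (simp_all add: hermitian_def cadj_minus cadj_mat star_complex_def mat_real_mult_vector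
            matrix_minus_mult_vector)
    then show ?thesis by (simp add: lambda_min_eq)
  qed

  \<comment> \<open>One argument for both index sets: any \<open>Z\<close> will do that satisfies
    the constraints and contains all admissible \<open>z\<close> whose matrix is a real multiple of
    the identity.\<close>
  have INF_eq: "ereal (lambda_max op) = (INF z\<in>Z. ereal (lambda_max (?L z)))"
    if Z: "\<And>z. z \<in> Z \<Longrightarrow> posdef z \<and> posdef (?Q z)"
      "\<And>z t. z \<in> B \<Longrightarrow> posdef z \<Longrightarrow> posdef (?Q z) \<Longrightarrow> ?L z = mat (complex_of_real t) \<Longrightarrow> z \<in> Z" for Z
  proof (rule antisym)
    show "ereal (lambda_max op) \<le> (INF z\<in>Z. ereal (lambda_max (?L z)))"
      using Z(1) max_le by (intro INF_greatest) auto
    show "(INF z\<in>Z. ereal (lambda_max (?L z))) \<le> ereal (lambda_max op)"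
    \<comment> \<open>Attainment is available only strictly above the spectrum, so the infimum is
      approached by the values \<open>lambda_max op + e\<close>.\<close>
    proof (rule ereal_le_epsilon2)
      fix e :: real assume "0 < e"
      then obtain z where z: "z \<in> B" "posdef z" "posdef (?Q z)"
        "?L z = mat (complex_of_real (lambda_max op + e))"
        using max_attained[of "lambda_max op + e"] by auto
      have "z \<in> Z" using z by (rule Z(2))
      then show "(INF z\<in>Z. ereal (lambda_max (?L z))) \<le> ereal (lambda_max op) + ereal e"
        using z(4) max_mat[of "lambda_max op + e"] by (intro INF_lower2[of z]) auto
    qed
  qed
  have SUP_eq: "ereal (lambda_min op) = (SUP z\<in>Z. ereal (lambda_min (?L z)))"
    if Z: "\<And>z. z \<in> Z \<Longrightarrow> posdef (- z)"
      "\<And>z t. z \<in> B \<Longrightarrow> posdef (- z) \<Longrightarrow> ?L z = mat (complex_of_real t) \<Longrightarrow> z \<in> Z" for Z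
  proof (rule antisym)
    show "(SUP z\<in>Z. ereal (lambda_min (?L z))) \<le> ereal (lambda_min op)"
      using Z(1) min_ge by (intro SUP_least) auto
    show "ereal (lambda_min op) \<le> (SUP z\<in>Z. ereal (lambda_min (?L z)))"
    proof (rule ereal_le_epsilon2)
      fix e :: real assume "0 < e"
      then obtain z where z: "z \<in> B" "posdef (- z)" "?L z = mat (complex_of_real (lambda_min op - e))"
        using min_attained[of "lambda_min op - e"] by auto
      have "z \<in> Z" using z by (rule Z(2))
      then have "ereal (lambda_min op - e) \<le> (SUP z\<in>Z. ereal (lambda_min (?L z)))"
        using z(3) min_mat[of "lambda_min op - e"] by (intro SUP_upper2[of z]) auto
      then have "ereal (lambda_min op - e) + ereal e \<le> (SUP z\<in>Z. ereal (lambda_min (?L z))) + ereal e"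
        by (rule add_right_mono)
      then show "ereal (lambda_min op) \<le> (SUP z\<in>Z. ereal (lambda_min (?L z))) + ereal e" by simp
    qed
  qed
  show ?thesis
    unfolding X by (intro conjI INF_eq SUP_eq) auto
qed

end
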